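(* Suppose assumptions (A1)–(A3) and (A5) of the context hold, and run META-STORM (defined in the context) for $T$ iterations with $p\in[\frac{3-\sqrt7}2,\frac12]$, $p+2q=1$. Let $\hat p=\frac{3(1-p)}{4-p}\in[\frac37,\sqrt7-2]$. Then $$\mathbb E\big[\|\nabla F(x_{\rm out})\|^{2\hat p}\big]=O\Big((F(x_1)-F^* )^{\frac{\hat p}{1-p}}+\beta^{\frac{\hat p}{p}}\log^{\frac{\hat p}{1-p}}\beta+\beta^{\frac{\hat p}{p}}\log^{\frac{\hat p}{1-p}}(1+\sigma^2T)\Big)\Big(\frac1{T^{\hat p}}+\frac{\sigma^{2\hat p/3}}{T^{2\hat p/3}}\Big).$$
   Context: Setting. $\mathcal D$ is a probability distribution; for each $\xi\in\mathrm{support}(\mathcal D)$, $f(\cdot,\xi):\mathbb R^d\to\mathbb R$ is differentiable; $F(x)=\mathbb E_{\xi\sim\mathcal D}[f(x,\xi)]$ (possibly non-convex), differentiable. $\|\cdot\|$ is the Euclidean norm, $[T]=\{1,\dots,T\}$; $\log^{r}(u)$ means $(\log u)^r$. In the first factor, $O(\cdot)$ indicates only the dependency on $\beta$ and $F(x_1)-F^*$ (besides $\log(1+\sigma^2T)$); dependency on the other parameters is suppressed. Assumptions. (A1) $F^*:=\inf_x F(x)>-\infty$. (A2) $\mathbb E_\xi[\nabla f(x,\xi)]=\nabla F(x)$ and $\mathbb E_\xi\|\nabla f(x,\xi)-\nabla F(x)\|^2\le\sigma^2$ for all $x$, with $\sigma\ge0$. (A3) $\mathbb E_\xi\|\nabla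 f(x,\xi)-\nabla f(y,\xi)\|^2\le\beta^2\|x-y\|^2$ for all $x,y\in\mathbb R^d$. (A5) $\|\nabla f(x,\xi)-\nabla f(x,\xi')\|\le2\widehat\sigma$ for all $x\in\mathbb R^d$, $\xi,\xi'\in\mathrm{support}(\mathcal D)$, with $\widehat\sigma\ge0$. Algorithm META-STORM. Input: $x_1\in\mathbb R^d$; parameters $a_0,b_0,\eta>0$, $p\in[\frac{3-\sqrt7}2,\frac12]$, $q$ with $p+2q=1$. Let $\xi_1,\xi_2,\dots$ be i.i.d. from $\mathcal D$, $d_1=\nabla f(x_1,\xi_1)$, $a_1=1$. For $t=1,\dots,T$: $b_t=\big(b_0^{1/p}+\sum_{i=1}^t\|d_i\|^2\big)^p/a_t^q$; $x_{t+1}=x_t-\frac{\eta}{b_t}d_t$; $a_{t+1}=\big(1+\sum_{i=1}^t\|\nabla f(x_i,\xi_i)-\nabla f(x_i,\xi_{i+1})\|^2/a_0^2\big)^{-2/3}$; $d_{t+1}=\nabla f(x_{t+1},\xi_{t+1})+(1-a_{t+1})(d_t-\nabla f(x_t,\xi_{t+1}))$. Output $x_{\rm out}=x_t$ with $t$ uniform on $[T]$.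
   Formalization: The bound is proved for all β ≥ β0, for every fixed β0 > 1, with the hidden constant depending on β0, since the power of log β is undefined for β < 1 and the bound fails with a uniform constant as β approaches 1. *)

theory Defs
  imports "HOL-Probability.Probability"
begin

definition gradient :: "('a::euclidean_space \<Rightarrow> real) \<Rightarrow> 'a \<Rightarrow> 'a" where
  "gradient h x = (THE g. GDERIV h x :> g)"

lemma gradient_eqI:
  assumes "GDERIV h x :> g"
  shows "gradient h x = g"
  unfolding gradient_def
proof (rule the_equality)
  fix g' assume "GDERIV h x :> g'"
  then have "(\<lambda>v. inner v g') = (\<lambda>v. inner v g)"
    using assms has_derivative_unique unfolding gderiv_def by blast
  then show "g' = g"
    by (metis vector_eq_ldot)
qed (fact assms)

text \<open>Topological support. If the topology is second countable and \<open>D\<close> is a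
  Borel measure, the support is closed and carries all the mass.\<close>

definition msupport :: "'b::topological_space measure \<Rightarrow> 'b set" where
  "msupport D = {\<xi>. \<forall>U. open U \<longrightarrow> \<xi> \<in> U \<longrightarrow> 0 < emeasure D U}"

lemma AE_in_msupport:
  fixes D :: "'b::second_countable_topology measure"
  assumes D: "sets D = sets borel"
  shows "AE \<xi> in D. \<xi> \<in> msupport D"
proof -
  obtain B :: "'b set set" where B: "countable B" "topological_basis B"
    using ex_countable_basis by blast
  have null: "(\<Union>{U \<in> B. emeasure D U = 0}) \<in> null_sets D"
  proof (rule null_sets_UN'[where N = "\<lambda>U. U" and I = "{U \<in> B. emeasure D U = 0}", simplified])
    show "countable {U \<in> B. emeasure D U = 0}"
      using B(1) by simp
    show "U \<in> null_sets D" if "U \<in> B \<and> emeasure D U = 0" for U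
      using that B(2) D by (auto simp: null_sets_def topological_basis_open)
  qed
  moreover have "{\<xi> \<in> space D. \<xi> \<notin> msupport D} \<subseteq> \<Union>{U \<in> B. emeasure D U = 0}"
  proof
    fix \<xi> assume "\<xi> \<in> {\<xi> \<in> space D. \<xi> \<notin> msupport D}"
    then obtain U where U: "open U" "\<xi> \<in> U" "emeasure D U = 0"
      by (auto simp: msupport_def)
    from topological_basisE[OF B(2) U(1,2)]
    obtain V where V: "V \<in> B" "\<xi> \<in> V" "V \<subseteq> U" .
    have "emeasure D V \<le> emeasure D U"
      using V(3) U(1) D by (intro emeasure_mono) auto
    then show "\<xi> \<in> \<Union>{U \<in> B. emeasure D U = 0}"
      using U(3) V by auto
  qed
  ultimately show ?thesis
    by (rule AE_I')
qed

definition objective :: "'b measure \<Rightarrow> ('a \<Rightarrow> 'b \<Rightarrow> real) \<Rightarrow> 'a \<Rightarrow> real" where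
  "objective D f x = integral\<^sup>L D (f x)"

text \<open>The gradient of \<open>f (\<cdot>, \<xi>)\<close> in the first argument. It is only meaningful for \<open>\<xi>\<close> in
  the support; the value \<open>0\<close> on the complementary null set keeps it Borel measurable in \<open>\<xi>\<close>.\<close>

definition sgrad ::
  "'b::topological_space measure \<Rightarrow> ('a::euclidean_space \<Rightarrow> 'b \<Rightarrow> real) \<Rightarrow> 'a \<Rightarrow> 'b \<Rightarrow> 'a" where
  "sgrad D f x \<xi> = (if \<xi> \<in> msupport D then gradient (\<lambda>y. f y \<xi>) x else 0)"

definition stochastic_objective ::
  "'b::topological_space measure \<Rightarrow> ('a::euclidean_space \<Rightarrow> 'b \<Rightarrow> real) \<Rightarrow> bool" where
  "stochastic_objective D f \<longleftrightarrow>
     prob_space D \<and> sets D = sets borel \<and>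
     (\<forall>\<xi>\<in>msupport D. \<forall>x. (\<lambda>y. f y \<xi>) differentiable (at x)) \<and>
     (\<forall>x. integrable D (f x)) \<and>
     (\<forall>x. objective D f differentiable (at x))"

definition bounded_below ::
  "'b measure \<Rightarrow> ('a \<Rightarrow> 'b \<Rightarrow> real) \<Rightarrow> bool" where
  "bounded_below D f \<longleftrightarrow> bdd_below (range (objective D f))"

definition unbiased_bounded_variance ::
  "'b::topological_space measure \<Rightarrow> ('a::euclidean_space \<Rightarrow> 'b \<Rightarrow> real) \<Rightarrow> real \<Rightarrow> bool" where
  "unbiased_bounded_variance D f \<sigma> \<longleftrightarrow>
     (\<forall>x. integrable D (sgrad D f x) \<and>
          integral\<^sup>L D (sgrad D f x) = gradient (objective D f) x \<and>
          (\<integral>\<^sup>+ \<xi>. ennreal ((norm (sgrad D f x \<xi> - gradient (objective D f) x))\<^sup>2) \<partial>D)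
            \<le> ennreal (\<sigma>\<^sup>2))"

definition mean_square_smooth ::
  "'b::topological_space measure \<Rightarrow> ('a::euclidean_space \<Rightarrow> 'b \<Rightarrow> real) \<Rightarrow> real \<Rightarrow> bool" where
  "mean_square_smooth D f \<beta> \<longleftrightarrow>
     (\<forall>x y. (\<integral>\<^sup>+ \<xi>. ennreal ((norm (sgrad D f x \<xi> - sgrad D f y \<xi>))\<^sup>2) \<partial>D)
              \<le> ennreal (\<beta>\<^sup>2 * (norm (x - y))\<^sup>2))"

definition bounded_gradient_differences ::
  "'b::topological_space measure \<Rightarrow> ('a::euclidean_space \<Rightarrow> 'b \<Rightarrow> real) \<Rightarrow> real \<Rightarrow> bool" where
  "bounded_gradient_differences D f \<sigma>h \<longleftrightarrow>
     (\<forall>x. \<forall>\<xi>\<in>msupport D. \<forall>\<xi>'\<in>msupport D. norm (sgrad D f x \<xi> - sgrad D f x \<xi>') \<le> 2 * \<sigma>h)"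

text \<open>The sequences \<open>x\<close>, \<open>a\<close>, \<open>b\<close>, \<open>d\<close> are those of a run of META-STORM on the samples
  \<open>\<xi> 1, \<xi> 2, \<dots>\<close>, where \<open>g x \<xi>\<close> is the stochastic gradient. Indices start at 1; the
  equations determine all values used in iterations 1 to \<open>T\<close>.\<close>

definition meta_storm ::
  "('a::euclidean_space \<Rightarrow> 'b \<Rightarrow> 'a) \<Rightarrow> real \<Rightarrow> real \<Rightarrow> real \<Rightarrow> real \<Rightarrow> real \<Rightarrow> 'a \<Rightarrow> nat \<Rightarrow>
   (nat \<Rightarrow> 'b) \<Rightarrow> (nat \<Rightarrow> 'a) \<Rightarrow> (nat \<Rightarrow> real) \<Rightarrow> (nat \<Rightarrow> real) \<Rightarrow> (nat \<Rightarrow> 'a) \<Rightarrow> bool" where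
  "meta_storm g a0 b0 \<eta> p q x1 T \<xi> x a b d \<longleftrightarrow>
     x 1 = x1 \<and> d 1 = g x1 (\<xi> 1) \<and> a 1 = 1 \<and>
     (\<forall>t\<in>{1..T}.
        b t = (b0 powr (1 / p) + (\<Sum>i=1..t. (norm (d i))\<^sup>2)) powr p / a t powr q \<and>
        x (t + 1) = x t - (\<eta> / b t) *\<^sub>R d t \<and>
        a (t + 1) = (1 + (\<Sum>i=1..t. (norm (g (x i) (\<xi> i) - g (x i) (\<xi> (i + 1))))\<^sup>2 / a0\<^sup>2))
                      powr (- (2 / 3)) \<and>
        d (t + 1) = g (x (t + 1)) (\<xi> (t + 1))
                      + (1 - a (t + 1)) *\<^sub>R (d t - g (x t) (\<xi> (t + 1))))"

definition iid_samples :: "'w measure \<Rightarrow> 'b measure \<Rightarrow> (nat \<Rightarrow> 'w \<Rightarrow> 'b) \<Rightarrow> bool" where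
  "iid_samples P D \<xi> \<longleftrightarrow>
     prob_space.indep_vars P (\<lambda>_. D) \<xi> {1..} \<and> (\<forall>i\<ge>1. distr P D (\<xi> i) = D)"

text \<open>The output index \<open>\<tau>\<close> is uniform on \<open>{1..T}\<close> and independent of the whole sample sequence.
  Independence is stated for the generated families of events, since \<open>indep_var\<close> requires both
  random variables to have values in the same type.\<close>

definition uniform_output_index ::
  "'w measure \<Rightarrow> 'b measure \<Rightarrow> (nat \<Rightarrow> 'w \<Rightarrow> 'b) \<Rightarrow> nat \<Rightarrow> ('w \<Rightarrow> nat) \<Rightarrow> bool" where
  "uniform_output_index P D \<xi> T \<tau> \<longleftrightarrow>
     \<tau> \<in> measurable P (count_space UNIV) \<and>
     distr P (count_space UNIV) \<tau> = measure_pmf (pmf_of_set {1..T}) \<and>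
     prob_space.indep_set P
       {(\<lambda>\<omega>. \<lambda>i\<in>{1..}. \<xi> i \<omega>) -` A \<inter> space P | A. A \<in> sets (Pi\<^sub>M {1..} (\<lambda>_. D))}
       {\<tau> -` B \<inter> space P | B. B \<in> sets (count_space UNIV)}"

end

theory Submission
  imports Defs
begin

text \<open>
  Write \<open>a t = 1 / r t ^ 2\<close>, so that \<open>r t ^ 3 = 1 + (sum of the squared gradient differences) / a0 ^ 2\<close>,
  and \<open>err t = d t - grad F (x t)\<close>. The proof balances the descent of \<open>F\<close> against the
  potential \<open>r t * norm (err t) ^ 2 / \<beta>\<close>. The inner product of \<open>err t\<close> and \<open>d t\<close> in the descent inequality is
  split by Young's inequality with the weight \<open>1 / (\<beta> * r t)\<close>; this is the weight for which both the
  error term and the variance injected by a step are comparable to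
  \<open>\<beta> * r t * norm (d t) ^ 2 / b t ^ 2\<close>. That quantity is absorbed by the decrease
  \<open>norm (d t) ^ 2 / b t\<close> unless \<open>(b0 powr (1 / p) + norm (d 1) ^ 2 + \<dots> + norm (d t) ^ 2) / r t\<close> is at most of order \<open>\<beta> powr (1 / p)\<close>,
  and the exceptional steps contribute only \<open>\<beta> powr (1 / p - 1)\<close> times a logarithm.

  The momentum parameter \<open>a (t + 1)\<close> depends on the fresh sample \<open>\<xi> (t + 1)\<close>. It is replaced by \<open>a t\<close> before
  taking expectations; bounded gradient differences make the replacement error and all the noise
  terms summable to \<open>ln (r (T + 1) ^ 3)\<close>. No Hoelder inequality is needed at the end, since
  \<open>x powr \<alpha> * y powr \<gamma> \<le> 1 + x + y\<close> for nonnegative \<open>x\<close>, \<open>y\<close> and \<open>\<alpha> + \<gamma> \<le> 1\<close>.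
\<close>

section \<open>Analytic preliminaries\<close>

text \<open>The estimates are circular: \<open>Q\<close> is bounded by \<open>EE\<close> and
  \<open>VV\<close>, \<open>EE\<close> by \<open>VV\<close>, and \<open>VV\<close> by half of
  \<open>Q\<close> plus a logarithm. The loop closes because the total coefficient
  \<open>8 + 3 / 4\<close> of \<open>\<beta> * \<eta>\<^sup>2 * VV\<close> stays below the 9 for
  which the last bound is made; moving half of the expectation of \<open>Q\<close> to the other side
  is legitimate since, for a fixed horizon, all these quantities are almost surely bounded. The
  injected variance is not estimated by \<open>\<sigma>\<^sup>2\<close> step by step. It is charged
  to the next squared gradient difference, so \<open>\<sigma>\<close> reaches the rate only through
  the expectation of \<open>r (T + 1) ^ 3\<close>. The exponent \<open>ph\<close> solves
  \<open>ph / (1 - p) + ph / 3 = 1\<close>: the sum of the \<open>norm (d t) ^ 2\<close> is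
  controlled by a product of a power of \<open>Q\<close> (up to a constant) and a power of
  \<open>r ^ 3\<close>, and these exponents keep the \<open>ph\<close>-th power of that product
  within reach of first moments. The constant is fixed before the problem, the horizon and
  \<open>\<beta>\<close>. Additive constants are therefore absorbed into \<open>ln \<beta>\<close>,
  which is at least \<open>ln \<beta>0 > 0\<close>.\<close>

lemma lipschitz_gradient_descent:
  fixes F :: "'a::euclidean_space \<Rightarrow> real"
  assumes grad: "\<And>x. GDERIV F x :> g x"
    and lip: "\<And>x y. norm (g x - g y) \<le> L * norm (x - y)"
  shows "F y \<le> F x + inner (g x) (y - x) + L / 2 * (norm (y - x))\<^sup>2"
proof -
  define v where "v = y - x"
  \<comment> \<open>\<open>F\<close> along the segment from \<open>x\<close> to \<open>y\<close>,
    minus the linear and quadratic terms of the claimed majorant; the claim is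
    \<open>h 1 \<le> h 0\<close>.\<close>
  define h where "h s = F (x + s *\<^sub>R v) - s * inner (g x) v - L / 2 * s\<^sup>2 * (norm v)\<^sup>2" for s :: real
  have F_deriv: "((\<lambda>s. F (x + s *\<^sub>R v)) has_real_derivative inner (g (x + s *\<^sub>R v)) v) (at s)" for s
  proof -
    have "((\<lambda>s. x + s *\<^sub>R v) has_derivative (\<lambda>k. k *\<^sub>R v)) (at s)"
      by (auto intro!: derivative_eq_intros)
    from has_derivative_compose[OF this grad[unfolded gderiv_def]]
    have "((\<lambda>s. F (x + s *\<^sub>R v)) has_derivative (\<lambda>k. inner (k *\<^sub>R v) (g (x + s *\<^sub>R v)))) (at s)" .
    then show ?thesis
      unfolding has_field_derivative_def
      by (rule has_derivative_eq_rhs) (auto simp: inner_commute)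
  qed
  have h_deriv: "(h has_real_derivative
      (inner (g (x + s *\<^sub>R v)) v - inner (g x) v - L * s * (norm v)\<^sup>2)) (at s)" for s
    unfolding h_def by (auto intro!: derivative_eq_intros F_deriv)
  have "h 1 \<le> h 0"
  proof (rule DERIV_nonpos_imp_nonincreasing[of 0 1 h])
    fix s :: real assume s: "0 \<le> s" "s \<le> 1"
    have "inner (g (x + s *\<^sub>R v)) v - inner (g x) v \<le> norm (g (x + s *\<^sub>R v) - g x) * norm v"
      by (metis inner_diff_left norm_cauchy_schwarz)
    also have "\<dots> \<le> (L * norm (s *\<^sub>R v)) * norm v"
      using lip[of "x + s *\<^sub>R v" x] by (intro mult_right_mono) auto
    also have "\<dots> = L * s * (norm v)\<^sup>2"
      using s by (simp add: power2_eq_square)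
    finally show "\<exists>D. (h has_real_derivative D) (at s) \<and> D \<le> 0"
      using h_deriv[of s] by fastforce
  qed simp
  then show ?thesis
    by (simp add: h_def v_def)
qed

text \<open>Bias-variance decomposition: the cross term has mean zero. The shift \<open>c\<close> is
  arbitrary, so the same identity drops cross terms with a frozen error and shows that the mean
  minimises the second moment.\<close>

lemma (in prob_space) expectation_norm_sq_shift:
  fixes X :: "'a \<Rightarrow> 'e::euclidean_space"
  assumes X: "integrable M X" and X2: "integrable M (\<lambda>y. (norm (X y))\<^sup>2)"
  shows "integrable M (\<lambda>y. (norm (c + (X y - expectation X)))\<^sup>2)"
    and "(\<integral>y. (norm (c + (X y - expectation X)))\<^sup>2 \<partial>M)
          = (norm c)\<^sup>2 + (\<integral>y. (norm (X y - expectation X))\<^sup>2 \<partial>M)"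
proof -
  define m where "m = expectation X"
  have expand: "(norm (e + (X y - m)))\<^sup>2 = (norm (X y))\<^sup>2 + 2 * inner (X y) (e - m) + (norm (e - m))\<^sup>2" for e y
    unfolding power2_norm_eq_inner by (simp add: algebra_simps inner_commute)
  have int: "integrable M (\<lambda>y. (norm (e + (X y - m)))\<^sup>2)" for e
    unfolding expand using X X2 by auto
  then show "integrable M (\<lambda>y. (norm (c + (X y - expectation X)))\<^sup>2)"
    by (simp add: m_def)
  have val: "(\<integral>y. (norm (e + (X y - m)))\<^sup>2 \<partial>M)
      = expectation (\<lambda>y. (norm (X y))\<^sup>2) + 2 * inner m (e - m) + (norm (e - m))\<^sup>2" for e
    unfolding expand using X X2 by (simp add: prob_space m_def)
  have "(\<integral>y. (norm (c + (X y - m)))\<^sup>2 \<partial>M)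
      = (norm c)\<^sup>2 + (\<integral>y. (norm (0 + (X y - m)))\<^sup>2 \<partial>M)"
    unfolding val by (simp add: power2_norm_eq_inner algebra_simps inner_commute)
  then show "(\<integral>y. (norm (c + (X y - expectation X)))\<^sup>2 \<partial>M)
          = (norm c)\<^sup>2 + (\<integral>y. (norm (X y - expectation X))\<^sup>2 \<partial>M)"
    by (simp add: m_def)
qed

section \<open>One-step estimates for the weight and the momentum error\<close>

lemma cube_step:
  fixes r r' \<delta> c :: real
  assumes r: "1 \<le> r" and r': "0 \<le> r'" and step: "r' ^ 3 = r ^ 3 + \<delta>" and \<delta>: "0 \<le> \<delta>" "\<delta> \<le> c"
  shows "r \<le> r'" and "r' - r \<le> \<delta> / r\<^sup>2" and "1 / r\<^sup>2 - 1 / r'\<^sup>2 \<le> \<delta> / r ^ 5" and "r' \<le> (1 + c) * r"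
proof -
  show le: "r \<le> r'"
  proof (rule ccontr)
    assume "\<not> r \<le> r'"
    then have "r' ^ 3 < r ^ 3" using r' by (intro power_strict_mono) auto
    then show False using step \<delta> by simp
  qed
  \<comment> \<open>Difference of cubes. Keeping only \<open>r\<^sup>2\<close> of the second factor
    bounds the growth of the weight; keeping \<open>(r' + r) * r'\<close> bounds the change of the
    momentum parameter \<open>1 / r\<^sup>2\<close>.\<close>
  have \<delta>_eq: "\<delta> = (r' - r) * (r'\<^sup>2 + r * r' + r\<^sup>2)"
    using step by (simp add: algebra_simps power2_eq_square power3_eq_cube)
  have "(r' - r) * r\<^sup>2 \<le> (r' - r) * (r'\<^sup>2 + r * r' + r\<^sup>2)"
    using le r by (intro mult_left_mono) auto
  then show "r' - r \<le> \<delta> / r\<^sup>2"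
    using r by (simp add: \<delta>_eq field_simps)
  have "(r' - r) * ((r' + r) * r') \<le> \<delta>"
    unfolding \<delta>_eq using le r by (intro mult_left_mono) (auto simp: power2_eq_square algebra_simps)
  then have "(r'\<^sup>2 - r\<^sup>2) * r' \<le> \<delta>"
    by (simp add: algebra_simps power2_eq_square)
  then have diff: "r'\<^sup>2 - r\<^sup>2 \<le> \<delta> / r'"
    using r le by (simp add: field_simps)
  have "1 / r\<^sup>2 - 1 / r'\<^sup>2 = (r'\<^sup>2 - r\<^sup>2) / (r\<^sup>2 * r'\<^sup>2)"
    using r le by (simp add: field_simps)
  also have "\<dots> \<le> (\<delta> / r') / (r\<^sup>2 * r'\<^sup>2)"
    by (intro divide_right_mono diff) auto
  also have "\<dots> = \<delta> / (r\<^sup>2 * r' ^ 3)"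
    by (simp add: power2_eq_square power3_eq_cube)
  also have "\<dots> \<le> \<delta> / (r\<^sup>2 * r ^ 3)"
    using r le \<delta> by (intro divide_left_mono mult_left_mono power_mono mult_pos_pos) auto
  also have "\<dots> = \<delta> / r ^ 5"
    by (simp add: power_numeral_reduce power2_eq_square)
  finally show "1 / r\<^sup>2 - 1 / r'\<^sup>2 \<le> \<delta> / r ^ 5" .
  have c0: "0 \<le> c" using \<delta> by simp
  have "\<delta> \<le> c * r ^ 3"
    using \<delta> r c0 by (metis mult_left_mono mult.right_neutral one_le_power order_trans)
  then have "r' ^ 3 \<le> (1 + c) * r ^ 3"
    using step by (simp add: algebra_simps)
  also have "\<dots> \<le> (1 + c) ^ 3 * r ^ 3"
    using c0 r by (intro mult_right_mono self_le_power) auto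
  finally have "r' ^ 3 \<le> ((1 + c) * r) ^ 3"
    by (simp add: power_mult_distrib)
  then show "r' \<le> (1 + c) * r"
    using c0 r by (metis add_nonneg_nonneg mult_nonneg_nonneg order_trans power_mono_iff zero_le_one zero_less_numeral r')
qed

lemma norm_sq_add_weighted:
  fixes u v :: "'a::real_inner"
  assumes "0 < \<alpha>"
  shows "(norm (u + v))\<^sup>2 \<le> (1 + \<alpha>) * (norm u)\<^sup>2 + (1 + 1 / \<alpha>) * (norm v)\<^sup>2"
proof -
  have "2 * inner u v \<le> \<alpha> * (norm u)\<^sup>2 + (1 / \<alpha>) * (norm v)\<^sup>2"
  proof -
    have "0 \<le> (norm (sqrt \<alpha> *\<^sub>R u - (1 / sqrt \<alpha>) *\<^sub>R v))\<^sup>2"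
      by simp
    also have "\<dots> = \<alpha> * (norm u)\<^sup>2 + (1 / \<alpha>) * (norm v)\<^sup>2 - 2 * inner u v"
      unfolding power2_norm_eq_inner using assms
      by (simp add: inner_diff_left inner_diff_right inner_commute algebra_simps)
    finally show ?thesis by simp
  qed
  moreover have "(norm (u + v))\<^sup>2 = (norm u)\<^sup>2 + 2 * inner u v + (norm v)\<^sup>2"
    unfolding power2_norm_eq_inner by (simp add: algebra_simps inner_commute)
  ultimately show ?thesis by (simp add: algebra_simps)
qed

lemma norm_sq_add_le:
  fixes u v :: "'a::real_inner"
  shows "(norm (u + v))\<^sup>2 \<le> 2 * (norm u)\<^sup>2 + 2 * (norm v)\<^sup>2"
  using norm_sq_add_weighted[of 1 u v] by simp

text \<open>Exchanging \<open>1 / r'\<^sup>2\<close> for \<open>1 / r\<^sup>2\<close> leaves a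
  remainder of norm at most \<open>6 * s * \<delta> / r ^ 3\<close>. Its square is multiplied by
  \<open>r\<close> and by the Young factor, at most \<open>2 * r\<^sup>2\<close>; this produces 72
  as \<open>2 * 36\<close>. One factor \<open>\<delta>\<close> is then given up for
  \<open>c\<close>, so that the cost is linear in \<open>\<delta> / r ^ 3\<close>.\<close>

lemma momentum_error_step:
  fixes e e' m n :: "'a::real_inner" and r r' \<delta> c s :: real
  assumes r: "1 \<le> r" and r': "0 \<le> r'" and step: "r' ^ 3 = r ^ 3 + \<delta>" and \<delta>: "0 \<le> \<delta>" "\<delta> \<le> c"
    and s: "0 \<le> s" and e: "norm e \<le> 4 * s * r\<^sup>2" and n: "norm n \<le> 2 * s"
    and e': "e' = m + (1 - 1 / r'\<^sup>2) *\<^sub>R (e - n)"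
  shows "r * (norm e')\<^sup>2
      \<le> r * (1 + 1 / r\<^sup>2) * (norm ((1 - 1 / r\<^sup>2) *\<^sub>R e + (m - (1 - 1 / r\<^sup>2) *\<^sub>R n)))\<^sup>2
        + 72 * s\<^sup>2 * c * (\<delta> / r ^ 3)"
proof -
  note cs = cube_step[OF r r' step \<delta>]
  define \<Delta> where "\<Delta> = 1 / r\<^sup>2 - 1 / r'\<^sup>2"
  have \<Delta>0: "0 \<le> \<Delta>"
    using cs(1) r by (auto simp: \<Delta>_def field_simps intro!: power_mono)
  have \<Delta>le: "\<Delta> \<le> \<delta> / r ^ 5" using cs(3) by (simp add: \<Delta>_def)
  define u where "u = (1 - 1 / r\<^sup>2) *\<^sub>R e + (m - (1 - 1 / r\<^sup>2) *\<^sub>R n)"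
  have split: "e' = u + \<Delta> *\<^sub>R (e - n)"
    unfolding e' u_def \<Delta>_def by (simp add: algebra_simps)
  have "norm (e - n) \<le> 4 * s * r\<^sup>2 + 2 * s"
    using e n norm_triangle_ineq4[of e n] by linarith
  also have "\<dots> \<le> 6 * s * r\<^sup>2"
  proof -
    have "s * 1 \<le> s * r\<^sup>2" using r s by (intro mult_left_mono) auto
    then show ?thesis by (simp add: algebra_simps)
  qed
  finally have en: "norm (e - n) \<le> 6 * s * r\<^sup>2" .
  have "norm (\<Delta> *\<^sub>R (e - n)) \<le> \<delta> / r ^ 5 * (6 * s * r\<^sup>2)"
    using \<Delta>0 \<Delta>le en mult_mono[OF \<Delta>le en] by simp
  also have "\<dots> = 6 * s * \<delta> / r ^ 3"
    using r by (simp add: field_simps power_numeral_reduce)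
  finally have R: "(norm (\<Delta> *\<^sub>R (e - n)))\<^sup>2 \<le> (6 * s * \<delta> / r ^ 3)\<^sup>2"
    by (intro power_mono) auto
  \<comment> \<open>The weight \<open>1 / r\<^sup>2\<close> is the momentum parameter itself: the
    factor \<open>1 + 1 / r\<^sup>2\<close> is later swallowed by the contraction
    \<open>(1 - 1 / r\<^sup>2)\<^sup>2\<close>.\<close>
  have "(norm e')\<^sup>2 \<le> (1 + 1 / r\<^sup>2) * (norm u)\<^sup>2 + (1 + 1 / (1 / r\<^sup>2)) * (norm (\<Delta> *\<^sub>R (e - n)))\<^sup>2"
    unfolding split using r by (intro norm_sq_add_weighted) auto
  also have "(1 + 1 / (1 / r\<^sup>2)) * (norm (\<Delta> *\<^sub>R (e - n)))\<^sup>2 \<le> (2 * r\<^sup>2) * (6 * s * \<delta> / r ^ 3)\<^sup>2"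
    using r R by (intro mult_mono) auto
  finally have "(norm e')\<^sup>2 \<le> (1 + 1 / r\<^sup>2) * (norm u)\<^sup>2 + (2 * r\<^sup>2) * (6 * s * \<delta> / r ^ 3)\<^sup>2"
    by simp
  then have "r * (norm e')\<^sup>2 \<le> r * ((1 + 1 / r\<^sup>2) * (norm u)\<^sup>2 + (2 * r\<^sup>2) * (6 * s * \<delta> / r ^ 3)\<^sup>2)"
    using r by (intro mult_left_mono) auto
  also have "\<dots> = r * (1 + 1 / r\<^sup>2) * (norm u)\<^sup>2 + 72 * s\<^sup>2 * \<delta> * (\<delta> / r ^ 3)"
    using r by (simp add: field_simps power_numeral_reduce)
  also have "72 * s\<^sup>2 * \<delta> * (\<delta> / r ^ 3) \<le> 72 * s\<^sup>2 * c * (\<delta> / r ^ 3)"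
    using \<delta> r by (intro mult_right_mono mult_left_mono) auto
  finally show ?thesis unfolding u_def by simp
qed

text \<open>Pays for raising the weight of the potential from \<open>r\<close> to \<open>r'\<close>:
  either the increment is at most \<open>1 / (2 * r')\<close>, or \<open>r\<close> is bounded by a
  constant and so is everything else.\<close>

lemma weight_increment_bound:
  fixes r r' \<delta> c s y :: real
  assumes r: "1 \<le> r" and r': "0 \<le> r'" and step: "r' ^ 3 = r ^ 3 + \<delta>" and \<delta>: "0 \<le> \<delta>" "\<delta> \<le> c"
    and y: "0 \<le> y" "y \<le> 4 * s * r'\<^sup>2"
  shows "(r' - r) * y\<^sup>2 \<le> y\<^sup>2 / r' / 2 + 16 * s\<^sup>2 * (2 * c * (1 + c)) ^ 5 * (1 + c) ^ 4 * (\<delta> / r ^ 3)"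
proof -
  note cs = cube_step[OF r r' step \<delta>]
  define k where "k = 2 * c * (1 + c)"
  have c0: "0 \<le> c" using \<delta> by simp
  have k0: "0 \<le> k" using c0 by (simp add: k_def)
  have rest0: "0 \<le> 16 * s\<^sup>2 * k ^ 5 * (1 + c) ^ 4 * (\<delta> / r ^ 3)"
    using \<delta> r k0 c0 by (intro mult_nonneg_nonneg divide_nonneg_nonneg) auto
  show ?thesis
  proof (cases "\<delta> / r\<^sup>2 \<le> 1 / r' / 2")
    case True
    then have "(r' - r) * y\<^sup>2 \<le> (1 / r' / 2) * y\<^sup>2"
      using cs(2) by (intro mult_right_mono) auto
    then show ?thesis using rest0 unfolding k_def by simp
  next
    case False
    \<comment> \<open>Failure of absorption forces \<open>r\<^sup>2 < 2 * c * r'\<close>, and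
      \<open>r' \<le> (1 + c) * r\<close> turns this into \<open>r < k\<close>. The powers of
      \<open>k\<close> and \<open>1 + c\<close> in the claim come from inserting this into
      \<open>y\<^sup>2 \<le> 16 * s\<^sup>2 * r' ^ 4\<close>.\<close>
    then have "1 / r' / 2 < c / r\<^sup>2"
      using \<delta> r by (smt (verit) divide_right_mono zero_le_power2)
    then have "r\<^sup>2 < 2 * c * r'"
      using r cs(1) by (simp add: field_simps)
    also have "\<dots> \<le> 2 * c * ((1 + c) * r)"
      using cs(4) c0 by (intro mult_left_mono) auto
    finally have "r * r < k * r" by (simp add: k_def power2_eq_square algebra_simps)
    then have rk: "r \<le> k" using r by simp
    have r'k: "r' \<le> (1 + c) * k"
      using cs(4) rk c0 by (meson add_nonneg_nonneg mult_left_mono order_trans zero_le_one)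
    have "y\<^sup>2 \<le> (4 * s * r'\<^sup>2)\<^sup>2" using y by (intro power_mono) auto
    also have "\<dots> = 16 * s\<^sup>2 * r' ^ 4" by (simp add: power_mult_distrib)
    also have "\<dots> \<le> 16 * s\<^sup>2 * ((1 + c) * k) ^ 4"
      using r'k r' by (intro mult_left_mono power_mono) auto
    finally have y2: "y\<^sup>2 \<le> 16 * s\<^sup>2 * ((1 + c) * k) ^ 4" .
    have "(r' - r) * y\<^sup>2 \<le> (\<delta> / r\<^sup>2) * (16 * s\<^sup>2 * ((1 + c) * k) ^ 4)"
      using cs(1,2) y2 \<delta> by (intro mult_mono) auto
    also have "\<delta> / r\<^sup>2 = r * (\<delta> / r ^ 3)"
      using r by (simp add: field_simps power_numeral_reduce)
    also have "r * (\<delta> / r ^ 3) * (16 * s\<^sup>2 * ((1 + c) * k) ^ 4)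
        \<le> k * (\<delta> / r ^ 3) * (16 * s\<^sup>2 * ((1 + c) * k) ^ 4)"
      using rk r \<delta> c0 k0 by (intro mult_right_mono) auto
    also have "\<dots> = 16 * s\<^sup>2 * k ^ 5 * (1 + c) ^ 4 * (\<delta> / r ^ 3)"
      by (simp add: power_mult_distrib power_numeral_reduce)
    finally show ?thesis
      unfolding k_def[symmetric] using y r' by (smt (verit) divide_nonneg_nonneg zero_le_power2)
  qed
qed

text \<open>The invariant \<open>4 * s * r\<^sup>2\<close> reproduces itself: multiplying it by
  \<open>1 - 1 / r'\<^sup>2\<close> gains exactly \<open>4 * s\<close>, which pays for the two noise
  vectors \<open>m\<close> and \<open>n\<close> of norm at most \<open>2 * s\<close>.\<close>

lemma momentum_error_bound:
  fixes e e' m n :: "'a::real_inner" and r r' s :: real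
  assumes r: "1 \<le> r" "r \<le> r'" and s: "0 \<le> s" and e: "norm e \<le> 4 * s * r\<^sup>2"
    and m: "norm m \<le> 2 * s" and n: "norm n \<le> 2 * s"
    and e': "e' = m + (1 - 1 / r'\<^sup>2) *\<^sub>R (e - n)"
  shows "norm e' \<le> 4 * s * r'\<^sup>2"
proof -
  have a: "0 \<le> 1 - 1 / r'\<^sup>2" "1 - 1 / r'\<^sup>2 \<le> 1" using r by (auto simp: field_simps)
  have "norm e' \<le> norm m + (1 - 1 / r'\<^sup>2) * norm (e - n)"
    unfolding e' using a by (metis abs_of_nonneg norm_scaleR norm_triangle_ineq)
  also have "\<dots> \<le> 2 * s + (1 - 1 / r'\<^sup>2) * (4 * s * r'\<^sup>2 + 2 * s)"
  proof (intro add_mono m mult_left_mono a)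
    have "4 * s * r\<^sup>2 \<le> 4 * s * r'\<^sup>2" using r s by (intro mult_left_mono power_mono) auto
    then show "norm (e - n) \<le> 4 * s * r'\<^sup>2 + 2 * s"
      using e n norm_triangle_ineq4[of e n] by linarith
  qed
  also have "\<dots> = 2 * s + (4 * s * r'\<^sup>2 - 4 * s) + (1 - 1 / r'\<^sup>2) * (2 * s)"
    using r by (simp add: field_simps)
  also have "\<dots> \<le> 2 * s + (4 * s * r'\<^sup>2 - 4 * s) + 1 * (2 * s)"
    using a s by (intro add_left_mono mult_right_mono) auto
  finally show ?thesis by simp
qed

section \<open>Logarithmic sums and concave powers\<close>

lemma increment_ratio_le_ln:
  fixes x w :: real
  assumes "0 < x" "0 \<le> w"
  shows "w / (x + w) \<le> ln (x + w) - ln x"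
proof -
  have "ln (x / (x + w)) \<le> x / (x + w) - 1"
    using assms by (intro ln_le_minus_one) auto
  moreover have "x / (x + w) - 1 = - (w / (x + w))"
    using assms by (simp add: field_simps)
  ultimately show ?thesis using assms by (simp add: ln_div)
qed

text \<open>The denominators are the values before the increment. Since one step multiplies
  \<open>x\<close> by at most \<open>1 + c\<close>, moving to the value after the increment costs
  that factor, and then the logarithms telescope.\<close>

lemma sum_increment_ratio_le_ln:
  fixes x \<delta> :: "nat \<Rightarrow> real"
  assumes x: "\<And>t. t \<in> {1..Suc n} \<Longrightarrow> 1 \<le> x t"
    and step: "\<And>t. t \<in> {1..n} \<Longrightarrow> x (Suc t) = x t + \<delta> t \<and> 0 \<le> \<delta> t \<and> \<delta> t \<le> c"
  shows "(\<Sum>t=1..n. \<delta> t / x t) \<le> (1 + c) * (ln (x (Suc n)) - ln (x 1))"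
  using assms
proof (induction n)
  case (Suc n)
  define y w where "y = x (Suc n)" and "w = \<delta> (Suc n)"
  have y: "1 \<le> y" and w: "x (Suc (Suc n)) = y + w" "0 \<le> w" "w \<le> c"
    using Suc.prems by (auto simp: y_def w_def)
  have "y + w \<le> (1 + c) * y"
    using w y mult_left_mono[of 1 y c] by (simp add: algebra_simps)
  then have "w * (y + w) \<le> w * ((1 + c) * y)"
    using w by (intro mult_left_mono)
  then have "w / y \<le> (1 + c) * (w / (y + w))"
    using y w by (simp add: field_simps)
  also have "\<dots> \<le> (1 + c) * (ln (y + w) - ln y)"
    using y w by (intro mult_left_mono increment_ratio_le_ln) auto
  finally have "w / y \<le> (1 + c) * ln (y + w) - (1 + c) * ln y"
    by (simp add: algebra_simps)
  moreover have "(\<Sum>t=1..n. \<delta> t / x t) \<le> (1 + c) * (ln y - ln (x 1))"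
    unfolding y_def using Suc by auto
  ultimately show ?case by (simp add: w y_def[symmetric] w_def[symmetric] algebra_simps)
qed simp

text \<open>Here the denominators already contain the increment. Telescoping is done on
  \<open>ln (min (x t) M)\<close>, which never decreases, so terms beyond \<open>M\<close> cost
  nothing and the bound does not grow with the final value.\<close>

lemma sum_truncated_increment_ratio_le_ln:
  fixes x w :: "nat \<Rightarrow> real"
  assumes x: "\<And>t. t \<le> n \<Longrightarrow> 0 < x t"
    and step: "\<And>t. t < n \<Longrightarrow> x (Suc t) = x t + w (Suc t) \<and> 0 \<le> w (Suc t)"
    and M: "x 0 \<le> M"
  shows "(\<Sum>t=1..n. if x t \<le> M then w t / x t else 0) \<le> ln (min (x n) M) - ln (x 0)"
  using x step
proof (induction n)
  case 0
  then show ?case using M by simp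
next
  case (Suc n)
  define y v where "y = x n" and "v = w (Suc n)"
  have y: "0 < y" and v: "x (Suc n) = y + v" "0 \<le> v"
    using Suc.prems by (auto simp: y_def v_def)
  have M0: "0 < M" using M Suc.prems(1)[of 0] by simp
  have "(if y + v \<le> M then v / (y + v) else 0) \<le> ln (min (y + v) M) - ln (min y M)"
  proof (cases "y + v \<le> M")
    case True
    then show ?thesis using increment_ratio_le_ln[of y v] v y by simp
  next
    case False
    then show ?thesis using v y M0 by (auto simp: min_def)
  qed
  moreover have "(\<Sum>t=1..n. if x t \<le> M then w t / x t else 0) \<le> ln (min y M) - ln (x 0)"
    unfolding y_def using Suc by auto
  ultimately show ?case by (cases "y + v \<le> M") (simp_all add: v v_def[symmetric])
qed

lemma powr_mult_powr_le:
  fixes x y \<alpha> \<gamma> :: real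
  assumes "0 \<le> x" "0 \<le> y" "0 \<le> \<alpha>" "0 \<le> \<gamma>" "\<alpha> + \<gamma> \<le> 1"
  shows "x powr \<alpha> * y powr \<gamma> \<le> 1 + x + y"
proof -
  define m where "m = max 1 (max x y)"
  have "x powr \<alpha> * y powr \<gamma> \<le> m powr \<alpha> * m powr \<gamma>"
    using assms by (intro mult_mono powr_mono2) (auto simp: m_def)
  also have "\<dots> = m powr (\<alpha> + \<gamma>)" by (simp add: powr_add)
  also have "\<dots> \<le> m powr 1" using assms by (intro powr_mono) (auto simp: m_def)
  also have "\<dots> = m" by (simp add: m_def)
  also have "\<dots> \<le> 1 + x + y" using assms by (auto simp: m_def)
  finally show ?thesis .
qed

lemma weighted_young:
  fixes A m n :: real
  assumes "0 < A"
  shows "n * m \<le> n\<^sup>2 / A + A * m\<^sup>2 / 4"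
proof -
  have "0 \<le> (2 * n - A * m)\<^sup>2 / (4 * A)" using assms by simp
  also have "\<dots> = n\<^sup>2 / A + A * m\<^sup>2 / 4 - n * m"
    using assms by (simp add: field_simps power2_eq_square)
  finally show ?thesis by simp
qed

lemma powr_add_le:
  fixes x y s :: real
  assumes "0 \<le> x" "0 \<le> y" "0 \<le> s" "s \<le> 1"
  shows "(x + y) powr s \<le> 2 * (x powr s + y powr s)"
proof -
  define m where "m = max x y"
  have "(x + y) powr s \<le> (2 * m) powr s"
    using assms by (intro powr_mono2) (auto simp: m_def)
  also have "\<dots> = 2 powr s * m powr s" using assms by (simp add: m_def powr_mult)
  also have "\<dots> \<le> 2 powr 1 * m powr s" using assms by (intro mult_right_mono powr_mono) auto
  also have "m powr s \<le> x powr s + y powr s" by (auto simp: m_def max_def)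
  finally show ?thesis by simp
qed

text \<open>Power-mean inequality up to a factor 2: with \<open>m\<close> the average of the
  \<open>h t\<close>, each term satisfies
  \<open>h t powr s \<le> m powr s * (1 + h t / m)\<close>.\<close>

lemma sum_powr_le:
  fixes h :: "nat \<Rightarrow> real"
  assumes h: "\<And>t. t \<in> {1..T} \<Longrightarrow> 0 \<le> h t" and T: "1 \<le> T" and s: "0 \<le> s" "s \<le> 1"
  shows "(\<Sum>t=1..T. h t powr s) \<le> 2 * real T powr (1 - s) * (\<Sum>t=1..T. h t) powr s"
proof -
  define H where "H = (\<Sum>t=1..T. h t)"
  have H0: "0 \<le> H" unfolding H_def using h by (intro sum_nonneg)
  show ?thesis
  proof (cases "H = 0")
    case True
    then have "\<forall>t\<in>{1..T}. h t = 0"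
      using h unfolding H_def by (subst (asm) sum_nonneg_eq_0_iff) auto
    then have "(\<Sum>t=1..T. h t powr s) = 0" by (intro sum.neutral) simp
    then show ?thesis by simp
  next
    case False
    define m where "m = H / real T"
    have m: "0 < m" using False H0 T by (simp add: m_def)
    have "h t powr s \<le> m powr s * (1 + h t / m)" if "t \<in> {1..T}" for t
    proof -
      have "(h t / m) powr s \<le> 1 + h t / m"
      proof (cases "h t / m \<le> 1")
        case True
        then have "(h t / m) powr s \<le> 1 powr s" using m h[OF that] s by (intro powr_mono2) auto
        then show ?thesis using m h[OF that] by (simp add: add_increasing2)
      next
        case False
        then have "(h t / m) powr s \<le> (h t / m) powr 1" using s by (intro powr_mono) auto
        then show ?thesis using False by simp
      qed
      then have "m powr s * (h t / m) powr s \<le> m powr s * (1 + h t / m)"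
        by (intro mult_left_mono) auto
      then show ?thesis using m h[OF that] by (simp add: powr_mult[symmetric])
    qed
    then have "(\<Sum>t=1..T. h t powr s) \<le> (\<Sum>t=1..T. m powr s * (1 + h t / m))"
      by (intro sum_mono)
    also have "\<dots> = m powr s * (real T + H / m)"
      by (simp add: H_def sum_distrib_left[symmetric] sum.distrib sum_divide_distrib)
    also have "H / m = real T" using False T by (simp add: m_def)
    also have "m powr s * (real T + real T) = 2 * (real T powr 1 * real T powr (- s)) * H powr s"
      using T H0 by (simp add: m_def powr_divide powr_minus field_simps)
    also have "\<dots> = 2 * real T powr (1 - s) * H powr s"
      by (simp only: powr_add[symmetric] diff_conv_add_uminus)
    finally show ?thesis by (simp add: H_def)
  qed
qed

text \<open>A crude substitute for Hoelder's inequality.\<close>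

lemma (in prob_space) expectation_powr_mult_powr_le:
  fixes X Y :: "'a \<Rightarrow> real"
  assumes X: "integrable M X" "\<And>\<omega>. \<omega> \<in> space M \<Longrightarrow> 0 \<le> X \<omega>" "expectation X \<le> A" "0 < A"
    and Y: "integrable M Y" "\<And>\<omega>. \<omega> \<in> space M \<Longrightarrow> 0 \<le> Y \<omega>" "expectation Y \<le> B" "0 < B"
    and exps: "0 \<le> \<alpha>" "0 \<le> \<gamma>" "\<alpha> + \<gamma> \<le> 1"
  shows "integrable M (\<lambda>\<omega>. X \<omega> powr \<alpha> * Y \<omega> powr \<gamma>)"
    and "expectation (\<lambda>\<omega>. X \<omega> powr \<alpha> * Y \<omega> powr \<gamma>) \<le> 3 * (A powr \<alpha> * B powr \<gamma>)"
proof -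
  let ?Z = "\<lambda>\<omega>. A powr \<alpha> * B powr \<gamma> * (1 + X \<omega> / A + Y \<omega> / B)"
  have le: "X \<omega> powr \<alpha> * Y \<omega> powr \<gamma> \<le> ?Z \<omega>" if \<omega>: "\<omega> \<in> space M" for \<omega>
  proof -
    have "X \<omega> powr \<alpha> * Y \<omega> powr \<gamma> = A powr \<alpha> * B powr \<gamma> * ((X \<omega> / A) powr \<alpha> * (Y \<omega> / B) powr \<gamma>)"
      using X(2)[OF \<omega>] Y(2)[OF \<omega>] X(4) Y(4) by (simp add: powr_divide)
    also have "\<dots> \<le> ?Z \<omega>"
      using X(2)[OF \<omega>] Y(2)[OF \<omega>] X(4) Y(4) exps by (intro mult_left_mono powr_mult_powr_le) auto
    finally show ?thesis .
  qed
  have int_Z: "integrable M ?Z" using X Y by auto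
  have [measurable]: "X \<in> borel_measurable M" "Y \<in> borel_measurable M" using X Y by auto
  show int: "integrable M (\<lambda>\<omega>. X \<omega> powr \<alpha> * Y \<omega> powr \<gamma>)"
  proof (rule Bochner_Integration.integrable_bound[OF int_Z])
    show "AE \<omega> in M. norm (X \<omega> powr \<alpha> * Y \<omega> powr \<gamma>) \<le> norm (?Z \<omega>)"
      using AE_space
    proof eventually_elim
      case (elim \<omega>)
      show ?case using le[OF elim] by simp
    qed
  qed measurable
  have "expectation (\<lambda>\<omega>. X \<omega> powr \<alpha> * Y \<omega> powr \<gamma>) \<le> expectation ?Z"
    by (rule integral_mono[OF int int_Z le])
  also have "\<dots> = A powr \<alpha> * B powr \<gamma> * (1 + expectation X / A + expectation Y / B)"
    using X Y by (simp add: prob_space)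
  also have "\<dots> \<le> A powr \<alpha> * B powr \<gamma> * (1 + 1 + 1)"
    using X Y by (intro mult_left_mono add_mono) auto
  finally show "expectation (\<lambda>\<omega>. X \<omega> powr \<alpha> * Y \<omega> powr \<gamma>) \<le> 3 * (A powr \<alpha> * B powr \<gamma>)"
    by simp
qed

section \<open>The stochastic gradient oracle\<close>

text \<open>The linear derivative is represented by the vector of its values on the basis; this is
  the witness that makes the definite description in \<open>gradient\<close> meaningful.\<close>

lemma GDERIV_gradient:
  fixes h :: "'a::euclidean_space \<Rightarrow> real"
  assumes "h differentiable (at x)"
  shows "GDERIV h x :> gradient h x"
proof -
  obtain h' where h': "(h has_derivative h') (at x)"
    using assms unfolding differentiable_def by blast
  then interpret bounded_linear h' by (rule has_derivative_bounded_linear)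
  define v where "v = (\<Sum>i\<in>Basis. h' i *\<^sub>R i)"
  have "h' k = inner k v" for k
  proof -
    have "h' k = h' (\<Sum>i\<in>Basis. inner k i *\<^sub>R i)" by (simp add: euclidean_representation)
    also have "\<dots> = (\<Sum>i\<in>Basis. inner k i * h' i)" by (simp add: sum scaleR)
    also have "\<dots> = inner k v" by (simp add: v_def inner_sum_right mult.commute)
    finally show ?thesis .
  qed
  then have "GDERIV h x :> v"
    using h' unfolding gderiv_def by presburger
  then show ?thesis using gradient_eqI by metis
qed

text \<open>Writes directional derivatives as limits along a sequence, so that measurability passes
  from a function to its gradient.\<close>

lemma LIMSEQ_difference_quotient_GDERIV:
  fixes h :: "'a::euclidean_space \<Rightarrow> real"
  assumes "GDERIV h x :> v"
  shows "(\<lambda>n. real (Suc n) * (h (x + (1 / real (Suc n)) *\<^sub>R u) - h x)) \<longlonglongrightarrow> inner v u"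
proof -
  have "((\<lambda>s. h (x + s *\<^sub>R u)) has_real_derivative inner v u) (at 0)"
  proof -
    have 1: "((\<lambda>s. x + s *\<^sub>R u) has_derivative (\<lambda>k. k *\<^sub>R u)) (at 0)"
      by (auto intro!: derivative_eq_intros)
    have "(h has_derivative (\<lambda>k. inner k v)) (at (x + 0 *\<^sub>R u))"
      using assms by (simp add: gderiv_def)
    from has_derivative_compose[OF 1 this] show ?thesis
      unfolding has_field_derivative_def
      by (rule has_derivative_eq_rhs) (auto simp: inner_commute)
  qed
  then have "((\<lambda>s. (h (x + s *\<^sub>R u) - h x) / s) \<longlongrightarrow> inner v u) (at 0)"
    unfolding DERIV_def by simp
  moreover have "filterlim (\<lambda>n. 1 / real (Suc n)) (at 0) sequentially"
    unfolding filterlim_at using LIMSEQ_Suc[OF lim_1_over_n] by (auto simp del: of_nat_Suc)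
  ultimately have "(\<lambda>n. (h (x + (1 / real (Suc n)) *\<^sub>R u) - h x) / (1 / real (Suc n))) \<longlonglongrightarrow> inner v u"
    by (rule filterlim_compose)
  then show ?thesis by (simp add: mult.commute del: of_nat_Suc)
qed

text \<open>Caratheodory functions are jointly measurable: replace \<open>x\<close> by simple
  functions \<open>\<phi> n x\<close>, for which the claim is a finite case distinction, and pass to
  the limit by continuity in \<open>x\<close>.\<close>

lemma borel_measurable_caratheodory:
  fixes h :: "'a::{second_countable_topology, metric_space} \<Rightarrow> 'b \<Rightarrow> real"
  assumes meas: "\<And>x. h x \<in> borel_measurable M"
    and cont: "\<And>y. y \<in> space M \<Longrightarrow> continuous_on UNIV (\<lambda>x. h x y)"
  shows "(\<lambda>(x, y). h x y) \<in> borel_measurable (borel \<Otimes>\<^sub>M M)"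
proof -
  have "(\<lambda>x. x) \<in> borel_measurable (borel :: 'a measure)" by simp
  \<comment> \<open>\<open>undefined\<close> fills the reference point of an accompanying distance
    bound; only the pointwise convergence is kept.\<close>
  from borel_measurable_implies_sequence_metric[OF this, of undefined]
  obtain \<phi> :: "nat \<Rightarrow> 'a \<Rightarrow> 'a" where \<phi>: "\<And>n. simple_function borel (\<phi> n)" "\<And>x. (\<lambda>n. \<phi> n x) \<longlonglongrightarrow> x"
    by auto
  have "(\<lambda>z. h (\<phi> n (fst z)) (snd z)) \<in> borel_measurable (borel \<Otimes>\<^sub>M M)" for n
  proof (rule measurable_compose_countable'[where I = "range (\<phi> n)" and g = "\<lambda>z. \<phi> n (fst z)"])
    show "countable (range (\<phi> n))"
      using \<phi>(1)[of n] by (auto simp: simple_function_def intro: countable_finite)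
    have "\<phi> n \<in> measurable borel (count_space (range (\<phi> n)))"
      using measurable_simple_function[OF \<phi>(1)[of n]] \<phi>(1)[of n]
      by (auto simp: measurable_def simple_function_def)
    then show "(\<lambda>z. \<phi> n (fst z)) \<in> measurable (borel \<Otimes>\<^sub>M M) (count_space (range (\<phi> n)))"
      by (rule measurable_compose[OF measurable_fst])
    show "(\<lambda>z. h i (snd z)) \<in> borel_measurable (borel \<Otimes>\<^sub>M M)" if "i \<in> range (\<phi> n)" for i
      using meas by measurable
  qed
  moreover have "(\<lambda>n. h (\<phi> n (fst z)) (snd z)) \<longlonglongrightarrow> (case z of (x, y) \<Rightarrow> h x y)"
    if "z \<in> space (borel \<Otimes>\<^sub>M M)" for z
  proof -
    have "snd z \<in> space M" using that by (auto simp: space_pair_measure)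
    from cont[OF this] have "isCont (\<lambda>x. h x (snd z)) (fst z)"
      by (simp add: continuous_on_eq_continuous_at)
    then show ?thesis
      using \<phi>(2)[of "fst z"] by (auto simp: split_beta intro: isCont_tendsto_compose)
  qed
  ultimately show ?thesis
    by (rule borel_measurable_LIMSEQ_real[rotated])
qed

lemma closed_msupport: "closed (msupport D)"
proof -
  have "- msupport D = \<Union>{U. open U \<and> emeasure D U = 0}"
    by (auto simp: msupport_def zero_less_iff_neq_zero)
  then have "open (- msupport D)" by auto
  then show ?thesis by (simp add: closed_def)
qed

locale stochastic_oracle =
  fixes D :: "'b::second_countable_topology measure"
    and f :: "'a::euclidean_space \<Rightarrow> 'b \<Rightarrow> real"
    and \<sigma> \<beta> \<sigma>h :: real
  assumes so: "stochastic_objective D f"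
    and unbiased: "unbiased_bounded_variance D f \<sigma>"
    and smooth: "mean_square_smooth D f \<beta>"
    and bounded_differences: "bounded_gradient_differences D f \<sigma>h"
    and \<beta>_nonneg: "0 \<le> \<beta>" and \<sigma>h_nonneg: "0 \<le> \<sigma>h"
begin

abbreviation "g \<equiv> sgrad D f"
abbreviation "F \<equiv> objective D f"
abbreviation "gradF \<equiv> gradient (objective D f)"

sublocale D: prob_space D
  using so by (simp add: stochastic_objective_def)

lemma sets_D[measurable_cong]: "sets D = sets borel"
  using so by (simp add: stochastic_objective_def)

lemma space_D: "space D = UNIV"
  using sets_eq_imp_space_eq[OF sets_D] by simp

lemma GDERIV_F: "GDERIV F x :> gradF x"
  using so by (intro GDERIV_gradient) (simp add: stochastic_objective_def)

lemma msupport_measurable[measurable]: "msupport D \<in> sets D"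
  using closed_msupport[of D] by (simp add: sets_D)

lemma AE_msupport: "AE y in D. y \<in> msupport D"
  by (rule AE_in_msupport[OF sets_D])

lemma GDERIV_sgrad: "y \<in> msupport D \<Longrightarrow> GDERIV (\<lambda>x. f x y) x :> g x y"
  using so by (auto simp: stochastic_objective_def sgrad_def intro!: GDERIV_gradient)

text \<open>The gradient is evaluated at random, sample-dependent points, which requires joint
  measurability. The setting provides measurability in the sample and differentiability in the
  point.\<close>

lemma sgrad_borel_measurable: "(\<lambda>(x, y). g x y) \<in> borel_measurable (borel \<Otimes>\<^sub>M D)"
proof -
  \<comment> \<open>Cutting \<open>f\<close> off outside the support makes it continuous in
    \<open>x\<close> for every sample. Off the support the difference quotients vanish, matching the
    value 0 of \<open>sgrad\<close> there, so the limit below holds everywhere.\<close>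
  define h where "h x y = (if y \<in> msupport D then f x y else 0)" for x y
  have f_meas: "f x \<in> borel_measurable D" for x
    using so by (auto simp: stochastic_objective_def)
  have h: "(\<lambda>(x, y). h x y) \<in> borel_measurable (borel \<Otimes>\<^sub>M D)"
  proof (rule borel_measurable_caratheodory)
    show "h x \<in> borel_measurable D" for x
      unfolding h_def using f_meas[of x] by measurable
    show "continuous_on UNIV (\<lambda>x. h x y)" for y
    proof (cases "y \<in> msupport D")
      case True
      have "isCont (\<lambda>x. f x y) x" for x
        using GDERIV_sgrad[OF True, of x] has_derivative_continuous unfolding gderiv_def by blast
      then show ?thesis
        using True by (auto simp: h_def continuous_on_eq_continuous_at)
    qed (simp add: h_def)
  qed
  have g_lim: "(\<lambda>n. real (Suc n) * (h (x + (1 / real (Suc n)) *\<^sub>R u) y - h x y)) \<longlonglongrightarrow> inner (g x y) u" for x y u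
  proof (cases "y \<in> msupport D")
    case True
    then show ?thesis
      using LIMSEQ_difference_quotient_GDERIV[OF GDERIV_sgrad[OF True]] by (simp add: h_def)
  qed (simp add: h_def sgrad_def)
  have h_comp: "(\<lambda>z. h (fst z + c) (snd z)) \<in> borel_measurable (borel \<Otimes>\<^sub>M D)" for c
  proof -
    have "(\<lambda>z. (fst z + c, snd z)) \<in> measurable (borel \<Otimes>\<^sub>M D) (borel \<Otimes>\<^sub>M D)"
      by measurable
    from measurable_compose[OF this h] show ?thesis by simp
  qed
  have "(\<lambda>z. inner (g (fst z) (snd z)) u) \<in> borel_measurable (borel \<Otimes>\<^sub>M D)" for u
  proof (rule borel_measurable_LIMSEQ_real)
    show "(\<lambda>n. real (Suc n) * (h (fst z + (1 / real (Suc n)) *\<^sub>R u) (snd z) - h (fst z) (snd z)))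
        \<longlonglongrightarrow> inner (g (fst z) (snd z)) u" for z
      by (rule g_lim)
    show "(\<lambda>z. real (Suc n) * (h (fst z + (1 / real (Suc n)) *\<^sub>R u) (snd z) - h (fst z) (snd z)))
        \<in> borel_measurable (borel \<Otimes>\<^sub>M D)" for n
      using h_comp[of "(1 / real (Suc n)) *\<^sub>R u"] h_comp[of 0] by simp
  qed
  then have "(\<lambda>z. g (fst z) (snd z)) \<in> borel_measurable (borel \<Otimes>\<^sub>M D)"
    by (subst borel_measurable_euclidean_space) auto
  then show ?thesis by (simp add: split_beta')
qed

lemma sgrad_measurable[measurable (raw)]:
  "X \<in> borel_measurable N \<Longrightarrow> Y \<in> measurable N D \<Longrightarrow> (\<lambda>\<omega>. g (X \<omega>) (Y \<omega>)) \<in> borel_measurable N"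
  using measurable_compose[of "\<lambda>\<omega>. (X \<omega>, Y \<omega>)" N "borel \<Otimes>\<^sub>M D", OF _ sgrad_borel_measurable]
  by simp

lemma integrable_sgrad: "integrable D (g x)"
  and expectation_sgrad: "D.expectation (g x) = gradF x"
  using unbiased by (auto simp: unbiased_bounded_variance_def)

lemma norm_sgrad_diff_le:
  "y \<in> msupport D \<Longrightarrow> y' \<in> msupport D \<Longrightarrow> norm (g x y - g x y') \<le> 2 * \<sigma>h"
  using bounded_differences by (auto simp: bounded_gradient_differences_def)

text \<open>\<open>gradF x\<close> is the average of \<open>g x y'\<close> over \<open>y'\<close>,
  and every \<open>g x y - g x y'\<close> with both samples in the support has norm at most
  \<open>2 * \<sigma>h\<close>.\<close>

lemma norm_sgrad_noise_le:
  assumes "y \<in> msupport D"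
  shows "norm (g x y - gradF x) \<le> 2 * \<sigma>h"
proof -
  have "g x y - gradF x = D.expectation (\<lambda>y'. g x y - g x y')"
    by (simp add: integrable_sgrad expectation_sgrad D.prob_space)
  also have "norm \<dots> \<le> D.expectation (\<lambda>y'. norm (g x y - g x y'))"
    by (rule integral_norm_bound)
  also have "\<dots> \<le> D.expectation (\<lambda>y'. 2 * \<sigma>h)"
  proof (rule integral_mono_AE)
    show "integrable D (\<lambda>y'. norm (g x y - g x y'))"
      using integrable_sgrad[of x] by auto
    show "AE y' in D. norm (g x y - g x y') \<le> 2 * \<sigma>h"
      using AE_msupport by eventually_elim (auto intro: norm_sgrad_diff_le assms)
  qed simp
  finally show ?thesis by (simp add: D.prob_space)
qed

lemma AE_norm_sgrad_le: "AE y in D. norm (g x y) \<le> norm (gradF x) + 2 * \<sigma>h"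
  using AE_msupport
proof eventually_elim
  case (elim y)
  then show ?case using norm_sgrad_noise_le[OF elim, of x] norm_triangle_sub[of "g x y" "gradF x"] by linarith
qed

text \<open>At fixed points the stochastic gradients are almost surely bounded. The parameters
  \<open>c\<close> and \<open>v\<close> are general enough to cover single, centred and
  momentum-combined gradients at once.\<close>

lemma integrable_norm_sq_combination:
  "integrable D (\<lambda>y. (norm (g x y - c *\<^sub>R g x' y - v))\<^sup>2)"
proof (rule D.integrable_const_bound)
  show "AE y in D. norm ((norm (g x y - c *\<^sub>R g x' y - v))\<^sup>2)
      \<le> ((norm (gradF x) + 2 * \<sigma>h) + \<bar>c\<bar> * (norm (gradF x') + 2 * \<sigma>h) + norm v)\<^sup>2"
    using AE_norm_sgrad_le[of x] AE_norm_sgrad_le[of x']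
  proof eventually_elim
    case (elim y)
    have "norm (g x y - c *\<^sub>R g x' y - v) \<le> norm (g x y) + \<bar>c\<bar> * norm (g x' y) + norm v"
      by (metis (no_types, opaque_lifting) add_right_mono norm_scaleR norm_triangle_ineq4 order_trans)
    also have "\<dots> \<le> (norm (gradF x) + 2 * \<sigma>h) + \<bar>c\<bar> * (norm (gradF x') + 2 * \<sigma>h) + norm v"
      using elim by (intro add_mono mult_left_mono) auto
    finally show ?case by (simp add: power_mono)
  qed
qed simp

lemma norm_sq_smooth: "D.expectation (\<lambda>y. (norm (g x y - g x' y))\<^sup>2) \<le> \<beta>\<^sup>2 * (norm (x - x'))\<^sup>2"
proof -
  have "ennreal (D.expectation (\<lambda>y. (norm (g x y - g x' y))\<^sup>2)) = (\<integral>\<^sup>+y. ennreal ((norm (g x y - g x' y))\<^sup>2) \<partial>D)"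
    using integrable_norm_sq_combination[of x 1 x' 0] by (intro nn_integral_eq_integral[symmetric]) auto
  also have "\<dots> \<le> ennreal (\<beta>\<^sup>2 * (norm (x - x'))\<^sup>2)"
    using smooth by (simp add: mean_square_smooth_def)
  finally show ?thesis by (simp add: ennreal_le_iff)
qed

text \<open>The true variance at a point is kept alongside its bound
  \<open>\<sigma>\<^sup>2\<close>, because it can be compared in expectation with the realised
  \<open>\<delta>\<close>, whose sum against \<open>1 / r ^ 3\<close> is only logarithmic.\<close>

definition variance_at :: "'a \<Rightarrow> real" where
  "variance_at x = D.expectation (\<lambda>y. (norm (g x y - gradF x))\<^sup>2)"

lemma variance_at_nonneg: "0 \<le> variance_at x"
  by (simp add: variance_at_def)

lemma variance_at_le: "variance_at x \<le> \<sigma>\<^sup>2"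
proof -
  have "ennreal (variance_at x) = (\<integral>\<^sup>+y. ennreal ((norm (g x y - gradF x))\<^sup>2) \<partial>D)"
    unfolding variance_at_def
    using integrable_norm_sq_combination[of x 0 x "gradF x"] by (intro nn_integral_eq_integral[symmetric]) auto
  also have "\<dots> \<le> ennreal (\<sigma>\<^sup>2)"
    using unbiased by (simp add: unbiased_bounded_variance_def)
  finally show ?thesis by (simp add: ennreal_le_iff)
qed

lemma variance_at_le_shift: "variance_at x \<le> D.expectation (\<lambda>y. (norm (g x y - v))\<^sup>2)"
  using D.expectation_norm_sq_shift(2)[of "g x" "gradF x - v"] integrable_sgrad[of x]
    integrable_norm_sq_combination[of x 0 x 0]
  by (simp add: variance_at_def expectation_sgrad)

lemma second_moment_shift:
  shows "D.expectation (\<lambda>y. (norm (v + (g x' y - c *\<^sub>R g x y - (gradF x' - c *\<^sub>R gradF x))))\<^sup>2)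
      = (norm v)\<^sup>2 + D.expectation (\<lambda>y. (norm (g x' y - c *\<^sub>R g x y - (gradF x' - c *\<^sub>R gradF x)))\<^sup>2)"
proof -
  have int: "integrable D (\<lambda>y. g x' y - c *\<^sub>R g x y)"
    using integrable_sgrad by auto
  have "D.expectation (\<lambda>y. g x' y - c *\<^sub>R g x y) = gradF x' - c *\<^sub>R gradF x"
    using integrable_sgrad by (simp add: expectation_sgrad)
  then show ?thesis
    using D.expectation_norm_sq_shift(2)[OF int, of v] integrable_norm_sq_combination[of x' c x 0]
    by simp
qed

text \<open>Jensen's inequality in the guise of bias-variance: the squared norm of the mean of
  \<open>g x y - g x' y\<close> is at most its second moment.\<close>

lemma gradient_lipschitz: "norm (gradF x - gradF x') \<le> \<beta> * norm (x - x')"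
proof -
  have "(norm (gradF x - gradF x'))\<^sup>2 \<le> D.expectation (\<lambda>y. (norm (g x y - g x' y))\<^sup>2)"
    using second_moment_shift[of "gradF x - gradF x'" x 1 x'] by simp
  also have "\<dots> \<le> (\<beta> * norm (x - x'))\<^sup>2"
    using norm_sq_smooth[of x x'] by (simp add: power_mult_distrib)
  finally show ?thesis
    by (rule power2_le_imp_le) (simp add: \<beta>_nonneg)
qed

lemma gradient_measurable[measurable]: "gradF \<in> borel_measurable borel"
proof (rule borel_measurable_continuous_onI)
  have "\<beta>-lipschitz_on UNIV gradF"
    by (rule lipschitz_onI) (use gradient_lipschitz \<beta>_nonneg in \<open>auto simp: dist_norm\<close>)
  then show "continuous_on UNIV gradF" by (rule lipschitz_on_continuous_on)
qed

text \<open>The noise has mean zero for frozen \<open>e\<close>, \<open>x\<close>,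
  \<open>x'\<close>, \<open>a\<close>, so the old error contributes only through
  \<open>(1 - a)\<^sup>2\<close>.\<close>

lemma momentum_second_moment:
  assumes a: "0 \<le> a" "a \<le> 1"
  shows "D.expectation (\<lambda>y. (norm ((1 - a) *\<^sub>R e
            + ((g x' y - gradF x') - (1 - a) *\<^sub>R (g x y - gradF x))))\<^sup>2)
    \<le> (1 - a)\<^sup>2 * (norm e)\<^sup>2 + 2 * \<beta>\<^sup>2 * (norm (x' - x))\<^sup>2 + 2 * a\<^sup>2 * variance_at x'" (is "?L \<le> _")
proof -
  \<comment> \<open>The noise is \<open>(1 - a)\<close> times the centred gradient difference
    \<open>Z\<close> plus \<open>a\<close> times the plain noise \<open>N\<close> at
    \<open>x'\<close>: smoothness controls the former, and the variance of the latter carries the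
    small factor \<open>a\<^sup>2\<close>.\<close>
  define Z where "Z y = g x' y - 1 *\<^sub>R g x y - (gradF x' - 1 *\<^sub>R gradF x)" for y
  define N where "N y = g x' y - 0 *\<^sub>R g x y - gradF x'" for y
  have intZ: "integrable D (\<lambda>y. (norm (Z y))\<^sup>2)" and intN: "integrable D (\<lambda>y. (norm (N y))\<^sup>2)"
    unfolding Z_def N_def by (rule integrable_norm_sq_combination)+
  have "D.expectation (\<lambda>y. (norm (Z y))\<^sup>2) \<le> D.expectation (\<lambda>y. (norm (g x' y - g x y))\<^sup>2)"
    using second_moment_shift[of "gradF x' - gradF x" x' 1 x] by (simp add: Z_def)
  also note norm_sq_smooth
  finally have Z: "D.expectation (\<lambda>y. (norm (Z y))\<^sup>2) \<le> \<beta>\<^sup>2 * (norm (x' - x))\<^sup>2" .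
  have "?L = D.expectation (\<lambda>y. (norm ((1 - a) *\<^sub>R e
      + (g x' y - (1 - a) *\<^sub>R g x y - (gradF x' - (1 - a) *\<^sub>R gradF x))))\<^sup>2)"
    by (simp add: algebra_simps)
  also have "\<dots> = (norm ((1 - a) *\<^sub>R e))\<^sup>2
      + D.expectation (\<lambda>y. (norm (g x' y - (1 - a) *\<^sub>R g x y - (gradF x' - (1 - a) *\<^sub>R gradF x)))\<^sup>2)"
    by (rule second_moment_shift)
  also have "D.expectation (\<lambda>y. (norm (g x' y - (1 - a) *\<^sub>R g x y - (gradF x' - (1 - a) *\<^sub>R gradF x)))\<^sup>2)
      \<le> D.expectation (\<lambda>y. 2 * (norm (Z y))\<^sup>2 + 2 * a\<^sup>2 * (norm (N y))\<^sup>2)"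
  proof (rule integral_mono)
    show "integrable D (\<lambda>y. (norm (g x' y - (1 - a) *\<^sub>R g x y - (gradF x' - (1 - a) *\<^sub>R gradF x)))\<^sup>2)"
      by (rule integrable_norm_sq_combination)
    show "integrable D (\<lambda>y. 2 * (norm (Z y))\<^sup>2 + 2 * a\<^sup>2 * (norm (N y))\<^sup>2)"
      using intZ intN by auto
    fix y
    have "g x' y - (1 - a) *\<^sub>R g x y - (gradF x' - (1 - a) *\<^sub>R gradF x) = (1 - a) *\<^sub>R Z y + a *\<^sub>R N y"
      by (simp add: Z_def N_def algebra_simps)
    then have "(norm (g x' y - (1 - a) *\<^sub>R g x y - (gradF x' - (1 - a) *\<^sub>R gradF x)))\<^sup>2
        \<le> 2 * (norm ((1 - a) *\<^sub>R Z y))\<^sup>2 + 2 * (norm (a *\<^sub>R N y))\<^sup>2"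
      using norm_sq_add_le[of "(1 - a) *\<^sub>R Z y" "a *\<^sub>R N y"] by simp
    also have "\<dots> = 2 * ((1 - a)\<^sup>2 * (norm (Z y))\<^sup>2) + 2 * (a\<^sup>2 * (norm (N y))\<^sup>2)"
      by (simp add: power_mult_distrib)
    also have "(1 - a)\<^sup>2 * (norm (Z y))\<^sup>2 \<le> 1 * (norm (Z y))\<^sup>2"
      using a by (intro mult_right_mono) (auto simp: power_le_one)
    finally show "(norm (g x' y - (1 - a) *\<^sub>R g x y - (gradF x' - (1 - a) *\<^sub>R gradF x)))\<^sup>2
        \<le> 2 * (norm (Z y))\<^sup>2 + 2 * a\<^sup>2 * (norm (N y))\<^sup>2" by simp
  qed
  also have "\<dots> = 2 * D.expectation (\<lambda>y. (norm (Z y))\<^sup>2) + 2 * a\<^sup>2 * variance_at x'"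
    using intZ intN by (simp add: variance_at_def N_def)
  finally show ?thesis
    using Z by (simp add: power_mult_distrib)
qed

end

section \<open>Runs of META-STORM\<close>

text \<open>\<open>indep_var\<close> would force both random variables to take values in the same type.\<close>

lemma (in prob_space) distr_pair_of_product_rule:
  assumes U: "U \<in> measurable M N" and Y: "Y \<in> measurable M K"
    and ind: "\<And>A B. A \<in> sets N \<Longrightarrow> B \<in> sets K \<Longrightarrow>
      prob ((U -` A \<inter> space M) \<inter> (Y -` B \<inter> space M)) = prob (U -` A \<inter> space M) * prob (Y -` B \<inter> space M)"
  shows "distr M N U \<Otimes>\<^sub>M distr M K Y = distr M (N \<Otimes>\<^sub>M K) (\<lambda>\<omega>. (U \<omega>, Y \<omega>))"
proof (rule pair_measure_eqI)
  interpret Y: prob_space "distr M K Y" by (rule prob_space_distr[OF Y])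
  interpret U: prob_space "distr M N U" by (rule prob_space_distr[OF U])
  show "sigma_finite_measure (distr M N U)" "sigma_finite_measure (distr M K Y)" by unfold_locales
  fix A B assume A: "A \<in> sets (distr M N U)" and B: "B \<in> sets (distr M K Y)"
  have "(\<lambda>\<omega>. (U \<omega>, Y \<omega>)) -` (A \<times> B) \<inter> space M = (U -` A \<inter> space M) \<inter> (Y -` B \<inter> space M)"
    by auto
  then show "emeasure (distr M N U) A * emeasure (distr M K Y) B
      = emeasure (distr M (N \<Otimes>\<^sub>M K) (\<lambda>\<omega>. (U \<omega>, Y \<omega>))) (A \<times> B)"
    using A B U Y ind[of A B]
    by (simp add: emeasure_distr emeasure_eq_measure ennreal_mult'[symmetric])
qed (simp cong: sets_pair_measure_cong)

text \<open>Freezing: when the joint law is the product of the marginals, Fubini integrates out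
  \<open>Y\<close> with \<open>U\<close> held fixed. This takes the place of conditional
  expectations.\<close>

lemma (in prob_space) expectation_distr_pair:
  fixes h :: "_ \<Rightarrow> real"
  assumes rv: "U \<in> measurable M N" "Y \<in> measurable M K"
    and eq: "distr M N U \<Otimes>\<^sub>M distr M K Y = distr M (N \<Otimes>\<^sub>M K) (\<lambda>\<omega>. (U \<omega>, Y \<omega>))"
    and h: "h \<in> borel_measurable (N \<Otimes>\<^sub>M K)"
    and int: "integrable M (\<lambda>\<omega>. h (U \<omega>, Y \<omega>))"
  shows "integrable M (\<lambda>\<omega>. \<integral>y. h (U \<omega>, y) \<partial>distr M K Y)"
    and "expectation (\<lambda>\<omega>. h (U \<omega>, Y \<omega>)) = expectation (\<lambda>\<omega>. \<integral>y. h (U \<omega>, y) \<partial>distr M K Y)"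
proof -
  interpret Y: prob_space "distr M K Y" by (rule prob_space_distr[OF rv(2)])
  interpret U: prob_space "distr M N U" by (rule prob_space_distr[OF rv(1)])
  interpret pair_sigma_finite "distr M N U" "distr M K Y" ..
  have h': "h \<in> borel_measurable (distr M N U \<Otimes>\<^sub>M distr M K Y)" using h by simp
  have int': "integrable (distr M N U \<Otimes>\<^sub>M distr M K Y) h"
    unfolding eq using rv h int by (subst integrable_distr_eq) auto
  have meas: "(\<lambda>u. \<integral>y. h (u, y) \<partial>distr M K Y) \<in> borel_measurable N"
    using h' by (intro Y.borel_measurable_lebesgue_integral) (auto simp: split_beta')
  show "integrable M (\<lambda>\<omega>. \<integral>y. h (U \<omega>, y) \<partial>distr M K Y)"
    using integrable_fst'[OF int'] rv meas by (subst (asm) integrable_distr_eq) auto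
  have "expectation (\<lambda>\<omega>. h (U \<omega>, Y \<omega>)) = integral\<^sup>L (distr M N U \<Otimes>\<^sub>M distr M K Y) h"
    unfolding eq using rv h by (subst integral_distr) auto
  also have "\<dots> = (\<integral>u. (\<integral>y. h (u, y) \<partial>distr M K Y) \<partial>distr M N U)"
    by (rule integral_fst'[OF int', symmetric])
  also have "\<dots> = expectation (\<lambda>\<omega>. \<integral>y. h (U \<omega>, y) \<partial>distr M K Y)"
    using rv meas by (subst integral_distr) auto
  finally show "expectation (\<lambda>\<omega>. h (U \<omega>, Y \<omega>)) = expectation (\<lambda>\<omega>. \<integral>y. h (U \<omega>, y) \<partial>distr M K Y)" .
qed

locale meta_storm_run = stochastic_oracle D f \<sigma> \<beta> \<sigma>h + P: prob_space P
  for D :: "'b::second_countable_topology measure"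
    and f :: "'a::euclidean_space \<Rightarrow> 'b \<Rightarrow> real" and \<sigma> \<beta> \<sigma>h :: real
    and P :: "'w measure" +
  fixes \<xi> :: "nat \<Rightarrow> 'w \<Rightarrow> 'b" and x1 :: 'a and T :: nat and a0 b0 \<eta> p q :: real
    and x :: "nat \<Rightarrow> 'w \<Rightarrow> 'a" and a b :: "nat \<Rightarrow> 'w \<Rightarrow> real" and d :: "nat \<Rightarrow> 'w \<Rightarrow> 'a"
  assumes bounded_below: "bounded_below D f"
    and iid: "iid_samples P D \<xi>"
    and run: "\<And>\<omega>. \<omega> \<in> space P \<Longrightarrow> meta_storm g a0 b0 \<eta> p q x1 T (\<lambda>i. \<xi> i \<omega>)
         (\<lambda>t. x t \<omega>) (\<lambda>t. a t \<omega>) (\<lambda>t. b t \<omega>) (\<lambda>t. d t \<omega>)"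
    and T: "1 \<le> T" and a0: "0 < a0" and b0: "0 < b0" and \<eta>: "0 < \<eta>" and \<beta>: "0 < \<beta>"
    and p: "0 < p" "p \<le> 1 / 2" and pq: "p + 2 * q = 1"
begin

section \<open>The natural filtration of the samples\<close>

definition history :: "nat set \<Rightarrow> 'w measure" where
  "history I = vimage_algebra (space P) (\<lambda>\<omega>. \<lambda>i\<in>I. \<xi> i \<omega>) (Pi\<^sub>M I (\<lambda>_. D))"

lemma space_history[simp]: "space (history I) = space P"
  by (simp add: history_def)

lemma \<xi>_measurable_P: "1 \<le> i \<Longrightarrow> \<xi> i \<in> measurable P D"
  using iid unfolding iid_samples_def P.indep_vars_def by auto

lemma \<xi>_measurable_history: "i \<in> I \<Longrightarrow> \<xi> i \<in> measurable (history I) D"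
proof -
  assume i: "i \<in> I"
  have "(\<lambda>\<omega>. \<lambda>i\<in>I. \<xi> i \<omega>) \<in> measurable (history I) (Pi\<^sub>M I (\<lambda>_. D))"
    unfolding history_def
    by (rule measurable_vimage_algebra1) (auto simp: space_PiM space_D)
  from measurable_compose[OF this measurable_component_singleton[OF i]]
  show ?thesis using i by simp
qed

lemma measurable_history_into:
  assumes "space N = space P" "\<And>i. i \<in> I \<Longrightarrow> \<xi> i \<in> measurable N D"
  shows "measurable (history I) K \<subseteq> measurable N K"
proof -
  have "(\<lambda>\<omega>. \<omega>) \<in> measurable N (history I)"
    unfolding history_def using assms
    by (intro measurable_vimage_algebra2 measurable_restrict) auto
  from measurable_compose[OF this] show ?thesis by auto
qed

lemma measurable_history_mono: "I \<subseteq> J \<Longrightarrow> U \<in> measurable (history I) K \<Longrightarrow> U \<in> measurable (history J) K"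
  using measurable_history_into[of "history J" I K] \<xi>_measurable_history by auto

lemma measurable_history_P: "I \<subseteq> {1..} \<Longrightarrow> U \<in> measurable (history I) K \<Longrightarrow> U \<in> measurable P K"
  using measurable_history_into[of P I K] \<xi>_measurable_P by auto

lemma distr_\<xi>: "1 \<le> i \<Longrightarrow> distr P D (\<xi> i) = D"
  using iid by (simp add: iid_samples_def)

lemma prob_history_next_sample:
  assumes U: "U \<in> measurable (history {1..t}) N" and A: "A \<in> sets N" and B: "B \<in> sets D"
  shows "P.prob ((U -` A \<inter> space P) \<inter> (\<xi> (Suc t) -` B \<inter> space P))
      = P.prob (U -` A \<inter> space P) * P.prob (\<xi> (Suc t) -` B \<inter> space P)"
proof -
  \<comment> \<open>The next sample is viewed as a function on a one-element index set, so that both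
    variables have the common type needed for \<open>indep_var\<close>.\<close>
  let ?H = "\<lambda>\<omega>. \<lambda>i\<in>{1..t}. \<xi> i \<omega>" and ?H' = "\<lambda>\<omega>. \<lambda>i\<in>{Suc t}. \<xi> i \<omega>"
  have "P.indep_vars (\<lambda>_. D) \<xi> {1..}" using iid by (simp add: iid_samples_def)
  then have ind: "P.indep_var (Pi\<^sub>M {1..t} (\<lambda>_. D)) ?H (Pi\<^sub>M {Suc t} (\<lambda>_. D)) ?H'"
    by (rule P.indep_var_restrict) auto
  have "U -` A \<inter> space P \<in> sets (history {1..t})"
    using measurable_sets[OF U A] by simp
  \<comment> \<open>As a pulled-back algebra, \<open>history\<close> consists literally of preimages
    under the sample map, so the event of \<open>U\<close> becomes an event about the first
    \<open>t\<close> samples.\<close>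
  then obtain A' where A': "A' \<in> sets (Pi\<^sub>M {1..t} (\<lambda>_. D))" "U -` A \<inter> space P = ?H -` A' \<inter> space P"
    unfolding history_def by (auto simp: sets_vimage_algebra2 space_PiM space_D)
  define B' where "B' = (\<lambda>h. h (Suc t)) -` B \<inter> space (Pi\<^sub>M {Suc t} (\<lambda>_. D))"
  have B': "B' \<in> sets (Pi\<^sub>M {Suc t} (\<lambda>_. D))"
    unfolding B'_def by (rule measurable_sets[OF measurable_component_singleton[of "Suc t" "{Suc t}" "\<lambda>_. D"] B]) simp
  have B'_eq: "\<xi> (Suc t) -` B \<inter> space P = ?H' -` B' \<inter> space P"
    unfolding B'_def by (auto simp: space_PiM space_D)
  have "(U -` A \<inter> space P) \<inter> (\<xi> (Suc t) -` B \<inter> space P) = (\<lambda>\<omega>. (?H \<omega>, ?H' \<omega>)) -` (A' \<times> B') \<inter> space P"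
    unfolding A' B'_eq by auto
  then show ?thesis
    using P.indep_varD[OF ind A'(1) B'] unfolding A'(2) B'_eq by simp
qed

text \<open>The conditional-expectation device of the whole analysis: anything known after
  \<open>t\<close> samples may be frozen while sample \<open>t + 1\<close> is averaged over
  \<open>D\<close>.\<close>

lemma expectation_next_sample:
  fixes h :: "_ \<Rightarrow> real"
  assumes U: "U \<in> measurable (history {1..t}) N" and h: "h \<in> borel_measurable (N \<Otimes>\<^sub>M D)"
    and int: "integrable P (\<lambda>\<omega>. h (U \<omega>, \<xi> (Suc t) \<omega>))"
  shows "integrable P (\<lambda>\<omega>. \<integral>y. h (U \<omega>, y) \<partial>D)"
    and "P.expectation (\<lambda>\<omega>. h (U \<omega>, \<xi> (Suc t) \<omega>)) = P.expectation (\<lambda>\<omega>. \<integral>y. h (U \<omega>, y) \<partial>D)"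
proof -
  have rv: "U \<in> measurable P N" "\<xi> (Suc t) \<in> measurable P D"
    using measurable_history_P[OF _ U] \<xi>_measurable_P by auto
  have eq: "distr P N U \<Otimes>\<^sub>M distr P D (\<xi> (Suc t)) = distr P (N \<Otimes>\<^sub>M D) (\<lambda>\<omega>. (U \<omega>, \<xi> (Suc t) \<omega>))"
    using prob_history_next_sample[OF U] by (intro P.distr_pair_of_product_rule rv)
  have \<xi>: "distr P D (\<xi> (Suc t)) = D" by (simp add: distr_\<xi>)
  show "integrable P (\<lambda>\<omega>. \<integral>y. h (U \<omega>, y) \<partial>D)"
    by (rule P.expectation_distr_pair(1)[OF rv eq h int, unfolded \<xi>])
  show "P.expectation (\<lambda>\<omega>. h (U \<omega>, \<xi> (Suc t) \<omega>)) = P.expectation (\<lambda>\<omega>. \<integral>y. h (U \<omega>, y) \<partial>D)"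
    by (rule P.expectation_distr_pair(2)[OF rv eq h int, unfolded \<xi>])
qed

section \<open>Closed forms of the run in terms of \<open>r\<close>, \<open>S\<close> and
  \<open>err\<close>\<close>

definition "\<delta> t \<omega> = (norm (g (x t \<omega>) (\<xi> t \<omega>) - g (x t \<omega>) (\<xi> (Suc t) \<omega>)))\<^sup>2 / a0\<^sup>2"
definition "r t \<omega> = (1 + (\<Sum>i=1..<t. \<delta> i \<omega>)) powr (1 / 3)"
definition "S t \<omega> = b0 powr (1 / p) + (\<Sum>i=1..t. (norm (d i \<omega>))\<^sup>2)"
definition "err t \<omega> = d t \<omega> - gradF (x t \<omega>)"
text \<open>Bound for every \<open>\<delta> t\<close> on paths staying in the support: the gradient
  differences are at most \<open>2 * \<sigma>h\<close>.\<close>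

definition "c = 4 * \<sigma>h\<^sup>2 / a0\<^sup>2"

lemma c_nonneg: "0 \<le> c" by (simp add: c_def)

lemma \<delta>_nonneg: "0 \<le> \<delta> t \<omega>" by (simp add: \<delta>_def)

lemma r_ge_1: "1 \<le> r t \<omega>"
  unfolding r_def using sum_nonneg[of "{1..<t}" "\<lambda>i. \<delta> i \<omega>"] \<delta>_nonneg by (intro ge_one_powr_ge_zero) auto

lemma r_pos: "0 < r t \<omega>"
  using r_ge_1[of t \<omega>] by linarith

lemma r_cube: "r t \<omega> ^ 3 = 1 + (\<Sum>i=1..<t. \<delta> i \<omega>)"
proof -
  have "0 < 1 + (\<Sum>i=1..<t. \<delta> i \<omega>)"
    using sum_nonneg[of "{1..<t}" "\<lambda>i. \<delta> i \<omega>"] \<delta>_nonneg by (simp add: add_pos_nonneg)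
  then show ?thesis
    unfolding r_def by (subst powr_realpow[symmetric]) (auto simp: powr_powr)
qed

lemma r_step: "1 \<le> t \<Longrightarrow> r (Suc t) \<omega> ^ 3 = r t \<omega> ^ 3 + \<delta> t \<omega>"
  unfolding r_cube by simp

lemma r_1: "r 1 \<omega> = 1" by (simp add: r_def)

lemma r_mono: "1 \<le> s \<Longrightarrow> s \<le> t \<Longrightarrow> r s \<omega> \<le> r t \<omega>"
proof -
  assume "1 \<le> s" "s \<le> t"
  then have "(\<Sum>i=1..<s. \<delta> i \<omega>) \<le> (\<Sum>i=1..<t. \<delta> i \<omega>)"
    by (intro sum_mono2) (auto simp: \<delta>_nonneg)
  then show ?thesis
    unfolding r_def using sum_nonneg[of "{1..<s}" "\<lambda>i. \<delta> i \<omega>"] \<delta>_nonneg by (intro powr_mono2) auto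
qed

lemma S_pos: "0 < S t \<omega>" and S_ge: "b0 powr (1 / p) \<le> S t \<omega>"
  and S_mono: "s \<le> t \<Longrightarrow> S s \<omega> \<le> S t \<omega>" and S_Suc: "S (Suc t) \<omega> = S t \<omega> + (norm (d (Suc t) \<omega>))\<^sup>2"
proof -
  show "b0 powr (1 / p) \<le> S t \<omega>" unfolding S_def by (simp add: sum_nonneg)
  moreover have "0 < b0 powr (1 / p)" using b0 by simp
  ultimately show "0 < S t \<omega>" by linarith
  show "s \<le> t \<Longrightarrow> S s \<omega> \<le> S t \<omega>"
    unfolding S_def by (intro add_left_mono sum_mono2) auto
qed (simp add: S_def)

context
  fixes \<omega> assumes \<omega>: "\<omega> \<in> space P"
begin

lemma x_1: "x 1 \<omega> = x1" and d_1: "d 1 \<omega> = g x1 (\<xi> 1 \<omega>)"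
  using run[OF \<omega>] by (auto simp: meta_storm_def)

lemma a_eq: assumes t: "t \<in> {1..Suc T}" shows "a t \<omega> = 1 / (r t \<omega>)\<^sup>2"
proof (cases "t = 1")
  case True
  then show ?thesis using run[OF \<omega>] r_1[of \<omega>] by (auto simp: meta_storm_def)
next
  case False
  then obtain s where s: "t = Suc s" "s \<in> {1..T}" using t by (cases t) auto
  have set: "{1..s} = {1..<Suc s}" by auto
  have "a t \<omega> = (1 + (\<Sum>i=1..<t. \<delta> i \<omega>)) powr (- (2 / 3))"
    unfolding s \<delta>_def set[symmetric] using run[OF \<omega>] s(2) by (simp add: meta_storm_def)
  also have "\<dots> = r t \<omega> powr (-2)" by (simp add: r_def powr_powr)
  also have "\<dots> = 1 / (r t \<omega>)\<^sup>2" using r_pos[of t \<omega>] by (simp add: powr_minus divide_inverse)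
  finally show ?thesis .
qed

text \<open>With \<open>q = (1 - p) / 2\<close> and \<open>a = r powr (-2)\<close>, the factor
  \<open>1 / a powr q\<close> is \<open>r powr (1 - p)\<close>. Consequently
  \<open>S / b = (S / r) powr (1 - p)\<close>, so only the ratio \<open>S / r\<close> matters
  later.\<close>

lemma b_eq: assumes t: "t \<in> {1..T}" shows "b t \<omega> = S t \<omega> powr p * r t \<omega> powr (1 - p)"
proof -
  have q: "q = (1 - p) / 2" using pq by simp
  have a: "a t \<omega> = r t \<omega> powr (-2)"
    using a_eq[of t] t r_pos[of t \<omega>] by (simp add: powr_minus divide_inverse)
  have "b t \<omega> = S t \<omega> powr p / a t \<omega> powr q"
    using run[OF \<omega>] t by (auto simp: meta_storm_def S_def)
  also have "a t \<omega> powr q = r t \<omega> powr (-(1 - p))"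
  proof -
    have "-2 * q = -(1 - p)" using q by simp
    then show ?thesis by (simp only: a powr_powr)
  qed
  finally show ?thesis
    by (simp only: powr_minus_divide divide_divide_eq_right div_by_1)
qed

lemma b_ge: assumes t: "t \<in> {1..T}" shows "b0 \<le> b t \<omega>"
proof -
  have "b0 = (b0 powr (1 / p)) powr p" using b0 p by (simp add: powr_powr)
  also have "\<dots> \<le> S t \<omega> powr p" using S_ge p by (intro powr_mono2) auto
  also have "\<dots> \<le> S t \<omega> powr p * r t \<omega> powr (1 - p)"
    using p r_ge_1[of t \<omega>] ge_one_powr_ge_zero[of "r t \<omega>" "1 - p"] mult_left_mono[of 1 "r t \<omega> powr (1 - p)" "S t \<omega> powr p"]
    by simp
  finally show ?thesis using b_eq[OF t] by simp
qed

lemma b_pos: "t \<in> {1..T} \<Longrightarrow> 0 < b t \<omega>"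
  using b_ge b0 by fastforce

lemma x_Suc: "t \<in> {1..T} \<Longrightarrow> x (Suc t) \<omega> = x t \<omega> - (\<eta> / b t \<omega>) *\<^sub>R d t \<omega>"
  using run[OF \<omega>] by (auto simp: meta_storm_def)

lemma d_Suc: "t \<in> {1..T} \<Longrightarrow> d (Suc t) \<omega> = g (x (Suc t) \<omega>) (\<xi> (Suc t) \<omega>)
    + (1 - 1 / (r (Suc t) \<omega>)\<^sup>2) *\<^sub>R (d t \<omega> - g (x t \<omega>) (\<xi> (Suc t) \<omega>))"
  using run[OF \<omega>] a_eq[of "Suc t"] by (auto simp: meta_storm_def)

lemma err_Suc: "t \<in> {1..T} \<Longrightarrow> err (Suc t) \<omega> = (g (x (Suc t) \<omega>) (\<xi> (Suc t) \<omega>) - gradF (x (Suc t) \<omega>))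
    + (1 - 1 / (r (Suc t) \<omega>)\<^sup>2) *\<^sub>R (err t \<omega> - (g (x t \<omega>) (\<xi> (Suc t) \<omega>) - gradF (x t \<omega>)))"
  unfolding err_def by (simp add: d_Suc algebra_simps)

lemma err_1: "err 1 \<omega> = g x1 (\<xi> 1 \<omega>) - gradF x1"
  unfolding err_def x_1 d_1 by simp

context
  assumes supp: "\<And>i. 1 \<le> i \<Longrightarrow> \<xi> i \<omega> \<in> msupport D"
begin

lemma \<delta>_le: "1 \<le> t \<Longrightarrow> \<delta> t \<omega> \<le> c"
  unfolding \<delta>_def c_def
  using norm_sgrad_diff_le[OF supp supp, of t "Suc t" "x t \<omega>"] a0
  by (intro divide_right_mono) (auto dest: power_mono[where n = 2] simp: power_mult_distrib)

text \<open>A deterministic bound along the path. It makes the replacement of the momentum parameter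
  and the growth of the weight summable, and it supplies integrability.\<close>

lemma norm_err_le: "1 \<le> t \<Longrightarrow> t \<le> Suc T \<Longrightarrow> norm (err t \<omega>) \<le> 4 * \<sigma>h * (r t \<omega>)\<^sup>2"
proof (induction t rule: nat_induct_at_least)
  case base
  then show ?case using norm_sgrad_noise_le[OF supp, of 1 x1] \<sigma>h_nonneg r_1[of \<omega>]
    unfolding err_1 by simp
next
  case (Suc t)
  show ?case
    using Suc r_mono[of t "Suc t" \<omega>] r_ge_1[of t \<omega>]
    by (intro momentum_error_bound[OF _ _ \<sigma>h_nonneg _ _ _ err_Suc])
      (auto intro!: norm_sgrad_noise_le supp)
qed

lemma r_le: assumes t: "t \<le> Suc T" shows "r t \<omega> \<le> 1 + real T * c"
proof -
  have "r t \<omega> \<le> r t \<omega> ^ 3" using r_ge_1[of t \<omega>] by (intro self_le_power) auto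
  also have "\<dots> \<le> 1 + (\<Sum>i=1..<t. c)"
    unfolding r_cube by (intro add_left_mono sum_mono \<delta>_le) auto
  also have "\<dots> \<le> 1 + real T * c"
    using t c_nonneg by (auto intro!: mult_right_mono)
  finally show ?thesis .
qed

end

end

lemma AE_supp: "AE \<omega> in P. \<forall>i\<ge>1. \<xi> i \<omega> \<in> msupport D"
proof -
  have "AE \<omega> in P. \<xi> i \<omega> \<in> msupport D" if "1 \<le> i" for i
  proof -
    have "AE y in distr P D (\<xi> i). y \<in> msupport D"
      unfolding distr_\<xi>[OF that] by (rule AE_msupport)
    then show ?thesis
      using \<xi>_measurable_P[OF that] by (subst (asm) AE_distr_iff) auto
  qed
  then show ?thesis by (simp add: AE_all_countable)
qed

lemma AE_path:
  "AE \<omega> in P. \<omega> \<in> space P \<and> (\<forall>i\<ge>1. \<xi> i \<omega> \<in> msupport D)"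
  using AE_supp by (rule AE_mp) (auto intro: AE_I2)

subsection \<open>Measurability and boundedness\<close>

text \<open>\<open>\<delta> i\<close> compares samples \<open>i\<close> and \<open>i + 1\<close>,
  hence \<open>Suc i\<close>. Accordingly \<open>r t\<close> is known after sample \<open>t\<close>,
  one sample later than \<open>x t\<close>.\<close>

lemma \<delta>_history:
  assumes "x i \<in> borel_measurable (history {1..<i})" "1 \<le> i" "{1..Suc i} \<subseteq> I"
  shows "\<delta> i \<in> borel_measurable (history I)"
proof -
  have "i \<in> I" "Suc i \<in> I" and sub: "{1..<i} \<subseteq> I" using assms by auto
  then have [measurable]: "\<xi> i \<in> measurable (history I) D" "\<xi> (Suc i) \<in> measurable (history I) D"
    by (auto intro: \<xi>_measurable_history)
  have [measurable]: "x i \<in> borel_measurable (history I)"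
    by (rule measurable_history_mono[OF sub assms(1)])
  show ?thesis unfolding \<delta>_def by measurable
qed

lemma r_history_if_x_history:
  assumes "\<And>i. i \<in> {1..<t} \<Longrightarrow> x i \<in> borel_measurable (history {1..<i})" "{1..t} \<subseteq> I"
  shows "r t \<in> borel_measurable (history I)"
proof -
  have [measurable]: "(\<lambda>\<omega>. \<Sum>i=1..<t. \<delta> i \<omega>) \<in> borel_measurable (history I)"
    using assms by (intro borel_measurable_sum \<delta>_history) auto
  show ?thesis unfolding r_def by measurable
qed

text \<open>A run prescribes values on \<open>space P\<close> and nothing about measurability, which
  is therefore derived from the recursion, by congruence on \<open>space P\<close>. That
  \<open>x s\<close> is known before sample \<open>s\<close> is what makes \<open>\<xi> s\<close>
  fresh at \<open>x s\<close>.\<close>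

lemma x_d_history:
  "1 \<le> t \<Longrightarrow> t \<le> Suc T \<Longrightarrow>
    \<forall>s\<in>{1..t}. x s \<in> borel_measurable (history {1..<s}) \<and> d s \<in> borel_measurable (history {1..s})"
proof (induction t rule: nat_induct_at_least)
  case base
  have "(\<lambda>\<omega>. x1) \<in> borel_measurable (history {1..<1})" by simp
  then have x: "x 1 \<in> borel_measurable (history {1..<1})"
    by (rule measurable_cong[THEN iffD2, rotated]) (simp add: x_1[simplified])
  have [measurable]: "\<xi> 1 \<in> measurable (history {1..1}) D"
    by (rule \<xi>_measurable_history) simp
  have "(\<lambda>\<omega>. g x1 (\<xi> 1 \<omega>)) \<in> borel_measurable (history {1..1})" by measurable
  then have "d 1 \<in> borel_measurable (history {1..1})"
    by (rule measurable_cong[THEN iffD2, rotated]) (simp add: d_1[simplified])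
  with x show ?case by simp
next
  case (Suc t)
  then have t: "t \<in> {1..T}" by auto
  have IH: "x s \<in> borel_measurable (history {1..<s})" "d s \<in> borel_measurable (history {1..s})"
    if "s \<in> {1..t}" for s
    using Suc that by auto
  have d_meas: "d s \<in> borel_measurable (history I)" if "s \<in> {1..t}" "{1..t} \<subseteq> I" for s I
    using that by (intro measurable_history_mono[OF _ IH(2)]) auto
  have x_meas: "x s \<in> borel_measurable (history I)" if "s \<in> {1..t}" "{1..t} \<subseteq> I" for s I
    using that by (intro measurable_history_mono[OF _ IH(1)]) auto
  have [measurable]: "d t \<in> borel_measurable (history {1..t})" "x t \<in> borel_measurable (history {1..t})"
    "d t \<in> borel_measurable (history {1..Suc t})" "x t \<in> borel_measurable (history {1..Suc t})"
    using t by (auto intro!: d_meas x_meas)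
  have [measurable]: "r t \<in> borel_measurable (history {1..t})"
    by (rule r_history_if_x_history) (use IH(1) in auto)
  have [measurable]: "r (Suc t) \<in> borel_measurable (history {1..Suc t})"
    by (rule r_history_if_x_history) (use IH(1) in auto)
  have [measurable]: "S t \<in> borel_measurable (history {1..t})"
    unfolding S_def
    by (intro borel_measurable_add borel_measurable_sum borel_measurable_const borel_measurable_power
      measurable_compose[OF d_meas borel_measurable_norm]) auto
  have "(\<lambda>\<omega>. x t \<omega> - (\<eta> / (S t \<omega> powr p * r t \<omega> powr (1 - p))) *\<^sub>R d t \<omega>) \<in> borel_measurable (history {1..t})"
    by measurable
  then have x: "x (Suc t) \<in> borel_measurable (history {1..t})"
    by (rule measurable_cong[THEN iffD2, rotated]) (simp add: x_Suc[OF _ t] b_eq[OF _ t])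
  have [measurable]: "x (Suc t) \<in> borel_measurable (history {1..Suc t})"
    by (rule measurable_history_mono[OF _ x]) auto
  have [measurable]: "\<xi> (Suc t) \<in> measurable (history {1..Suc t}) D"
    by (rule \<xi>_measurable_history) simp
  have "(\<lambda>\<omega>. g (x (Suc t) \<omega>) (\<xi> (Suc t) \<omega>)
    + (1 - 1 / (r (Suc t) \<omega>)\<^sup>2) *\<^sub>R (d t \<omega> - g (x t \<omega>) (\<xi> (Suc t) \<omega>))) \<in> borel_measurable (history {1..Suc t})"
    by measurable
  then have "d (Suc t) \<in> borel_measurable (history {1..Suc t})"
    by (rule measurable_cong[THEN iffD2, rotated]) (simp add: d_Suc[OF _ t])
  moreover have "{1..<Suc t} = {1..t}" by auto
  ultimately show ?case
    using IH x by (auto simp: le_Suc_eq)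
qed

context
  fixes I :: "nat set" and t :: nat
  assumes t: "1 \<le> t" "t \<le> Suc T" and I: "{1..t} \<subseteq> I"
begin

lemma d_history: "d t \<in> borel_measurable (history I)"
proof (rule measurable_history_mono[OF I])
  show "d t \<in> borel_measurable (history {1..t})" using x_d_history[OF t] t by simp
qed

lemma x_history': "x t \<in> borel_measurable (history I)"
proof (rule measurable_history_mono)
  show "{1..<t} \<subseteq> I" using I by auto
qed (use x_d_history[OF t] t in auto)

lemma r_history: "r t \<in> borel_measurable (history I)"
  using x_d_history[OF t] I by (intro r_history_if_x_history) auto

lemma err_history: "err t \<in> borel_measurable (history I)"
proof -
  note [measurable] = d_history x_history'
  show ?thesis unfolding err_def by measurable
qed

end

lemma x_history: "t \<in> {1..T} \<Longrightarrow> x (Suc t) \<in> borel_measurable (history {1..t})"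
proof -
  assume "t \<in> {1..T}"
  then have "x (Suc t) \<in> borel_measurable (history {1..<Suc t})"
    using x_d_history[of "Suc t"] by auto
  then show ?thesis unfolding atLeastLessThanSuc_atLeastAtMost .
qed

lemma P_measurable[measurable]:
  assumes "1 \<le> t" "t \<le> Suc T"
  shows "x t \<in> borel_measurable P" "d t \<in> borel_measurable P" "r t \<in> borel_measurable P"
    "err t \<in> borel_measurable P" "\<delta> t \<in> borel_measurable P"
proof -
  show "x t \<in> borel_measurable P" "d t \<in> borel_measurable P" "r t \<in> borel_measurable P"
    "err t \<in> borel_measurable P"
    using assms x_history' d_history r_history err_history
    by (auto intro!: measurable_history_P[of "{1..}"])
  show "\<delta> t \<in> borel_measurable P"
    using assms x_d_history[OF assms] by (intro measurable_history_P[of "{1..}"] \<delta>_history) auto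
qed

lemma S_measurable[measurable]: "t \<le> Suc T \<Longrightarrow> S t \<in> borel_measurable P"
  unfolding S_def
  by (intro borel_measurable_add borel_measurable_sum borel_measurable_const borel_measurable_power
      measurable_compose[OF P_measurable(2) borel_measurable_norm]) auto

lemma b_measurable[measurable]: assumes t: "t \<in> {1..T}" shows "b t \<in> borel_measurable P"
proof -
  have [measurable]: "S t \<in> borel_measurable P" "r t \<in> borel_measurable P" using t by auto
  have "(\<lambda>\<omega>. S t \<omega> powr p * r t \<omega> powr (1 - p)) \<in> borel_measurable P" by measurable
  then show ?thesis by (rule measurable_cong[THEN iffD2, rotated]) (simp add: b_eq[OF _ t])
qed

text \<open>Almost surely bounded variables form an algebra, which settles all integrability
  questions. The bounds may depend on \<open>T\<close>; they never enter the rate.\<close>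

definition bounded_rv :: "('w \<Rightarrow> real) \<Rightarrow> bool" where
  "bounded_rv X \<longleftrightarrow> X \<in> borel_measurable P \<and> (\<exists>K. AE \<omega> in P. \<bar>X \<omega>\<bar> \<le> K)"

lemma bounded_rvI: "X \<in> borel_measurable P \<Longrightarrow> (AE \<omega> in P. \<bar>X \<omega>\<bar> \<le> K) \<Longrightarrow> bounded_rv X"
  unfolding bounded_rv_def by auto

lemma bounded_rv_const: "bounded_rv (\<lambda>_. k)"
  by (rule bounded_rvI[of _ "\<bar>k\<bar>"]) auto

lemma bounded_rv_integrable: "bounded_rv X \<Longrightarrow> integrable P X"
  unfolding bounded_rv_def using P.integrable_const_bound[of X] by auto

lemma bounded_rv_mono: "X \<in> borel_measurable P \<Longrightarrow> bounded_rv Y \<Longrightarrow> (AE \<omega> in P. \<bar>X \<omega>\<bar> \<le> Y \<omega>) \<Longrightarrow> bounded_rv X"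
  unfolding bounded_rv_def
proof safe
  fix K assume le: "AE \<omega> in P. \<bar>X \<omega>\<bar> \<le> Y \<omega>" and K: "AE \<omega> in P. \<bar>Y \<omega>\<bar> \<le> K"
  have "AE \<omega> in P. \<bar>X \<omega>\<bar> \<le> K" using le K by eventually_elim linarith
  then show "\<exists>K. AE \<omega> in P. \<bar>X \<omega>\<bar> \<le> K" ..
qed

lemma bounded_rv_add: "bounded_rv X \<Longrightarrow> bounded_rv Y \<Longrightarrow> bounded_rv (\<lambda>\<omega>. X \<omega> + Y \<omega>)"
proof -
  assume X: "bounded_rv X" and Y: "bounded_rv Y"
  then obtain K L where "AE \<omega> in P. \<bar>X \<omega>\<bar> \<le> K" "AE \<omega> in P. \<bar>Y \<omega>\<bar> \<le> L" unfolding bounded_rv_def by auto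
  then have "AE \<omega> in P. \<bar>X \<omega> + Y \<omega>\<bar> \<le> K + L" by eventually_elim linarith
  then show ?thesis using X Y by (intro bounded_rvI) (auto simp: bounded_rv_def)
qed

lemma bounded_rv_mult: "bounded_rv X \<Longrightarrow> bounded_rv Y \<Longrightarrow> bounded_rv (\<lambda>\<omega>. X \<omega> * Y \<omega>)"
proof -
  assume X: "bounded_rv X" and Y: "bounded_rv Y"
  then obtain K L where "AE \<omega> in P. \<bar>X \<omega>\<bar> \<le> K" "AE \<omega> in P. \<bar>Y \<omega>\<bar> \<le> L" unfolding bounded_rv_def by auto
  then have "AE \<omega> in P. \<bar>X \<omega> * Y \<omega>\<bar> \<le> K * L"
    by eventually_elim (auto simp: abs_mult intro!: mult_mono)
  then show ?thesis using X Y by (intro bounded_rvI) (auto simp: bounded_rv_def)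
qed

lemma bounded_rv_power: "bounded_rv X \<Longrightarrow> bounded_rv (\<lambda>\<omega>. X \<omega> ^ n)"
  by (induction n) (auto intro: bounded_rv_const bounded_rv_mult)

lemma bounded_rv_sum: "(\<And>i. i \<in> A \<Longrightarrow> bounded_rv (X i)) \<Longrightarrow> bounded_rv (\<lambda>\<omega>. \<Sum>i\<in>A. X i \<omega>)"
  by (induction A rule: infinite_finite_induct) (auto intro: bounded_rv_const bounded_rv_add)

lemma bounded_rv_divide:
  assumes X: "bounded_rv X" and Y: "Y \<in> borel_measurable P" "0 < k" "\<And>\<omega>. \<omega> \<in> space P \<Longrightarrow> k \<le> Y \<omega>"
  shows "bounded_rv (\<lambda>\<omega>. X \<omega> / Y \<omega>)"
proof -
  obtain K where "AE \<omega> in P. \<bar>X \<omega>\<bar> \<le> K" using X unfolding bounded_rv_def by auto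
  with AE_space have "AE \<omega> in P. \<bar>X \<omega> / Y \<omega>\<bar> \<le> K / k"
  proof eventually_elim
    case (elim \<omega>)
    have "\<bar>X \<omega> / Y \<omega>\<bar> = \<bar>X \<omega>\<bar> / Y \<omega>" using Y(3)[OF elim(1)] Y(2) by simp
    also have "\<dots> \<le> K / k" using elim Y(2) Y(3)[OF elim(1)] by (intro frac_le) auto
    finally show ?case .
  qed
  then show ?thesis using X Y by (intro bounded_rvI) (auto simp: bounded_rv_def)
qed

lemma bounded_rv_divide_r: "bounded_rv X \<Longrightarrow> 1 \<le> t \<Longrightarrow> t \<le> Suc T \<Longrightarrow> bounded_rv (\<lambda>\<omega>. X \<omega> / r t \<omega> ^ n)"
  using r_ge_1 by (intro bounded_rv_divide[where k = 1]) (auto intro: one_le_power)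

lemma bounded_rv_r: "1 \<le> t \<Longrightarrow> t \<le> Suc T \<Longrightarrow> bounded_rv (r t)"
proof (rule bounded_rvI)
  assume t: "1 \<le> t" "t \<le> Suc T"
  show "AE \<omega> in P. \<bar>r t \<omega>\<bar> \<le> 1 + real T * c"
    using AE_path
  proof eventually_elim
    case (elim \<omega>)
    then show ?case using r_le[of \<omega> t] t r_pos[of t \<omega>] by auto
  qed
qed auto

lemma bounded_rv_\<delta>: "1 \<le> t \<Longrightarrow> t \<le> Suc T \<Longrightarrow> bounded_rv (\<delta> t)"
proof (rule bounded_rvI)
  assume t: "1 \<le> t" "t \<le> Suc T"
  show "AE \<omega> in P. \<bar>\<delta> t \<omega>\<bar> \<le> c"
    using AE_path
  proof eventually_elim
    case (elim \<omega>)
    then show ?case using \<delta>_le[of \<omega> t] t \<delta>_nonneg[of t \<omega>] by auto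
  qed
qed auto

lemma bounded_rv_norm_err: assumes t: "1 \<le> t" "t \<le> Suc T" shows "bounded_rv (\<lambda>\<omega>. norm (err t \<omega>))"
proof (rule bounded_rv_mono)
  show "bounded_rv (\<lambda>\<omega>. 4 * \<sigma>h * (r t \<omega>)\<^sup>2)"
    using t by (intro bounded_rv_mult bounded_rv_const bounded_rv_power bounded_rv_r)
  show "AE \<omega> in P. \<bar>norm (err t \<omega>)\<bar> \<le> 4 * \<sigma>h * (r t \<omega>)\<^sup>2"
    using AE_path
  proof eventually_elim
    case (elim \<omega>)
    then show ?case using norm_err_le[of \<omega> t] t by auto
  qed
  show "(\<lambda>\<omega>. norm (err t \<omega>)) \<in> borel_measurable P" using t by simp
qed

text \<open>Induction over the iterations: a step has length at most
  \<open>\<eta> / b0 * norm (d t)\<close>, so the Lipschitz gradient stays bounded, and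
  \<open>d\<close> differs from it by the bounded \<open>err\<close>.\<close>

lemma bounded_rv_norm_d: "1 \<le> t \<Longrightarrow> t \<le> Suc T \<Longrightarrow> bounded_rv (\<lambda>\<omega>. norm (gradF (x t \<omega>))) \<and> bounded_rv (\<lambda>\<omega>. norm (d t \<omega>))"
proof -
  have *: "bounded_rv (\<lambda>\<omega>. norm (d t \<omega>))"
    if t: "1 \<le> t" "t \<le> Suc T" and gx: "bounded_rv (\<lambda>\<omega>. norm (gradF (x t \<omega>)))" for t
  proof (rule bounded_rv_mono)
    show "bounded_rv (\<lambda>\<omega>. norm (gradF (x t \<omega>)) + norm (err t \<omega>))"
      using t gx by (intro bounded_rv_add bounded_rv_norm_err)
    show "AE \<omega> in P. \<bar>norm (d t \<omega>)\<bar> \<le> norm (gradF (x t \<omega>)) + norm (err t \<omega>)"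
      unfolding err_def by (auto intro: norm_triangle_sub)
    show "(\<lambda>\<omega>. norm (d t \<omega>)) \<in> borel_measurable P" using t by simp
  qed
  have "1 \<le> t \<Longrightarrow> t \<le> Suc T \<Longrightarrow> bounded_rv (\<lambda>\<omega>. norm (gradF (x t \<omega>)))"
  proof (induction t rule: nat_induct_at_least)
    case base
    have [measurable]: "x 1 \<in> borel_measurable P" by (rule P_measurable) auto
    show ?case
    proof (rule bounded_rvI)
      show "AE \<omega> in P. \<bar>norm (gradF (x 1 \<omega>))\<bar> \<le> norm (gradF x1)"
        using AE_space by eventually_elim (simp only: x_1 abs_norm_cancel order_refl)
    qed measurable
  next
    case (Suc t)
    then have t: "t \<in> {1..T}" by auto
    have IH: "bounded_rv (\<lambda>\<omega>. norm (gradF (x t \<omega>)))" using Suc by auto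
    have d: "bounded_rv (\<lambda>\<omega>. norm (d t \<omega>))" using Suc t IH by (intro *) auto
    have [measurable]: "x (Suc t) \<in> borel_measurable P" using Suc by (intro P_measurable) auto
    show ?case
    proof (rule bounded_rv_mono)
      show "bounded_rv (\<lambda>\<omega>. norm (gradF (x t \<omega>)) + \<beta> * (\<eta> / b0 * norm (d t \<omega>)))"
        by (intro bounded_rv_add bounded_rv_mult bounded_rv_const IH d)
      show "(\<lambda>\<omega>. norm (gradF (x (Suc t) \<omega>))) \<in> borel_measurable P" by measurable
      show "AE \<omega> in P. \<bar>norm (gradF (x (Suc t) \<omega>))\<bar> \<le> norm (gradF (x t \<omega>)) + \<beta> * (\<eta> / b0 * norm (d t \<omega>))"
        using AE_space
      proof eventually_elim
        case (elim \<omega>)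
        have "norm (x (Suc t) \<omega> - x t \<omega>) = \<eta> / b t \<omega> * norm (d t \<omega>)"
          using x_Suc[OF elim t] b_pos[OF elim t] \<eta> by simp
        also have "\<dots> \<le> \<eta> / b0 * norm (d t \<omega>)"
          using b_ge[OF elim t] b0 \<eta> by (intro mult_right_mono frac_le) auto
        finally have "\<beta> * norm (x (Suc t) \<omega> - x t \<omega>) \<le> \<beta> * (\<eta> / b0 * norm (d t \<omega>))"
          using \<beta> by (intro mult_left_mono) auto
        then show ?case
          using gradient_lipschitz[of "x (Suc t) \<omega>" "x t \<omega>"]
            norm_triangle_sub[of "gradF (x (Suc t) \<omega>)" "gradF (x t \<omega>)"] by simp
      qed
    qed
  qed
  then show "1 \<le> t \<Longrightarrow> t \<le> Suc T \<Longrightarrow> ?thesis" using *[of t] by auto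
qed

subsection \<open>Variance reduction\<close>

lemma r_cube_le: 
  assumes \<omega>: "\<omega> \<in> space P" and supp: "\<forall>i\<ge>1. \<xi> i \<omega> \<in> msupport D" and t: "1 \<le> t"
  shows "r (Suc t) \<omega> ^ 3 \<le> (1 + c) * r t \<omega> ^ 3"
proof -
  have "1 \<le> r t \<omega> ^ 3" using r_ge_1 by (intro one_le_power)
  then have "c * 1 \<le> c * r t \<omega> ^ 3" using c_nonneg by (intro mult_left_mono)
  then show ?thesis
    using r_step[OF t, of \<omega>] \<delta>_le[of \<omega> t] \<omega> supp t by (simp add: algebra_simps)
qed

lemma noise_second_moment:
  assumes X: "X \<in> borel_measurable (history {1..t})"
  shows "integrable P (\<lambda>\<omega>. (norm (g (X \<omega>) (\<xi> (Suc t) \<omega>) - gradF (X \<omega>)))\<^sup>2)"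
    and "P.expectation (\<lambda>\<omega>. (norm (g (X \<omega>) (\<xi> (Suc t) \<omega>) - gradF (X \<omega>)))\<^sup>2) \<le> \<sigma>\<^sup>2"
proof -
  define h where "h = (\<lambda>(u, y). (norm (g u y - gradF u))\<^sup>2)"
  have h: "h \<in> borel_measurable (borel \<Otimes>\<^sub>M D)"
    unfolding h_def split_beta' by measurable
  have [measurable]: "X \<in> borel_measurable P" "\<xi> (Suc t) \<in> measurable P D"
    using measurable_history_P[OF _ X] \<xi>_measurable_P by auto
  have int: "integrable P (\<lambda>\<omega>. h (X \<omega>, \<xi> (Suc t) \<omega>))"
  proof (rule P.integrable_const_bound)
    show "AE \<omega> in P. norm (h (X \<omega>, \<xi> (Suc t) \<omega>)) \<le> (2 * \<sigma>h)\<^sup>2"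
      using AE_path
    proof eventually_elim
      case (elim \<omega>)
      then have "norm (g (X \<omega>) (\<xi> (Suc t) \<omega>) - gradF (X \<omega>)) \<le> 2 * \<sigma>h"
        by (intro norm_sgrad_noise_le) auto
      then have "(norm (g (X \<omega>) (\<xi> (Suc t) \<omega>) - gradF (X \<omega>)))\<^sup>2 \<le> (2 * \<sigma>h)\<^sup>2"
        by (intro power_mono) auto
      then show ?case by (simp add: h_def)
    qed
    show "(\<lambda>\<omega>. h (X \<omega>, \<xi> (Suc t) \<omega>)) \<in> borel_measurable P"
      unfolding h_def by simp
  qed
  then show "integrable P (\<lambda>\<omega>. (norm (g (X \<omega>) (\<xi> (Suc t) \<omega>) - gradF (X \<omega>)))\<^sup>2)"
    by (simp add: h_def)
  note E = expectation_next_sample[OF X h int]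
  have "P.expectation (\<lambda>\<omega>. h (X \<omega>, \<xi> (Suc t) \<omega>)) \<le> P.expectation (\<lambda>\<omega>. \<sigma>\<^sup>2)"
    unfolding E(2)
  proof (rule integral_mono[OF E(1)])
    show "(\<integral>y. h (X \<omega>, y) \<partial>D) \<le> \<sigma>\<^sup>2" for \<omega>
      using variance_at_le[of "X \<omega>"] by (simp add: h_def variance_at_def)
  qed simp
  then show "P.expectation (\<lambda>\<omega>. (norm (g (X \<omega>) (\<xi> (Suc t) \<omega>) - gradF (X \<omega>)))\<^sup>2) \<le> \<sigma>\<^sup>2"
    by (simp add: h_def P.prob_space)
qed

text \<open>Both samples in \<open>\<delta> t\<close> are fresh for \<open>x t\<close>, which is
  known after \<open>t - 1\<close> samples. Each deviation from \<open>gradF\<close> contributes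
  \<open>2 * \<sigma>\<^sup>2\<close>.\<close>

lemma expectation_\<delta>_le:
  assumes t: "t \<in> {1..T}"
  shows "P.expectation (\<delta> t) \<le> 4 * \<sigma>\<^sup>2 / a0\<^sup>2"
proof -
  obtain s where s: "t = Suc s" using t by (cases t) auto
  have 1: "x t \<in> borel_measurable (history {1..s})"
  proof -
    have "x t \<in> borel_measurable (history {1..<t})" using x_d_history[of t] t by auto
    then show ?thesis unfolding s atLeastLessThanSuc_atLeastAtMost .
  qed
  have 2: "x t \<in> borel_measurable (history {1..t})"
    using t by (intro x_history') auto
  let ?N1 = "\<lambda>\<omega>. (norm (g (x t \<omega>) (\<xi> t \<omega>) - gradF (x t \<omega>)))\<^sup>2"
  let ?N2 = "\<lambda>\<omega>. (norm (g (x t \<omega>) (\<xi> (Suc t) \<omega>) - gradF (x t \<omega>)))\<^sup>2"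
  note N1 = noise_second_moment[OF 1, folded s] and N2 = noise_second_moment[OF 2]
  have "P.expectation (\<delta> t) \<le> P.expectation (\<lambda>\<omega>. (2 * ?N1 \<omega> + 2 * ?N2 \<omega>) / a0\<^sup>2)"
  proof (rule integral_mono)
    show "integrable P (\<delta> t)" using t by (intro bounded_rv_integrable bounded_rv_\<delta>) auto
    show "integrable P (\<lambda>\<omega>. (2 * ?N1 \<omega> + 2 * ?N2 \<omega>) / a0\<^sup>2)" using N1(1) N2(1) by auto
    show "\<delta> t \<omega> \<le> (2 * ?N1 \<omega> + 2 * ?N2 \<omega>) / a0\<^sup>2" for \<omega>
      unfolding \<delta>_def
      using norm_sq_add_le[of "g (x t \<omega>) (\<xi> t \<omega>) - gradF (x t \<omega>)" "- (g (x t \<omega>) (\<xi> (Suc t) \<omega>) - gradF (x t \<omega>))"]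
      by (intro divide_right_mono) (auto simp: norm_minus_commute)
  qed
  also have "\<dots> = (2 * P.expectation ?N1 + 2 * P.expectation ?N2) / a0\<^sup>2"
    using N1(1) N2(1) by simp
  also have "\<dots> \<le> 4 * \<sigma>\<^sup>2 / a0\<^sup>2"
    using N1(2) N2(2) by (intro divide_right_mono) auto
  finally show ?thesis .
qed

lemma expectation_r_cube_le: "P.expectation (\<lambda>\<omega>. r (Suc T) \<omega> ^ 3) \<le> 1 + 4 * \<sigma>\<^sup>2 / a0\<^sup>2 * real T"
proof -
  have int: "integrable P (\<delta> t)" if "t \<in> {1..T}" for t
    using that by (intro bounded_rv_integrable bounded_rv_\<delta>) auto
  have "P.expectation (\<lambda>\<omega>. r (Suc T) \<omega> ^ 3) = P.expectation (\<lambda>\<omega>. 1 + (\<Sum>t=1..T. \<delta> t \<omega>))"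
    unfolding r_cube atLeastLessThanSuc_atLeastAtMost ..
  also have "\<dots> = 1 + (\<Sum>t=1..T. P.expectation (\<delta> t))"
    using int by (subst Bochner_Integration.integral_add)
      (auto simp: P.prob_space intro!: Bochner_Integration.integral_sum Bochner_Integration.integrable_sum)
  also have "\<dots> \<le> 1 + (\<Sum>t=1..T. 4 * \<sigma>\<^sup>2 / a0\<^sup>2)"
    by (intro add_left_mono sum_mono expectation_\<delta>_le)
  finally show ?thesis by (simp add: mult.commute)
qed

text \<open>\<open>\<xi> (Suc s)\<close> is fresh at time \<open>s\<close>, and the mean minimises the second moment.\<close>

lemma expectation_variance_le_\<delta>:
  assumes t: "t \<in> {1..<T}"
  shows "integrable P (\<lambda>\<omega>. variance_at (x (Suc t) \<omega>) / r t \<omega> ^ 3)"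
    and "P.expectation (\<lambda>\<omega>. variance_at (x (Suc t) \<omega>) / r t \<omega> ^ 3)
      \<le> a0\<^sup>2 * P.expectation (\<lambda>\<omega>. \<delta> (Suc t) \<omega> / r t \<omega> ^ 3)"
proof -
  define h :: "('a \<times> 'b \<times> real) \<times> 'b \<Rightarrow> real"
    where "h = (\<lambda>((u, z, \<rho>), y). (norm (g u z - g u y))\<^sup>2 / \<rho> ^ 3)"
  define U where "U \<omega> = (x (Suc t) \<omega>, \<xi> (Suc t) \<omega>, r t \<omega>)" for \<omega>
  have h: "h \<in> borel_measurable ((borel \<Otimes>\<^sub>M D \<Otimes>\<^sub>M borel) \<Otimes>\<^sub>M D)"
    unfolding h_def split_beta' by measurable
  have 1: "x (Suc t) \<in> borel_measurable (history {1..Suc t})"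
    "\<xi> (Suc t) \<in> measurable (history {1..Suc t}) D" "r t \<in> borel_measurable (history {1..Suc t})"
    using t by (auto intro!: x_history' r_history \<xi>_measurable_history)
  then have U: "U \<in> measurable (history {1..Suc t}) (borel \<Otimes>\<^sub>M D \<Otimes>\<^sub>M borel)"
    unfolding U_def by measurable
  have hU: "h (U \<omega>, \<xi> (Suc (Suc t)) \<omega>) = a0\<^sup>2 * (\<delta> (Suc t) \<omega> / r t \<omega> ^ 3)" for \<omega>
    using a0 by (simp add: h_def U_def \<delta>_def)
  have bounded_rv: "bounded_rv (\<lambda>\<omega>. \<delta> (Suc t) \<omega> / r t \<omega> ^ 3)"
    using t by (intro bounded_rv_divide_r bounded_rv_\<delta>) auto
  then have int: "integrable P (\<lambda>\<omega>. h (U \<omega>, \<xi> (Suc (Suc t)) \<omega>))"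
    unfolding hU by (intro integrable_mult_right bounded_rv_integrable) auto
  note E = expectation_next_sample[OF U h int]
  have var_meas: "variance_at \<in> borel_measurable borel"
    unfolding variance_at_def by (rule D.borel_measurable_lebesgue_integral) (simp add: split_beta')
  have [measurable]: "x (Suc t) \<in> borel_measurable P" "r t \<in> borel_measurable P"
    using t by (auto intro!: P_measurable)
  show int2: "integrable P (\<lambda>\<omega>. variance_at (x (Suc t) \<omega>) / r t \<omega> ^ 3)"
  proof (intro bounded_rv_integrable bounded_rv_divide_r)
    show "bounded_rv (\<lambda>\<omega>. variance_at (x (Suc t) \<omega>))"
      using variance_at_le variance_at_nonneg var_meas by (intro bounded_rvI[of _ "\<sigma>\<^sup>2"]) auto
  qed (use t in auto)
  have "P.expectation (\<lambda>\<omega>. variance_at (x (Suc t) \<omega>) / r t \<omega> ^ 3)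
      \<le> P.expectation (\<lambda>\<omega>. \<integral>y. h (U \<omega>, y) \<partial>D)"
  proof (rule integral_mono[OF int2 E(1)])
    fix \<omega>
    have "variance_at (x (Suc t) \<omega>) / r t \<omega> ^ 3
        \<le> D.expectation (\<lambda>y. (norm (g (x (Suc t) \<omega>) y - g (x (Suc t) \<omega>) (\<xi> (Suc t) \<omega>)))\<^sup>2) / r t \<omega> ^ 3"
      using r_pos[of t \<omega>] by (intro divide_right_mono variance_at_le_shift) auto
    also have "\<dots> = (\<integral>y. h (U \<omega>, y) \<partial>D)"
      by (simp add: h_def U_def norm_minus_commute)
    finally show "variance_at (x (Suc t) \<omega>) / r t \<omega> ^ 3 \<le> (\<integral>y. h (U \<omega>, y) \<partial>D)" .
  qed
  also have "\<dots> = a0\<^sup>2 * P.expectation (\<lambda>\<omega>. \<delta> (Suc t) \<omega> / r t \<omega> ^ 3)"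
    unfolding E(2)[symmetric] hU by (simp del: times_divide_eq_right)
  finally show "P.expectation (\<lambda>\<omega>. variance_at (x (Suc t) \<omega>) / r t \<omega> ^ 3)
      \<le> a0\<^sup>2 * P.expectation (\<lambda>\<omega>. \<delta> (Suc t) \<omega> / r t \<omega> ^ 3)" .
qed

text \<open>Expected relative growth of \<open>r ^ 3\<close>. The noise terms of the error recursion
  are expressed in this unit because its sum is a logarithm.\<close>

definition "L t = P.expectation (\<lambda>\<omega>. \<delta> t \<omega> / r t \<omega> ^ 3)"
text \<open>\<open>\<eta>\<^sup>2 * V t\<close> is \<open>r t\<close> times the squared length of
  step \<open>t\<close>.\<close>

definition "V t \<omega> = r t \<omega> * (norm (d t \<omega>))\<^sup>2 / (b t \<omega>)\<^sup>2"

lemma bounded_rv_V: assumes t: "t \<in> {1..T}" shows "bounded_rv (V t)"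
proof -
  have "bounded_rv (\<lambda>\<omega>. r t \<omega> * (norm (d t \<omega>))\<^sup>2 / (b t \<omega>)\<^sup>2)"
  proof (rule bounded_rv_divide[where k = "b0\<^sup>2"])
    show "bounded_rv (\<lambda>\<omega>. r t \<omega> * (norm (d t \<omega>))\<^sup>2)"
      using t bounded_rv_norm_d[of t] by (intro bounded_rv_mult bounded_rv_power bounded_rv_r) auto
    show "b0\<^sup>2 \<le> (b t \<omega>)\<^sup>2" if "\<omega> \<in> space P" for \<omega>
      using b_ge[OF that t] b0 by (intro power_mono) auto
  qed (use b0 b_measurable[OF t] in auto)
  then show ?thesis unfolding V_def[abs_def] .
qed

text \<open>The weight is \<open>r t\<close> on both sides, as it must be known before sample
  \<open>t + 1\<close> to be frozen; its growth to \<open>r (t + 1)\<close> is settled when the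
  steps are summed. The term \<open>norm (err t) ^ 2 / r t\<close> is the dissipation
  \<open>r t * a t * norm (err t) ^ 2\<close>.\<close>

lemma variance_reduction_step:
  assumes t: "t \<in> {1..<T}"
  shows "P.expectation (\<lambda>\<omega>. r t \<omega> * (norm (err (Suc t) \<omega>))\<^sup>2)
    \<le> P.expectation (\<lambda>\<omega>. r t \<omega> * (norm (err t \<omega>))\<^sup>2) - P.expectation (\<lambda>\<omega>. (norm (err t \<omega>))\<^sup>2 / r t \<omega>)
      + 4 * \<beta>\<^sup>2 * \<eta>\<^sup>2 * P.expectation (V t) + 4 * a0\<^sup>2 * (1 + c) * L (Suc t) + 72 * \<sigma>h\<^sup>2 * c * L t"
proof -
  have t': "1 \<le> t" "t \<le> Suc T" "1 \<le> Suc t" "Suc t \<le> Suc T" "t \<in> {1..T}" using t by auto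
  define h :: "('a \<times> 'a \<times> 'a \<times> real) \<times> 'b \<Rightarrow> real"
    where "h = (\<lambda>((u, u', e, \<rho>), y). \<rho> * (1 + 1 / \<rho>\<^sup>2) * (norm ((1 - 1 / \<rho>\<^sup>2) *\<^sub>R e
      + ((g u' y - gradF u') - (1 - 1 / \<rho>\<^sup>2) *\<^sub>R (g u y - gradF u))))\<^sup>2)"
  define U where "U \<omega> = (x t \<omega>, x (Suc t) \<omega>, err t \<omega>, r t \<omega>)" for \<omega>
  let ?\<xi> = "\<xi> (Suc t)"
  have h: "h \<in> borel_measurable ((borel \<Otimes>\<^sub>M borel \<Otimes>\<^sub>M borel \<Otimes>\<^sub>M borel) \<Otimes>\<^sub>M D)"
    unfolding h_def split_beta' by measurable
  have 1: "x t \<in> borel_measurable (history {1..t})" "x (Suc t) \<in> borel_measurable (history {1..t})"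
    "err t \<in> borel_measurable (history {1..t})" "r t \<in> borel_measurable (history {1..t})"
    using t by (auto intro!: x_history' x_history[simplified] err_history r_history)
  then have U: "U \<in> measurable (history {1..t}) (borel \<Otimes>\<^sub>M borel \<Otimes>\<^sub>M borel \<Otimes>\<^sub>M borel)"
    unfolding U_def by measurable
  have hU_meas: "(\<lambda>\<omega>. h (U \<omega>, ?\<xi> \<omega>)) \<in> borel_measurable P"
    using U h \<xi>_measurable_P[of "Suc t"] measurable_history_P[OF _ U]
    by (intro measurable_compose[OF _ h]) auto
  have ar: "0 \<le> 1 / (r s \<omega>)\<^sup>2" "1 / (r s \<omega>)\<^sup>2 \<le> 1" for s \<omega>
    using r_ge_1[of s \<omega>] by (auto simp: field_simps)
  have bounded_rv_err: "bounded_rv (\<lambda>\<omega>. norm (err t \<omega>))" and bounded_rv_err': "bounded_rv (\<lambda>\<omega>. norm (err (Suc t) \<omega>))"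
    and bounded_rv_r_t: "bounded_rv (r t)"
    using t' by (auto intro!: bounded_rv_norm_err bounded_rv_r)
  have int: "integrable P (\<lambda>\<omega>. h (U \<omega>, ?\<xi> \<omega>))"
  proof (rule bounded_rv_integrable, rule bounded_rv_mono[OF hU_meas])
    show "bounded_rv (\<lambda>\<omega>. 2 * r t \<omega> * (norm (err t \<omega>) + 4 * \<sigma>h)\<^sup>2)"
      by (intro bounded_rv_mult bounded_rv_power bounded_rv_add bounded_rv_const bounded_rv_err bounded_rv_r_t)
    show "AE \<omega> in P. \<bar>h (U \<omega>, ?\<xi> \<omega>)\<bar> \<le> 2 * r t \<omega> * (norm (err t \<omega>) + 4 * \<sigma>h)\<^sup>2"
      using AE_path
    proof eventually_elim
      case (elim \<omega>)
      define \<alpha> where "\<alpha> = 1 - 1 / (r t \<omega>)\<^sup>2"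
      have \<alpha>: "0 \<le> \<alpha>" "\<alpha> \<le> 1" using ar[of t \<omega>] by (auto simp: \<alpha>_def)
      define m n where "m = g (x (Suc t) \<omega>) (?\<xi> \<omega>) - gradF (x (Suc t) \<omega>)"
        and "n = g (x t \<omega>) (?\<xi> \<omega>) - gradF (x t \<omega>)"
      have mn: "norm m \<le> 2 * \<sigma>h" "norm n \<le> 2 * \<sigma>h"
        unfolding m_def n_def using elim by (auto intro!: norm_sgrad_noise_le)
      have "norm (\<alpha> *\<^sub>R err t \<omega> + (m - \<alpha> *\<^sub>R n)) \<le> norm (\<alpha> *\<^sub>R err t \<omega>) + (norm m + norm (\<alpha> *\<^sub>R n))"
        by (meson add_left_mono norm_triangle_ineq norm_triangle_ineq4 order_trans)
      also have "\<dots> \<le> 1 * norm (err t \<omega>) + (norm m + 1 * norm n)"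
        using \<alpha> by (auto intro!: add_mono mult_left_le_one_le)
      also have "\<dots> \<le> norm (err t \<omega>) + 4 * \<sigma>h" using mn by simp
      finally have "(norm (\<alpha> *\<^sub>R err t \<omega> + (m - \<alpha> *\<^sub>R n)))\<^sup>2 \<le> (norm (err t \<omega>) + 4 * \<sigma>h)\<^sup>2"
        by (intro power_mono) auto
      moreover have "r t \<omega> * (1 + 1 / (r t \<omega>)\<^sup>2) \<le> r t \<omega> * 2"
        using ar[of t \<omega>] r_pos[of t \<omega>] by (intro mult_left_mono) auto
      ultimately have "r t \<omega> * (1 + 1 / (r t \<omega>)\<^sup>2) * (norm (\<alpha> *\<^sub>R err t \<omega> + (m - \<alpha> *\<^sub>R n)))\<^sup>2
          \<le> r t \<omega> * 2 * (norm (err t \<omega>) + 4 * \<sigma>h)\<^sup>2"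
        using ar[of t \<omega>] r_pos[of t \<omega>] by (intro mult_mono) auto
      moreover have "h (U \<omega>, ?\<xi> \<omega>) = r t \<omega> * (1 + 1 / (r t \<omega>)\<^sup>2) * (norm (\<alpha> *\<^sub>R err t \<omega> + (m - \<alpha> *\<^sub>R n)))\<^sup>2"
        by (simp add: h_def U_def \<alpha>_def m_def n_def)
      moreover have "0 \<le> r t \<omega> * (1 + 1 / (r t \<omega>)\<^sup>2) * (norm (\<alpha> *\<^sub>R err t \<omega> + (m - \<alpha> *\<^sub>R n)))\<^sup>2"
        using ar[of t \<omega>] r_pos[of t \<omega>] by simp
      ultimately show ?case by (simp add: mult.commute)
    qed
  qed
  note E = expectation_next_sample[OF U h int]
  note Var = expectation_variance_le_\<delta>[OF t]
  have int_re: "integrable P (\<lambda>\<omega>. r t \<omega> * (norm (err t \<omega>))\<^sup>2)"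
    and int_re': "integrable P (\<lambda>\<omega>. r t \<omega> * (norm (err (Suc t) \<omega>))\<^sup>2)"
    by (intro bounded_rv_integrable bounded_rv_mult bounded_rv_power bounded_rv_err bounded_rv_err' bounded_rv_r_t)+
  have int_er: "integrable P (\<lambda>\<omega>. (norm (err t \<omega>))\<^sup>2 / r t \<omega>)"
    using bounded_rv_divide_r[OF bounded_rv_power[OF bounded_rv_err, of 2] t'(1,2), of 1] by (auto intro: bounded_rv_integrable)
  have int_V: "integrable P (V t)" using bounded_rv_V t' by (intro bounded_rv_integrable) auto
  have int_\<delta>: "integrable P (\<lambda>\<omega>. \<delta> t \<omega> / r t \<omega> ^ 3)"
    "integrable P (\<lambda>\<omega>. \<delta> (Suc t) \<omega> / r (Suc t) \<omega> ^ 3)" "integrable P (\<lambda>\<omega>. \<delta> (Suc t) \<omega> / r t \<omega> ^ 3)"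
    using t' by (auto intro!: bounded_rv_integrable bounded_rv_divide_r bounded_rv_\<delta>)
  have "P.expectation (\<lambda>\<omega>. r t \<omega> * (norm (err (Suc t) \<omega>))\<^sup>2)
      \<le> P.expectation (\<lambda>\<omega>. h (U \<omega>, ?\<xi> \<omega>) + 72 * \<sigma>h\<^sup>2 * c * (\<delta> t \<omega> / r t \<omega> ^ 3))"
  proof (rule integral_mono_AE[OF int_re'])
    show "integrable P (\<lambda>\<omega>. h (U \<omega>, ?\<xi> \<omega>) + 72 * \<sigma>h\<^sup>2 * c * (\<delta> t \<omega> / r t \<omega> ^ 3))"
      by (intro Bochner_Integration.integrable_add integrable_mult_right int int_\<delta>)
    show "AE \<omega> in P. r t \<omega> * (norm (err (Suc t) \<omega>))\<^sup>2 \<le> h (U \<omega>, ?\<xi> \<omega>) + 72 * \<sigma>h\<^sup>2 * c * (\<delta> t \<omega> / r t \<omega> ^ 3)"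
      using AE_path
    proof eventually_elim
      case (elim \<omega>)
      show ?case
        unfolding h_def U_def split
        using elim t' r_pos[of "Suc t" \<omega>]
        by (intro momentum_error_step[where r' = "r (Suc t) \<omega>"] r_ge_1 r_step \<delta>_nonneg \<sigma>h_nonneg
            \<delta>_le norm_err_le norm_sgrad_noise_le err_Suc) auto
    qed
  qed
  also have "\<dots> = P.expectation (\<lambda>\<omega>. \<integral>y. h (U \<omega>, y) \<partial>D) + 72 * \<sigma>h\<^sup>2 * c * L t"
    using int int_\<delta> by (simp add: E(2) L_def del: times_divide_eq_right)
  also have "P.expectation (\<lambda>\<omega>. \<integral>y. h (U \<omega>, y) \<partial>D)
      \<le> P.expectation (\<lambda>\<omega>. r t \<omega> * (norm (err t \<omega>))\<^sup>2 - (norm (err t \<omega>))\<^sup>2 / r t \<omega>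
          + 4 * \<beta>\<^sup>2 * \<eta>\<^sup>2 * V t \<omega> + 4 * (variance_at (x (Suc t) \<omega>) / r t \<omega> ^ 3))"
  proof (rule integral_mono_AE[OF E(1)])
    show "integrable P (\<lambda>\<omega>. r t \<omega> * (norm (err t \<omega>))\<^sup>2 - (norm (err t \<omega>))\<^sup>2 / r t \<omega>
          + 4 * \<beta>\<^sup>2 * \<eta>\<^sup>2 * V t \<omega> + 4 * (variance_at (x (Suc t) \<omega>) / r t \<omega> ^ 3))"
      by (intro Bochner_Integration.integrable_add Bochner_Integration.integrable_diff
        integrable_mult_right int_re int_er int_V Var(1))
    show "AE \<omega> in P. (\<integral>y. h (U \<omega>, y) \<partial>D) \<le> r t \<omega> * (norm (err t \<omega>))\<^sup>2 - (norm (err t \<omega>))\<^sup>2 / r t \<omega>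
          + 4 * \<beta>\<^sup>2 * \<eta>\<^sup>2 * V t \<omega> + 4 * (variance_at (x (Suc t) \<omega>) / r t \<omega> ^ 3)"
      using AE_space
    proof eventually_elim
      case (elim \<omega>)
      define \<rho> \<alpha> v e where "\<rho> = r t \<omega>" and "\<alpha> = 1 / \<rho>\<^sup>2" and "v = variance_at (x (Suc t) \<omega>)"
        and "e = (norm (err t \<omega>))\<^sup>2"
      have \<rho>: "1 \<le> \<rho>" using r_ge_1 by (simp add: \<rho>_def)
      have \<alpha>: "0 \<le> \<alpha>" "\<alpha> \<le> 1" using ar[of t \<omega>] by (auto simp: \<alpha>_def \<rho>_def)
      have v: "0 \<le> v" and e: "0 \<le> e" using variance_at_nonneg by (auto simp: v_def e_def)
      have dx: "(norm (x (Suc t) \<omega> - x t \<omega>))\<^sup>2 = \<eta>\<^sup>2 * ((norm (d t \<omega>))\<^sup>2 / (b t \<omega>)\<^sup>2)"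
        using x_Suc[OF elim t'(5)] by (simp add: power_divide power_mult_distrib)
      have "(\<integral>y. h (U \<omega>, y) \<partial>D) = \<rho> * (1 + \<alpha>) * D.expectation (\<lambda>y. (norm ((1 - \<alpha>) *\<^sub>R err t \<omega>
            + ((g (x (Suc t) \<omega>) y - gradF (x (Suc t) \<omega>)) - (1 - \<alpha>) *\<^sub>R (g (x t \<omega>) y - gradF (x t \<omega>)))))\<^sup>2)"
        by (simp add: h_def U_def \<rho>_def \<alpha>_def)
      also have "\<dots> \<le> \<rho> * (1 + \<alpha>) * ((1 - \<alpha>)\<^sup>2 * (norm (err t \<omega>))\<^sup>2
          + 2 * \<beta>\<^sup>2 * (norm (x (Suc t) \<omega> - x t \<omega>))\<^sup>2 + 2 * \<alpha>\<^sup>2 * variance_at (x (Suc t) \<omega>))"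
        using \<rho> \<alpha> by (intro mult_left_mono momentum_second_moment) auto
      also have "\<dots> = \<rho> * ((1 + \<alpha>) * (1 - \<alpha>)\<^sup>2 * e)
          + \<rho> * (1 + \<alpha>) * (2 * \<beta>\<^sup>2 * (norm (x (Suc t) \<omega> - x t \<omega>))\<^sup>2) + \<rho> * (1 + \<alpha>) * (2 * \<alpha>\<^sup>2 * v)"
        by (simp add: algebra_simps e_def v_def)
      also have "\<dots> \<le> \<rho> * ((1 - \<alpha>) * e)
          + \<rho> * 2 * (2 * \<beta>\<^sup>2 * (norm (x (Suc t) \<omega> - x t \<omega>))\<^sup>2) + \<rho> * 2 * (2 * \<alpha>\<^sup>2 * v)"
      proof (intro add_mono mult_right_mono mult_left_mono)
        \<comment> \<open>One factor of the contraction cancels the Young factor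
          \<open>1 + \<alpha>\<close>; the other survives and yields the dissipation.\<close>
        have "(1 + \<alpha>) * (1 - \<alpha>)\<^sup>2 = (1 - \<alpha>\<^sup>2) * (1 - \<alpha>)"
          by (simp add: power2_eq_square algebra_simps)
        also have "\<dots> \<le> 1 * (1 - \<alpha>)" using \<alpha> by (intro mult_right_mono) auto
        finally show "(1 + \<alpha>) * (1 - \<alpha>)\<^sup>2 \<le> 1 - \<alpha>" by simp
      qed (use \<rho> \<alpha> v e in auto)
      also have "\<rho> * ((1 - \<alpha>) * e) = \<rho> * e - e / \<rho>"
        using \<rho> by (simp add: \<alpha>_def field_simps power2_eq_square)
      also have "\<rho> * 2 * (2 * \<beta>\<^sup>2 * (norm (x (Suc t) \<omega> - x t \<omega>))\<^sup>2) = 4 * \<beta>\<^sup>2 * \<eta>\<^sup>2 * V t \<omega>"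
        unfolding dx V_def \<rho>_def by simp
      also have "\<rho> * 2 * (2 * \<alpha>\<^sup>2 * v) = 4 * (v / \<rho> ^ 3)"
        using \<rho> by (simp add: \<alpha>_def field_simps power_numeral_reduce)
      finally show ?case unfolding \<rho>_def v_def e_def .
    qed
  qed
  also have "\<dots> = P.expectation (\<lambda>\<omega>. r t \<omega> * (norm (err t \<omega>))\<^sup>2) - P.expectation (\<lambda>\<omega>. (norm (err t \<omega>))\<^sup>2 / r t \<omega>)
      + 4 * \<beta>\<^sup>2 * \<eta>\<^sup>2 * P.expectation (V t) + 4 * P.expectation (\<lambda>\<omega>. variance_at (x (Suc t) \<omega>) / r t \<omega> ^ 3)"
    using int_re int_er int_V Var(1) by (simp del: times_divide_eq_right)
  also have "P.expectation (\<lambda>\<omega>. variance_at (x (Suc t) \<omega>) / r t \<omega> ^ 3) \<le> a0\<^sup>2 * ((1 + c) * L (Suc t))"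
  proof -
    \<comment> \<open>The variance comes with the older denominator \<open>r t ^ 3\<close>; matching
      it to the index of \<open>\<delta> (Suc t)\<close> costs \<open>1 + c\<close>.\<close>
    have "P.expectation (\<lambda>\<omega>. \<delta> (Suc t) \<omega> / r t \<omega> ^ 3)
        \<le> P.expectation (\<lambda>\<omega>. (1 + c) * (\<delta> (Suc t) \<omega> / r (Suc t) \<omega> ^ 3))"
    proof (rule integral_mono_AE)
      show "AE \<omega> in P. \<delta> (Suc t) \<omega> / r t \<omega> ^ 3 \<le> (1 + c) * (\<delta> (Suc t) \<omega> / r (Suc t) \<omega> ^ 3)"
        using AE_path
      proof eventually_elim
        case (elim \<omega>)
        have "\<delta> (Suc t) \<omega> * r (Suc t) \<omega> ^ 3 \<le> \<delta> (Suc t) \<omega> * ((1 + c) * r t \<omega> ^ 3)"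
          using elim t' by (intro mult_left_mono r_cube_le \<delta>_nonneg) auto
        then show ?case using r_pos[of t \<omega>] r_pos[of "Suc t" \<omega>] by (simp add: field_simps)
      qed
    qed (intro integrable_mult_right int_\<delta>)+
    then have "P.expectation (\<lambda>\<omega>. \<delta> (Suc t) \<omega> / r t \<omega> ^ 3) \<le> (1 + c) * L (Suc t)"
      by (simp add: L_def del: times_divide_eq_right)
    then show ?thesis using Var(2) mult_left_mono[of _ _ "a0\<^sup>2"] by (meson order_trans zero_le_power2)
  qed
  finally show ?thesis by (simp add: algebra_simps)
qed

section \<open>Summing the error recursion over the run\<close>

definition "EE \<omega> = (\<Sum>t=1..T. (norm (err t \<omega>))\<^sup>2 / r t \<omega>)"
definition "VV \<omega> = (\<Sum>t=1..T. V t \<omega>)"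
definition "Q \<omega> = (\<Sum>t=1..T. \<eta> * (norm (d t \<omega>))\<^sup>2 / b t \<omega>)"
text \<open>The constant of \<open>weight_increment_bound\<close> with
  \<open>s = \<sigma>h\<close>.\<close>

definition "K1 = 16 * \<sigma>h\<^sup>2 * (2 * c * (1 + c)) ^ 5 * (1 + c) ^ 4"
text \<open>Collects the coefficients of \<open>L\<close>: variance, replacement of the momentum
  parameter, growth of the weight. The last \<open>1 + c\<close> comes from \<open>sum_L_le\<close>,
  the leading 2 from the half of \<open>EE\<close> that is spent.\<close>

definition "K2 = 2 * (4 * a0\<^sup>2 * (1 + c) + (72 * \<sigma>h\<^sup>2 * c + K1)) * (1 + c)"

lemma K1_nonneg: "0 \<le> K1" and K2_nonneg: "0 \<le> K2"
  using c_nonneg by (auto simp: K1_def K2_def intro!: mult_nonneg_nonneg add_nonneg_nonneg)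

lemma V_nonneg: "0 \<le> V t \<omega>"
  using r_pos[of t \<omega>] by (auto simp: V_def)

lemma bounded_rv_EE: "bounded_rv EE"
proof -
  have "bounded_rv (\<lambda>\<omega>. (norm (err t \<omega>))\<^sup>2 / r t \<omega> ^ 1)" if "t \<in> {1..T}" for t
    using that by (intro bounded_rv_divide_r bounded_rv_power bounded_rv_norm_err) auto
  then show ?thesis unfolding EE_def[abs_def] by (intro bounded_rv_sum) auto
qed

lemma bounded_rv_VV: "bounded_rv VV"
  unfolding VV_def[abs_def] by (intro bounded_rv_sum bounded_rv_V)

lemma bounded_rv_Q: "bounded_rv Q"
proof -
  have "bounded_rv (\<lambda>\<omega>. \<eta> * (norm (d t \<omega>))\<^sup>2 / b t \<omega>)" if "t \<in> {1..T}" for t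
    using that bounded_rv_norm_d[of t] b0 b_ge
    by (intro bounded_rv_divide[where k = b0] bounded_rv_mult bounded_rv_power bounded_rv_const) auto
  then show ?thesis unfolding Q_def[abs_def] by (intro bounded_rv_sum) auto
qed

lemma ln_r_cube_nonneg: "0 \<le> ln (r t \<omega> ^ 3)"
  using r_ge_1[of t \<omega>] by (intro ln_ge_zero) (auto intro: one_le_power)

lemma bounded_rv_ln_r_cube: "bounded_rv (\<lambda>\<omega>. ln (r (Suc T) \<omega> ^ 3))"
proof (rule bounded_rv_mono)
  show "bounded_rv (\<lambda>\<omega>. r (Suc T) \<omega> ^ 3)" by (intro bounded_rv_power bounded_rv_r) auto
  have [measurable]: "r (Suc T) \<in> borel_measurable P" by auto
  show "(\<lambda>\<omega>. ln (r (Suc T) \<omega> ^ 3)) \<in> borel_measurable P" by measurable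
  show "AE \<omega> in P. \<bar>ln (r (Suc T) \<omega> ^ 3)\<bar> \<le> r (Suc T) \<omega> ^ 3"
  proof (rule AE_I2)
    fix \<omega>
    have "0 < r (Suc T) \<omega> ^ 3" using r_pos by simp
    then show "\<bar>ln (r (Suc T) \<omega> ^ 3)\<bar> \<le> r (Suc T) \<omega> ^ 3"
      using ln_r_cube_nonneg[of "Suc T" \<omega>] ln_le_minus_one[of "r (Suc T) \<omega> ^ 3"] by simp
  qed
qed

lemma sum_L_le: "(\<Sum>t=1..T. L t) \<le> (1 + c) * P.expectation (\<lambda>\<omega>. ln (r (Suc T) \<omega> ^ 3))"
proof -
  have int: "integrable P (\<lambda>\<omega>. \<delta> t \<omega> / r t \<omega> ^ 3)" if "t \<in> {1..T}" for t
    using that by (intro bounded_rv_integrable bounded_rv_divide_r bounded_rv_\<delta>) auto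
  have "(\<Sum>t=1..T. L t) = P.expectation (\<lambda>\<omega>. \<Sum>t=1..T. \<delta> t \<omega> / r t \<omega> ^ 3)"
    unfolding L_def using int by (intro Bochner_Integration.integral_sum[symmetric])
  also have "\<dots> \<le> P.expectation (\<lambda>\<omega>. (1 + c) * ln (r (Suc T) \<omega> ^ 3))"
  proof (rule integral_mono_AE)
    show "integrable P (\<lambda>\<omega>. \<Sum>t=1..T. \<delta> t \<omega> / r t \<omega> ^ 3)"
      using int by (intro Bochner_Integration.integrable_sum)
    show "integrable P (\<lambda>\<omega>. (1 + c) * ln (r (Suc T) \<omega> ^ 3))"
      by (intro bounded_rv_integrable bounded_rv_mult bounded_rv_const bounded_rv_ln_r_cube)
    show "AE \<omega> in P. (\<Sum>t=1..T. \<delta> t \<omega> / r t \<omega> ^ 3) \<le> (1 + c) * ln (r (Suc T) \<omega> ^ 3)"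
      using AE_path
    proof eventually_elim
      case (elim \<omega>)
      have "(\<Sum>t=1..T. \<delta> t \<omega> / r t \<omega> ^ 3) \<le> (1 + c) * (ln (r (Suc T) \<omega> ^ 3) - ln (r 1 \<omega> ^ 3))"
        using elim
        by (intro sum_increment_ratio_le_ln[of T "\<lambda>t. r t \<omega> ^ 3"])
          (auto intro: one_le_power r_ge_1 simp: r_step \<delta>_nonneg \<delta>_le)
      then show ?case by (simp only: r_1 power_one ln_one diff_0_right)
    qed
  qed
  finally show ?thesis by simp
qed

text \<open>Raising the weight from \<open>r t\<close> to \<open>r (t + 1)\<close> consumes half of
  the next dissipation, so half of \<open>EE\<close> survives the telescoping. Doubling gives
  \<open>8 = 2 * 4\<close> and \<open>32 = 2 * 16\<close>, where
  \<open>16 * \<sigma>h\<^sup>2\<close> bounds the initial potential.\<close>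

lemma expectation_EE_le:
  "P.expectation EE \<le> 32 * \<sigma>h\<^sup>2 + 8 * \<beta>\<^sup>2 * \<eta>\<^sup>2 * P.expectation VV
    + K2 * P.expectation (\<lambda>\<omega>. ln (r (Suc T) \<omega> ^ 3))"
proof -
  define u where "u t = P.expectation (\<lambda>\<omega>. r t \<omega> * (norm (err t \<omega>))\<^sup>2)" for t
  define e where "e t = P.expectation (\<lambda>\<omega>. (norm (err t \<omega>))\<^sup>2 / r t \<omega>)" for t
  define v where "v t = P.expectation (V t)" for t
  define A B C where "A = 4 * \<beta>\<^sup>2 * \<eta>\<^sup>2" and "B = 4 * a0\<^sup>2 * (1 + c)" and "C = 72 * \<sigma>h\<^sup>2 * c + K1"
  have ABC: "0 \<le> A" "0 \<le> B" "0 \<le> C" using c_nonneg K1_nonneg by (auto simp: A_def B_def C_def)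
  have v: "0 \<le> v t" for t unfolding v_def by (intro Bochner_Integration.integral_nonneg V_nonneg)
  have L: "0 \<le> L t" for t
    unfolding L_def using \<delta>_nonneg r_pos by (intro Bochner_Integration.integral_nonneg divide_nonneg_pos) auto
  have int_er: "integrable P (\<lambda>\<omega>. (norm (err t \<omega>))\<^sup>2 / r t \<omega>)" if "t \<in> {1..T}" for t
    using bounded_rv_divide_r[OF bounded_rv_power[OF bounded_rv_norm_err, of t 2], of t 1] that by (auto intro: bounded_rv_integrable)
  have int_re: "integrable P (\<lambda>\<omega>. r s \<omega> * (norm (err t \<omega>))\<^sup>2)" if "t \<in> {1..T}" "s \<in> {1..T}" for s t
    using that by (intro bounded_rv_integrable bounded_rv_mult bounded_rv_power bounded_rv_norm_err bounded_rv_r) auto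
  have int_\<delta>: "integrable P (\<lambda>\<omega>. \<delta> t \<omega> / r t \<omega> ^ 3)" if "t \<in> {1..T}" for t
    using that by (intro bounded_rv_integrable bounded_rv_divide_r bounded_rv_\<delta>) auto
  have step: "u (Suc t) \<le> u t - e t + e (Suc t) / 2 + A * v t + B * L (Suc t) + C * L t"
    if t: "t \<in> {1..<T}" for t
  proof -
    have t': "t \<in> {1..T}" "Suc t \<in> {1..T}" using t by auto
    have "u (Suc t) \<le> P.expectation (\<lambda>\<omega>. r t \<omega> * (norm (err (Suc t) \<omega>))\<^sup>2
        + ((1 / 2) * ((norm (err (Suc t) \<omega>))\<^sup>2 / r (Suc t) \<omega>) + K1 * (\<delta> t \<omega> / r t \<omega> ^ 3)))"
      unfolding u_def
    proof (rule integral_mono_AE)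
      show "AE \<omega> in P. r (Suc t) \<omega> * (norm (err (Suc t) \<omega>))\<^sup>2 \<le> r t \<omega> * (norm (err (Suc t) \<omega>))\<^sup>2
        + ((1 / 2) * ((norm (err (Suc t) \<omega>))\<^sup>2 / r (Suc t) \<omega>) + K1 * (\<delta> t \<omega> / r t \<omega> ^ 3))"
        using AE_path
      proof eventually_elim
        case (elim \<omega>)
        have "(r (Suc t) \<omega> - r t \<omega>) * (norm (err (Suc t) \<omega>))\<^sup>2
            \<le> (norm (err (Suc t) \<omega>))\<^sup>2 / r (Suc t) \<omega> / 2 + K1 * (\<delta> t \<omega> / r t \<omega> ^ 3)"
          unfolding K1_def using elim t' r_pos[of "Suc t" \<omega>]
          by (intro weight_increment_bound r_ge_1 r_step \<delta>_nonneg \<delta>_le norm_err_le) auto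
        then show ?case by (simp add: algebra_simps)
      qed
    qed (intro Bochner_Integration.integrable_add integrable_mult_right int_re int_er int_\<delta> t')+
    also have "\<dots> = P.expectation (\<lambda>\<omega>. r t \<omega> * (norm (err (Suc t) \<omega>))\<^sup>2) + (e (Suc t) / 2 + K1 * L t)"
    proof -
      have "P.expectation (\<lambda>\<omega>. X \<omega> + ((1 / 2) * Y \<omega> + K1 * Z \<omega>))
          = P.expectation X + (P.expectation Y / 2 + K1 * P.expectation Z)"
        if "integrable P X" "integrable P Y" "integrable P Z" for X Y Z
        using that by simp
      from this[OF int_re[OF t'(2) t'(1)] int_er[OF t'(2)] int_\<delta>[OF t'(1)]]
      show ?thesis unfolding e_def L_def .
    qed
    finally show ?thesis
      using variance_reduction_step[OF t] unfolding u_def e_def v_def A_def B_def C_def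
      by (simp add: algebra_simps)
  qed
  \<comment> \<open>The negative term \<open>e (Suc n) / 2\<close> is dissipation already spent on
    the weight but not yet recovered. At \<open>n = T - 1\<close> it is compensated by
    \<open>e T \<le> u T\<close>.\<close>
  have "u (Suc n) + (\<Sum>t=1..n. e t) / 2 - e (Suc n) / 2
      \<le> u 1 + A * (\<Sum>t=1..n. v t) + B * (\<Sum>t=1..Suc n. L t) + C * (\<Sum>t=1..n. L t)" if "Suc n \<le> T" for n
    using that
  proof (induction n)
    case 0
    have "0 \<le> e 1" unfolding e_def using r_pos by (intro Bochner_Integration.integral_nonneg divide_nonneg_pos) auto
    moreover have "0 \<le> B * L 1" using ABC L by simp
    ultimately show ?case by simp
  next
    case (Suc n)
    then have "Suc n \<in> {1..<T}" by auto
    from step[OF this] Suc show ?case by (simp add: algebra_simps add_divide_distrib)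
  qed
  from this[of "T - 1"] T
  have "u T + (\<Sum>t=1..T-1. e t) / 2 - e T / 2
      \<le> u 1 + A * (\<Sum>t=1..T-1. v t) + B * (\<Sum>t=1..T. L t) + C * (\<Sum>t=1..T-1. L t)"
    by simp
  also have "\<dots> \<le> u 1 + A * (\<Sum>t=1..T. v t) + B * (\<Sum>t=1..T. L t) + C * (\<Sum>t=1..T. L t)"
    using ABC v L by (intro add_mono mult_left_mono sum_mono2) auto
  finally have "u T + (\<Sum>t=1..T-1. e t) / 2 - e T / 2
      \<le> u 1 + A * (\<Sum>t=1..T. v t) + (B + C) * (\<Sum>t=1..T. L t)"
    by (simp add: algebra_simps)
  moreover have "(\<Sum>t=1..T. e t) = (\<Sum>t=1..T-1. e t) + e T"
    using T sum.cl_ivl_Suc[of e 1 "T - 1"] by simp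
  moreover have "e T \<le> u T"
    unfolding e_def u_def
  proof (rule integral_mono)
    show "(norm (err T \<omega>))\<^sup>2 / r T \<omega> \<le> r T \<omega> * (norm (err T \<omega>))\<^sup>2" for \<omega>
    proof -
      have "(norm (err T \<omega>))\<^sup>2 / r T \<omega> \<le> (norm (err T \<omega>))\<^sup>2 / 1"
        using r_ge_1[of T \<omega>] by (intro divide_left_mono) auto
      also have "\<dots> \<le> r T \<omega> * (norm (err T \<omega>))\<^sup>2"
        using r_ge_1[of T \<omega>] mult_right_mono[of 1 "r T \<omega>" "(norm (err T \<omega>))\<^sup>2"] by simp
      finally show ?thesis .
    qed
  qed (use T in \<open>auto intro!: int_er int_re\<close>)
  moreover have "u 1 \<le> 16 * \<sigma>h\<^sup>2"
  proof -
    have "u 1 \<le> P.expectation (\<lambda>\<omega>. 16 * \<sigma>h\<^sup>2)"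
      unfolding u_def
    proof (rule integral_mono_AE)
      show "integrable P (\<lambda>\<omega>. r 1 \<omega> * (norm (err 1 \<omega>))\<^sup>2)" using T by (intro int_re) auto
      show "AE \<omega> in P. r 1 \<omega> * (norm (err 1 \<omega>))\<^sup>2 \<le> 16 * \<sigma>h\<^sup>2"
        using AE_path
      proof eventually_elim
        case (elim \<omega>)
        then have "norm (err 1 \<omega>) \<le> 4 * \<sigma>h * (r 1 \<omega>)\<^sup>2" by (intro norm_err_le) auto
        then have "(norm (err 1 \<omega>))\<^sup>2 \<le> (4 * \<sigma>h)\<^sup>2"
          unfolding r_1 by (intro power_mono) auto
        then show ?case unfolding r_1 by (simp add: power_mult_distrib)
      qed
    qed simp
    then show ?thesis by (simp add: P.prob_space)
  qed
  moreover have "(B + C) * (\<Sum>t=1..T. L t) \<le> (B + C) * ((1 + c) * P.expectation (\<lambda>\<omega>. ln (r (Suc T) \<omega> ^ 3)))"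
    using ABC by (intro mult_left_mono sum_L_le) auto
  ultimately have "(\<Sum>t=1..T. e t) \<le> 32 * \<sigma>h\<^sup>2 + 2 * A * (\<Sum>t=1..T. v t)
      + 2 * ((B + C) * ((1 + c) * P.expectation (\<lambda>\<omega>. ln (r (Suc T) \<omega> ^ 3))))"
    by linarith
  moreover have "(\<Sum>t=1..T. e t) = P.expectation EE"
    unfolding EE_def[abs_def] e_def using int_er by (intro Bochner_Integration.integral_sum[symmetric]) auto
  moreover have "(\<Sum>t=1..T. v t) = P.expectation VV"
    unfolding VV_def[abs_def] v_def using bounded_rv_integrable[OF bounded_rv_V]
    by (intro Bochner_Integration.integral_sum[symmetric]) auto
  ultimately show ?thesis unfolding A_def B_def C_def K2_def by (simp add: algebra_simps)
qed

section \<open>Descent along a path and absorption of the step lengths\<close>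

definition "gap = F x1 - (INF y. F y)"

lemma F_ge_INF: "(INF y. F y) \<le> F y"
  using bounded_below unfolding bounded_below_def by (intro cINF_lower) auto

lemma gap_nonneg: "0 \<le> gap"
  using F_ge_INF[of x1] by (simp add: gap_def)

text \<open>Young's inequality with parameter \<open>\<beta> * r t\<close> contributes
  \<open>1 / 4\<close> and the smoothness term \<open>1 / 2\<close> of
  \<open>\<beta> * \<eta>\<^sup>2 * V t\<close>, the latter using \<open>1 \<le> r t\<close>;
  together they give \<open>3 / 4\<close>.\<close>

lemma Q_le_path:
  assumes \<omega>: "\<omega> \<in> space P"
  shows "Q \<omega> \<le> gap + EE \<omega> / \<beta> + 3 / 4 * \<beta> * \<eta>\<^sup>2 * VV \<omega>"
proof -
  have step: "\<eta> * (norm (d t \<omega>))\<^sup>2 / b t \<omega> \<le> F (x t \<omega>) - F (x (Suc t) \<omega>)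
      + ((norm (err t \<omega>))\<^sup>2 / r t \<omega> / \<beta> + 3 / 4 * \<beta> * \<eta>\<^sup>2 * V t \<omega>)" if t: "t \<in> {1..T}" for t
  proof -
    define s where "s = \<eta> / b t \<omega>"
    have s: "0 < s" using b_pos[OF \<omega> t] \<eta> by (simp add: s_def)
    have r: "1 \<le> r t \<omega>" by (rule r_ge_1)
    have dx: "x (Suc t) \<omega> - x t \<omega> = - s *\<^sub>R d t \<omega>"
      using x_Suc[OF \<omega> t] by (simp add: s_def)
    have "F (x (Suc t) \<omega>) \<le> F (x t \<omega>) + inner (gradF (x t \<omega>)) (- s *\<^sub>R d t \<omega>) + \<beta> / 2 * (norm (- s *\<^sub>R d t \<omega>))\<^sup>2"
      using lipschitz_gradient_descent[OF GDERIV_F gradient_lipschitz, of "x (Suc t) \<omega>" "x t \<omega>"]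
      unfolding dx .
    also have "inner (gradF (x t \<omega>)) (- s *\<^sub>R d t \<omega>) = s * inner (err t \<omega>) (d t \<omega>) - s * (norm (d t \<omega>))\<^sup>2"
      unfolding err_def by (simp add: inner_diff_left algebra_simps power2_norm_eq_inner)
    also have "(norm (- s *\<^sub>R d t \<omega>))\<^sup>2 = (s * norm (d t \<omega>))\<^sup>2"
      using s by (simp add: power_mult_distrib)
    finally have 1: "s * (norm (d t \<omega>))\<^sup>2 \<le> F (x t \<omega>) - F (x (Suc t) \<omega>) + s * inner (err t \<omega>) (d t \<omega>)
        + \<beta> / 2 * (s * norm (d t \<omega>))\<^sup>2"
      by simp
    have "s * inner (err t \<omega>) (d t \<omega>) \<le> s * (norm (err t \<omega>) * norm (d t \<omega>))"
      using s norm_cauchy_schwarz by (intro mult_left_mono) auto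
    also have "\<dots> = norm (err t \<omega>) * (s * norm (d t \<omega>))" by simp
    also have "\<dots> \<le> (norm (err t \<omega>))\<^sup>2 / (\<beta> * r t \<omega>) + \<beta> * r t \<omega> * (s * norm (d t \<omega>))\<^sup>2 / 4"
      using \<beta> r by (intro weighted_young) auto
    finally have 2: "s * inner (err t \<omega>) (d t \<omega>)
        \<le> (norm (err t \<omega>))\<^sup>2 / (\<beta> * r t \<omega>) + \<beta> * r t \<omega> * (s * norm (d t \<omega>))\<^sup>2 / 4" .
    have "\<beta> / 2 * (1 * (s * norm (d t \<omega>))\<^sup>2) \<le> \<beta> / 2 * (r t \<omega> * (s * norm (d t \<omega>))\<^sup>2)"
      using \<beta> r by (intro mult_left_mono mult_right_mono) auto
    then have 3: "\<beta> / 2 * (s * norm (d t \<omega>))\<^sup>2 \<le> \<beta> / 2 * (r t \<omega> * (s * norm (d t \<omega>))\<^sup>2)"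
      by simp
    have "r t \<omega> * (s * norm (d t \<omega>))\<^sup>2 = \<eta>\<^sup>2 * V t \<omega>"
      by (simp add: s_def V_def power_mult_distrib power_divide)
    with 2 3 have "s * inner (err t \<omega>) (d t \<omega>) + \<beta> / 2 * (s * norm (d t \<omega>))\<^sup>2
        \<le> (norm (err t \<omega>))\<^sup>2 / (\<beta> * r t \<omega>) + 3 / 4 * \<beta> * (\<eta>\<^sup>2 * V t \<omega>)"
      by (simp add: mult.assoc)
    with 1 show ?thesis by (simp add: s_def mult.commute mult.left_commute)
  qed
  have "Q \<omega> \<le> (\<Sum>t=1..T. F (x t \<omega>) - F (x (Suc t) \<omega>))
      + (\<Sum>t=1..T. (norm (err t \<omega>))\<^sup>2 / r t \<omega> / \<beta> + 3 / 4 * \<beta> * \<eta>\<^sup>2 * V t \<omega>)"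
    unfolding Q_def sum.distrib[symmetric] by (intro sum_mono step)
  also have "(\<Sum>t=1..T. F (x t \<omega>) - F (x (Suc t) \<omega>)) = F (x 1 \<omega>) - F (x (Suc T) \<omega>)"
    using sum_Suc_diff[of 1 T "\<lambda>t. - F (x t \<omega>)"] T by simp
  also have "\<dots> \<le> gap"
    unfolding x_1[OF \<omega>] gap_def using F_ge_INF[of "x (Suc T) \<omega>"] by simp
  also have "(\<Sum>t=1..T. (norm (err t \<omega>))\<^sup>2 / r t \<omega> / \<beta> + 3 / 4 * \<beta> * \<eta>\<^sup>2 * V t \<omega>)
      = EE \<omega> / \<beta> + 3 / 4 * \<beta> * \<eta>\<^sup>2 * VV \<omega>"
    unfolding EE_def VV_def sum.distrib by (simp add: sum_divide_distrib sum_distrib_left)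
  finally show ?thesis by simp
qed

text \<open>With \<open>Y = S t / r t\<close>, the summands of \<open>VV\<close> and \<open>Q\<close> are \<open>\<parallel>d\<parallel>\<^sup>2 / S\<close> times
  \<open>Y powr (1 - 2 * p)\<close> and \<open>Y powr (1 - p)\<close>, so the former is dominated once \<open>Y\<close> is of order
  \<open>\<beta> powr (1 / p)\<close>; the steps with smaller \<open>Y\<close> contribute a logarithm.\<close>

lemma VV_le_path:
  assumes \<omega>: "\<omega> \<in> space P" and \<kappa>: "0 < \<kappa>"
  defines "y0 \<equiv> (2 * \<kappa> * \<beta> / \<eta>) powr (1 / p)"
  shows "\<kappa> * \<beta> * VV \<omega> \<le> Q \<omega> / 2
    + \<kappa> * \<beta> * y0 powr (1 - 2 * p) * (\<bar>ln y0\<bar> + \<bar>ln (b0 powr (1 / p))\<bar> + ln (r (Suc T) \<omega> ^ 3))"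
proof -
  define B where "B = b0 powr (1 / p)"
  \<comment> \<open>An exceptional step has \<open>S t \<le> y0 * r t\<close>, hence
    \<open>S t \<le> y0 * r T\<close>, a threshold independent of \<open>t\<close>. The maximum with
    \<open>B\<close> keeps it above the starting value \<open>S 0\<close>.\<close>
  define M where "M = max B (y0 * r T \<omega>)"
  define w where "w t = (norm (d t \<omega>))\<^sup>2" for t
  have B: "0 < B" using b0 by (simp add: B_def)
  have base: "0 < 2 * \<kappa> * \<beta> / \<eta>" using \<kappa> \<beta> \<eta> by simp
  have y0: "0 < y0" unfolding y0_def powr_gt_zero using \<kappa> \<beta> \<eta> by simp
  have step: "\<kappa> * \<beta> * V t \<omega> \<le> \<eta> * w t / b t \<omega> / 2
      + \<kappa> * \<beta> * y0 powr (1 - 2 * p) * (if S t \<omega> \<le> M then w t / S t \<omega> else 0)" if t: "t \<in> {1..T}" for t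
  proof -
    define R s Y where "R = r t \<omega>" and "s = S t \<omega>" and "Y = s / R"
    have R: "0 < R" and s: "0 < s" using r_pos S_pos by (auto simp: R_def s_def)
    then have Y: "0 < Y" by (simp add: Y_def)
    have w0: "0 \<le> w t" by (simp add: w_def)
    have b: "b t \<omega> = s / Y powr (1 - p)"
    proof -
      have "b t \<omega> = s powr p * R powr (1 - p)" using b_eq[OF \<omega> t] by (simp add: s_def R_def)
      also have "\<dots> = s / Y powr (1 - p)"
        using R s unfolding Y_def by (simp add: powr_divide powr_diff field_simps)
      finally show ?thesis .
    qed
    have Q1: "\<eta> * w t / b t \<omega> = \<eta> * (w t / s) * Y powr (1 - p)"
      using s Y by (simp add: b)
    have "V t \<omega> = R * w t * (Y powr (1 - p))\<^sup>2 / s\<^sup>2"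
      by (simp add: V_def b R_def w_def power_divide)
    also have "\<dots> = (w t / s) * ((Y powr (1 - p))\<^sup>2 / Y)"
      using R s by (simp add: Y_def field_simps power2_eq_square)
    also have "(Y powr (1 - p))\<^sup>2 / Y = Y powr (1 - 2 * p)"
    proof -
      have "(Y powr (1 - p))\<^sup>2 / Y = Y powr (2 * (1 - p)) / Y powr 1"
        using Y by (simp add: power2_eq_square flip: powr_add)
      also have "\<dots> = Y powr (2 * (1 - p) - 1)" by (rule powr_diff[symmetric])
      also have "2 * (1 - p) - 1 = 1 - 2 * p" by simp
      finally show ?thesis .
    qed
    finally have V1: "V t \<omega> = (w t / s) * Y powr (1 - 2 * p)" .
    have good0: "0 \<le> \<eta> * w t / b t \<omega> / 2"
      using \<eta> w0 b_pos[OF \<omega> t] by simp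
    have bad0: "0 \<le> \<kappa> * \<beta> * y0 powr (1 - 2 * p) * (if S t \<omega> \<le> M then w t / S t \<omega> else 0)"
      using \<kappa> \<beta> w0 S_pos[of t \<omega>] by simp
    show ?thesis
    proof (cases "y0 \<le> Y")
      case True
      \<comment> \<open>This equation determines \<open>y0\<close>: the ratio of the
        \<open>Q\<close>-summand to the \<open>V\<close>-summand is
        \<open>\<eta> * Y powr p\<close>, which for \<open>Y \<ge> y0\<close> is at least
        \<open>2 * \<kappa> * \<beta>\<close>. The 2 leaves half of \<open>Q\<close> for
        absorption.\<close>
      have "2 * \<kappa> * \<beta> / \<eta> = y0 powr p"
        unfolding y0_def using \<kappa> \<beta> \<eta> p by (simp add: powr_powr)
      also have "\<dots> \<le> Y powr p" using True y0 p by (intro powr_mono2) auto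
      finally have "2 * \<kappa> * \<beta> \<le> \<eta> * Y powr p" using \<eta> by (simp add: field_simps)
      then have "2 * \<kappa> * \<beta> * ((w t / s) * Y powr (1 - 2 * p)) \<le> \<eta> * Y powr p * ((w t / s) * Y powr (1 - 2 * p))"
        using w0 s by (intro mult_right_mono) auto
      also have "\<dots> = \<eta> * (w t / s) * (Y powr p * Y powr (1 - 2 * p))" by (simp add: ac_simps)
      also have "Y powr p * Y powr (1 - 2 * p) = Y powr (1 - p)" by (simp flip: powr_add)
      finally have "\<kappa> * \<beta> * V t \<omega> \<le> \<eta> * w t / b t \<omega> / 2"
        unfolding Q1 V1 by simp
      then show ?thesis using bad0 by linarith
    next
      case False
      have "s = Y * R" using R by (simp add: Y_def)
      also have "\<dots> \<le> y0 * r T \<omega>"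
        using False r_mono[of t T \<omega>] t R y0 Y by (intro mult_mono) (auto simp: R_def)
      finally have sM: "S t \<omega> \<le> M" by (simp add: M_def s_def)
      have "\<kappa> * \<beta> * V t \<omega> \<le> \<kappa> * \<beta> * ((w t / s) * y0 powr (1 - 2 * p))"
        unfolding V1 using False Y p \<kappa> \<beta> w0 s by (intro mult_left_mono powr_mono2) auto
      then have "\<kappa> * \<beta> * V t \<omega> \<le> \<kappa> * \<beta> * y0 powr (1 - 2 * p) * (if S t \<omega> \<le> M then w t / S t \<omega> else 0)"
        using sM by (simp add: s_def ac_simps)
      then show ?thesis using good0 by linarith
    qed
  qed
  have "\<kappa> * \<beta> * VV \<omega> = (\<Sum>t=1..T. \<kappa> * \<beta> * V t \<omega>)"
    unfolding VV_def by (simp add: sum_distrib_left)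
  also have "\<dots> \<le> (\<Sum>t=1..T. \<eta> * w t / b t \<omega> / 2
      + \<kappa> * \<beta> * y0 powr (1 - 2 * p) * (if S t \<omega> \<le> M then w t / S t \<omega> else 0))"
    by (intro sum_mono step)
  also have "\<dots> = Q \<omega> / 2
      + \<kappa> * \<beta> * y0 powr (1 - 2 * p) * (\<Sum>t=1..T. if S t \<omega> \<le> M then w t / S t \<omega> else 0)"
    unfolding Q_def w_def by (simp add: sum.distrib sum_divide_distrib sum_distrib_left)
  also have "\<dots> \<le> Q \<omega> / 2
    + \<kappa> * \<beta> * y0 powr (1 - 2 * p) * (\<bar>ln y0\<bar> + \<bar>ln B\<bar> + ln (r (Suc T) \<omega> ^ 3))"
  proof (intro add_left_mono mult_left_mono)
    have "(\<Sum>t=1..T. if S t \<omega> \<le> M then w t / S t \<omega> else 0) \<le> ln (min (S T \<omega>) M) - ln (S 0 \<omega>)"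
    proof (rule sum_truncated_increment_ratio_le_ln)
      show "S (Suc t) \<omega> = S t \<omega> + w (Suc t) \<and> 0 \<le> w (Suc t)" for t
        by (simp add: S_Suc w_def)
      show "S 0 \<omega> \<le> M" by (simp add: S_def M_def B_def)
    qed (rule S_pos)
    also have "S 0 \<omega> = B" by (simp add: S_def B_def)
    also have "ln (min (S T \<omega>) M) - ln B \<le> ln M - ln B"
      using S_pos[of T \<omega>] B by (auto simp: min_def M_def)
    also have "\<dots> \<le> \<bar>ln y0\<bar> + \<bar>ln B\<bar> + ln (r (Suc T) \<omega> ^ 3)"
    proof (cases "B \<le> y0 * r T \<omega>")
      case True
      have "r T \<omega> \<le> r (Suc T) \<omega>" using r_mono[of T "Suc T" \<omega>] T by simp
      also have "\<dots> \<le> r (Suc T) \<omega> ^ 3" using r_ge_1[of "Suc T" \<omega>] by (intro self_le_power) auto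
      finally have "ln (r T \<omega>) \<le> ln (r (Suc T) \<omega> ^ 3)" using r_pos[of T \<omega>] by (intro ln_mono)
      moreover have "ln M = ln y0 + ln (r T \<omega>)"
        using True y0 r_pos[of T \<omega>] by (simp add: M_def max_def ln_mult)
      ultimately show ?thesis by linarith
    next
      case False
      then show ?thesis using ln_r_cube_nonneg[of "Suc T" \<omega>] by (simp add: M_def max_def)
    qed
    finally show "(\<Sum>t=1..T. if S t \<omega> \<le> M then w t / S t \<omega> else 0)
      \<le> \<bar>ln y0\<bar> + \<bar>ln B\<bar> + ln (r (Suc T) \<omega> ^ 3)" .
  qed (use \<kappa> \<beta> in auto)
  finally show ?thesis unfolding B_def .
qed

subsection \<open>Bounds in expectation\<close>

text \<open>Bounds the expectation of \<open>r (T + 1) ^ 3\<close>; the only place through which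
  \<open>\<sigma>\<close> and \<open>T\<close> enter the moment bounds.\<close>

definition "m = 1 + 4 * \<sigma>\<^sup>2 / a0\<^sup>2 * real T"
text \<open>Chosen so that the exponents \<open>ph / (1 - p) = 3 / (4 - p)\<close> of
  \<open>Q\<close> and \<open>ph / 3 = (1 - p) / (4 - p)\<close> of \<open>r ^ 3\<close> add up to
  1.\<close>

definition "ph = 3 * (1 - p) / (4 - p)"
text \<open>The threshold of \<open>VV_le_path\<close> for
  \<open>\<kappa> = 9 * \<eta>\<^sup>2\<close>; 9 exceeds the coefficient \<open>8 + 3 / 4\<close>
  that has to be absorbed.\<close>

definition "y0 = (2 * (9 * \<eta>\<^sup>2) * \<beta> / \<eta>) powr (1 / p)"
text \<open>Expected contribution of the exceptional steps, with the expected logarithm replaced by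
  \<open>ln m\<close>.\<close>

definition "W = 9 * \<eta>\<^sup>2 * \<beta> * y0 powr (1 - 2 * p) * (\<bar>ln y0\<bar> + \<bar>ln (b0 powr (1 / p))\<bar> + ln m)"

lemma m_ge_1: "1 \<le> m" by (simp add: m_def)

lemma ph_bounds: "0 < ph" "ph \<le> 1" "ph + ph / 3 \<le> 1" "ph / (1 - p) + ph / 3 = 1" "0 \<le> ph / (1 - p)"
proof -
  have "3 * u / w / u = 3 / w" if "u \<noteq> 0" for u w :: real using that by simp
  from this[of "1 - p"] have 1: "ph / (1 - p) = 3 / (4 - p)" using p by (simp add: ph_def)
  have "3 * u / w / 3 = u / w" for u w :: real by simp
  from this[of "1 - p"] have 2: "ph / 3 = (1 - p) / (4 - p)" by (simp only: ph_def)
  have 3: "3 / (4 - p) + (1 - p) / (4 - p) = 1" using p by (simp add: add_divide_distrib[symmetric])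
  show "ph / (1 - p) + ph / 3 = 1" unfolding 1 2 by (rule 3)
  show "0 \<le> ph / (1 - p)" using 1 p by simp
  show "0 < ph" using p by (simp add: ph_def)
  have "ph \<le> 3 / 4"
    using p by (simp add: ph_def divide_le_eq)
  then show "ph \<le> 1" "ph + ph / 3 \<le> 1" by simp_all
qed

text \<open>Jensen's inequality through the tangent of the logarithm at \<open>m\<close>, which also
  handles that \<open>m\<close> is only an upper bound of the expectation.\<close>

lemma expectation_ln_r_cube_le: "P.expectation (\<lambda>\<omega>. ln (r (Suc T) \<omega> ^ 3)) \<le> ln m"
proof -
  have int: "integrable P (\<lambda>\<omega>. r (Suc T) \<omega> ^ 3)" by (intro bounded_rv_integrable bounded_rv_power bounded_rv_r) auto
  have "P.expectation (\<lambda>\<omega>. ln (r (Suc T) \<omega> ^ 3)) \<le> P.expectation (\<lambda>\<omega>. ln m + (r (Suc T) \<omega> ^ 3 / m - 1))"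
  proof (rule integral_mono)
    show "integrable P (\<lambda>\<omega>. ln (r (Suc T) \<omega> ^ 3))" by (intro bounded_rv_integrable bounded_rv_ln_r_cube)
    show "integrable P (\<lambda>\<omega>. ln m + (r (Suc T) \<omega> ^ 3 / m - 1))" using int by auto
    fix \<omega>
    have pos: "0 < r (Suc T) \<omega> ^ 3" using r_pos by simp
    then have "ln (r (Suc T) \<omega> ^ 3 / m) \<le> r (Suc T) \<omega> ^ 3 / m - 1"
      using m_ge_1 by (intro ln_le_minus_one) auto
    then show "ln (r (Suc T) \<omega> ^ 3) \<le> ln m + (r (Suc T) \<omega> ^ 3 / m - 1)"
      using pos m_ge_1 by (simp add: ln_div)
  qed
  also have "\<dots> = ln m + (P.expectation (\<lambda>\<omega>. r (Suc T) \<omega> ^ 3) / m - 1)"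
    using int by (simp add: P.prob_space)
  also have "\<dots> \<le> ln m + (m / m - 1)"
    using expectation_r_cube_le m_ge_1 by (intro add_left_mono diff_right_mono divide_right_mono) (auto simp: m_def)
  finally show ?thesis using m_ge_1 by simp
qed

lemma expectation_VV_le: "9 * \<eta>\<^sup>2 * \<beta> * P.expectation VV \<le> P.expectation Q / 2 + W"
proof -
  define k l where "k = 9 * \<eta>\<^sup>2 * \<beta> * y0 powr (1 - 2 * p)" and "l = \<bar>ln y0\<bar> + \<bar>ln (b0 powr (1 / p))\<bar>"
  have k: "0 \<le> k" using \<beta> by (simp add: k_def)
  note ints = bounded_rv_integrable[OF bounded_rv_Q] bounded_rv_integrable[OF bounded_rv_VV] bounded_rv_integrable[OF bounded_rv_ln_r_cube]
  have "P.expectation (\<lambda>\<omega>. 9 * \<eta>\<^sup>2 * \<beta> * VV \<omega>) \<le> P.expectation (\<lambda>\<omega>. Q \<omega> / 2 + k * (l + ln (r (Suc T) \<omega> ^ 3)))"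
  proof (rule integral_mono)
    show "9 * \<eta>\<^sup>2 * \<beta> * VV \<omega> \<le> Q \<omega> / 2 + k * (l + ln (r (Suc T) \<omega> ^ 3))" if "\<omega> \<in> space P" for \<omega>
      using VV_le_path[OF that, of "9 * \<eta>\<^sup>2"] \<eta> unfolding k_def l_def y0_def by simp
  qed (use ints in auto)
  also have "\<dots> = P.expectation Q / 2 + k * (l + P.expectation (\<lambda>\<omega>. ln (r (Suc T) \<omega> ^ 3)))"
    using ints by (simp add: P.prob_space)
  also have "\<dots> \<le> P.expectation Q / 2 + k * (l + ln m)"
    using k expectation_ln_r_cube_le by (intro add_left_mono mult_left_mono) auto
  finally show ?thesis by (simp add: W_def k_def l_def)
qed

lemma expectation_EE_bound:
  "P.expectation EE \<le> 32 * \<sigma>h\<^sup>2 + K2 * ln m + \<beta> * (P.expectation Q / 2 + W)"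
proof -
  have VV0: "0 \<le> P.expectation VV"
    unfolding VV_def[abs_def] using V_nonneg by (intro Bochner_Integration.integral_nonneg sum_nonneg)
  have "8 * \<beta>\<^sup>2 * \<eta>\<^sup>2 * P.expectation VV \<le> 9 * \<beta>\<^sup>2 * \<eta>\<^sup>2 * P.expectation VV"
    using VV0 by (intro mult_right_mono) auto
  also have "\<dots> = \<beta> * (9 * \<eta>\<^sup>2 * \<beta> * P.expectation VV)" by (simp add: power2_eq_square)
  also have "\<dots> \<le> \<beta> * (P.expectation Q / 2 + W)"
    using \<beta> expectation_VV_le by (intro mult_left_mono) auto
  finally show ?thesis
    using expectation_EE_le mult_left_mono[OF expectation_ln_r_cube_le K2_nonneg] by linarith
qed

text \<open>Inserting the bound for \<open>EE\<close> leaves \<open>35 / 4\<close> times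
  \<open>\<eta>\<^sup>2 * \<beta> * VV\<close>. By \<open>expectation_VV_le\<close> this costs at
  most half of the expectation of \<open>Q\<close> plus \<open>W\<close>; moving that half to the
  left doubles all other terms.\<close>

lemma expectation_Q_bound:
  "P.expectation Q \<le> 2 * gap + 2 * (32 * \<sigma>h\<^sup>2 + K2 * ln m) / \<beta> + 2 * W"
proof -
  note ints = bounded_rv_integrable[OF bounded_rv_Q] bounded_rv_integrable[OF bounded_rv_VV] bounded_rv_integrable[OF bounded_rv_EE]
  have "P.expectation Q \<le> P.expectation (\<lambda>\<omega>. gap + EE \<omega> / \<beta> + 3 / 4 * \<beta> * \<eta>\<^sup>2 * VV \<omega>)"
    using ints by (intro integral_mono Q_le_path) auto
  also have "\<dots> = gap + P.expectation EE / \<beta> + 3 / 4 * \<beta> * \<eta>\<^sup>2 * P.expectation VV"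
    using ints by (simp add: P.prob_space)
  also have "P.expectation EE / \<beta> \<le> (32 * \<sigma>h\<^sup>2 + 8 * \<beta>\<^sup>2 * \<eta>\<^sup>2 * P.expectation VV + K2 * ln m) / \<beta>"
    using expectation_EE_le mult_left_mono[OF expectation_ln_r_cube_le K2_nonneg] \<beta>
    by (intro divide_right_mono) linarith+
  also have "\<dots> = (32 * \<sigma>h\<^sup>2 + K2 * ln m) / \<beta> + 8 * \<beta> * \<eta>\<^sup>2 * P.expectation VV"
    using \<beta> by (simp add: field_simps power2_eq_square)
  finally have "P.expectation Q \<le> gap + (32 * \<sigma>h\<^sup>2 + K2 * ln m) / \<beta> + 35 / 4 * (\<eta>\<^sup>2 * \<beta> * P.expectation VV)"
    by (simp add: algebra_simps)
  moreover have "0 \<le> \<eta>\<^sup>2 * \<beta> * P.expectation VV"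
    unfolding VV_def[abs_def] using V_nonneg \<beta>
    by (intro mult_nonneg_nonneg Bochner_Integration.integral_nonneg sum_nonneg) auto
  ultimately show ?thesis using expectation_VV_le by (simp add: add_divide_distrib)
qed

section \<open>From \<open>Q\<close> and \<open>EE\<close> back to the gradient norms\<close>

lemma Q_ge_path:
  assumes \<omega>: "\<omega> \<in> space P"
  shows "(S T \<omega> / r T \<omega>) powr (1 - p) \<le> Q \<omega> / \<eta> + (b0 powr (1 / p)) powr (1 - p)"
proof -
  define B s R where "B = b0 powr (1 / p)" and "s = S T \<omega>" and "R = r T \<omega>"
  have B: "0 < B" using b0 by (simp add: B_def)
  have s: "0 < s" "B \<le> s" and R: "1 \<le> R"
    using S_pos S_ge r_ge_1 by (auto simp: s_def B_def R_def)
  have bT: "s powr p * R powr (1 - p) = b T \<omega>" using b_eq[OF \<omega>, of T] T by (simp add: s_def R_def)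
  \<comment> \<open>Since \<open>b\<close> is nondecreasing, all denominators in \<open>Q\<close>
    may be replaced by \<open>b T\<close>. The sum of the squared norms then appears as
    \<open>S T\<close> minus its initial value, and \<open>S T / b T\<close> is the wanted power of
    \<open>S T / r T\<close>.\<close>
  have "(s - B) / b T \<omega> = (\<Sum>t=1..T. (norm (d t \<omega>))\<^sup>2 / b T \<omega>)"
    by (simp add: s_def B_def S_def sum_divide_distrib)
  also have "\<dots> \<le> (\<Sum>t=1..T. (norm (d t \<omega>))\<^sup>2 / b t \<omega>)"
  proof (rule sum_mono)
    fix t assume t: "t \<in> {1..T}"
    have "b t \<omega> \<le> b T \<omega>"
      unfolding b_eq[OF \<omega> t] bT[symmetric] s_def R_def
      using t p S_pos[of t \<omega>] S_mono[of t T \<omega>] r_pos[of t \<omega>] r_mono[of t T \<omega>]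
      by (intro mult_mono powr_mono2) auto
    then show "(norm (d t \<omega>))\<^sup>2 / b T \<omega> \<le> (norm (d t \<omega>))\<^sup>2 / b t \<omega>"
      using b_pos[OF \<omega> t] by (intro divide_left_mono mult_pos_pos) auto
  qed
  also have "\<dots> = Q \<omega> / \<eta>"
    unfolding Q_def sum_divide_distrib using \<eta> by (intro sum.cong) auto
  finally have "s / b T \<omega> \<le> Q \<omega> / \<eta> + B / b T \<omega>" by (simp add: diff_divide_distrib)
  moreover have "s / b T \<omega> = (s / R) powr (1 - p)"
    unfolding bT[symmetric] using s R by (simp add: powr_divide powr_diff field_simps)
  moreover have "B / b T \<omega> \<le> B powr (1 - p)"
  proof -
    have "B powr p * 1 \<le> s powr p * R powr (1 - p)"
      using B s R p by (intro mult_mono powr_mono2 ge_one_powr_ge_zero) auto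
    then have "B / b T \<omega> \<le> B / B powr p"
      unfolding bT[symmetric] using B s R by (intro divide_left_mono mult_pos_pos) auto
    then show ?thesis using B by (simp add: powr_diff)
  qed
  ultimately show ?thesis unfolding s_def R_def B_def by linarith
qed

text \<open>Each of \<open>S T\<close> and the summed squared errors is written as its quotient by
  \<open>r T\<close>, controlled by \<open>Q\<close> respectively \<open>EE\<close>, times
  \<open>r T\<close>. The factor 8 is a product of three twos: \<open>sum_powr_le\<close>, the
  splitting of \<open>gradF\<close> into \<open>d\<close> and \<open>err\<close>, and
  \<open>powr_add_le\<close>.\<close>

lemma sum_gradient_powr_path:
  assumes \<omega>: "\<omega> \<in> space P"
  shows "(\<Sum>t=1..T. norm (gradF (x t \<omega>)) powr (2 * ph))
    \<le> 8 * real T powr (1 - ph) *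
      ((Q \<omega> / \<eta> + (b0 powr (1 / p)) powr (1 - p)) powr (ph / (1 - p)) * (r (Suc T) \<omega> ^ 3) powr (ph / 3)
       + EE \<omega> powr ph * (r (Suc T) \<omega> ^ 3) powr (ph / 3))"
proof -
  define R N where "R = r T \<omega>" and "N = (\<Sum>t=1..T. (norm (err t \<omega>))\<^sup>2)"
  have R: "1 \<le> R" and N: "0 \<le> N" using r_ge_1 by (auto simp: R_def N_def sum_nonneg)
  have S: "0 < S T \<omega>" by (rule S_pos)
  have Rph: "R powr ph \<le> (r (Suc T) \<omega> ^ 3) powr (ph / 3)"
  proof -
    have "R powr ph \<le> r (Suc T) \<omega> powr ph"
      using R r_mono[of T "Suc T" \<omega>] T ph_bounds by (intro powr_mono2) (auto simp: R_def)
    also have "\<dots> = (r (Suc T) \<omega> powr 3) powr (ph / 3)" by (simp add: powr_powr)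
    finally show ?thesis using r_pos[of "Suc T" \<omega>] by (simp add: powr_numeral)
  qed
  have "(\<Sum>t=1..T. norm (gradF (x t \<omega>)) powr (2 * ph)) = (\<Sum>t=1..T. ((norm (gradF (x t \<omega>)))\<^sup>2) powr ph)"
  proof (rule sum.cong)
    show "norm (gradF (x t \<omega>)) powr (2 * ph) = ((norm (gradF (x t \<omega>)))\<^sup>2) powr ph" for t
      by (cases "gradF (x t \<omega>) = 0") (auto simp: powr_powr[symmetric] powr_numeral)
  qed simp
  also have "\<dots> \<le> 2 * real T powr (1 - ph) * (\<Sum>t=1..T. (norm (gradF (x t \<omega>)))\<^sup>2) powr ph"
    using T ph_bounds by (intro sum_powr_le) auto
  finally have sum_le: "(\<Sum>t=1..T. norm (gradF (x t \<omega>)) powr (2 * ph))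
      \<le> 2 * real T powr (1 - ph) * (\<Sum>t=1..T. (norm (gradF (x t \<omega>)))\<^sup>2) powr ph" .
  have "(\<Sum>t=1..T. (norm (gradF (x t \<omega>)))\<^sup>2) powr ph \<le> (2 * S T \<omega> + 2 * N) powr ph"
  proof (rule powr_mono2)
    have "(\<Sum>t=1..T. (norm (gradF (x t \<omega>)))\<^sup>2) \<le> (\<Sum>t=1..T. 2 * (norm (d t \<omega>))\<^sup>2 + 2 * (norm (err t \<omega>))\<^sup>2)"
    proof (rule sum_mono)
      show "(norm (gradF (x t \<omega>)))\<^sup>2 \<le> 2 * (norm (d t \<omega>))\<^sup>2 + 2 * (norm (err t \<omega>))\<^sup>2" for t
        using norm_sq_add_le[of "d t \<omega>" "- err t \<omega>"] by (simp add: err_def norm_minus_commute)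
    qed
    also have "\<dots> = 2 * (\<Sum>t=1..T. (norm (d t \<omega>))\<^sup>2) + 2 * N"
      by (simp add: N_def sum.distrib sum_distrib_left)
    also have "(\<Sum>t=1..T. (norm (d t \<omega>))\<^sup>2) \<le> S T \<omega>" by (simp add: S_def)
    finally show "(\<Sum>t=1..T. (norm (gradF (x t \<omega>)))\<^sup>2) \<le> 2 * S T \<omega> + 2 * N" by simp
  qed (use ph_bounds in \<open>auto simp: sum_nonneg\<close>)
  also have "(2 * S T \<omega> + 2 * N) powr ph = 2 powr ph * (S T \<omega> + N) powr ph"
    using S N by (simp add: powr_mult[symmetric] distrib_left)
  also have "\<dots> \<le> 2 powr 1 * (2 * (S T \<omega> powr ph + N powr ph))"
    using S N ph_bounds by (intro mult_mono powr_mono powr_add_le) auto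
  finally have split: "(\<Sum>t=1..T. (norm (gradF (x t \<omega>)))\<^sup>2) powr ph \<le> 4 * (S T \<omega> powr ph + N powr ph)"
    by simp
  have "S T \<omega> powr ph = ((S T \<omega> / R) powr (1 - p)) powr (ph / (1 - p)) * R powr ph"
    using S R p by (simp add: powr_powr powr_mult[symmetric])
  also have "\<dots> \<le> (Q \<omega> / \<eta> + (b0 powr (1 / p)) powr (1 - p)) powr (ph / (1 - p)) * (r (Suc T) \<omega> ^ 3) powr (ph / 3)"
    (is "_ \<le> ?X") using Q_ge_path[OF \<omega>] Rph ph_bounds unfolding R_def by (intro mult_mono powr_mono2) auto
  finally have X: "S T \<omega> powr ph \<le> ?X" .
  have "N powr ph = (N / R) powr ph * R powr ph"
    using N R by (simp add: powr_mult[symmetric])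
  also have "\<dots> \<le> EE \<omega> powr ph * (r (Suc T) \<omega> ^ 3) powr (ph / 3)" (is "_ \<le> ?Y")
  proof (intro mult_mono powr_mono2 Rph)
    show "N / R \<le> EE \<omega>"
      unfolding N_def EE_def sum_divide_distrib R_def
      using r_mono[of _ T \<omega>] r_pos by (intro sum_mono divide_left_mono mult_pos_pos) auto
  qed (use N R ph_bounds in auto)
  finally have Y: "N powr ph \<le> ?Y" .
  have "(\<Sum>t=1..T. (norm (gradF (x t \<omega>)))\<^sup>2) powr ph \<le> 4 * (?X + ?Y)"
    by (rule order_trans[OF split]) (intro mult_left_mono add_mono X Y, simp)
  then have "2 * real T powr (1 - ph) * (\<Sum>t=1..T. (norm (gradF (x t \<omega>)))\<^sup>2) powr ph
      \<le> 2 * real T powr (1 - ph) * (4 * (?X + ?Y))"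
    by (intro mult_left_mono) auto
  note le = order_trans[OF sum_le this]
  have "2 * k * (4 * z) = 8 * k * z" for k z :: real by simp
  from le[unfolded this] show ?thesis .
qed

lemma bounded_rv_gradient_powr: assumes t: "t \<in> {1..T}" shows "bounded_rv (\<lambda>\<omega>. norm (gradF (x t \<omega>)) powr (2 * ph))"
proof -
  have "bounded_rv (\<lambda>\<omega>. norm (gradF (x t \<omega>)))" using t bounded_rv_norm_d[of t] by auto
  then obtain K where "AE \<omega> in P. \<bar>norm (gradF (x t \<omega>))\<bar> \<le> K" unfolding bounded_rv_def by auto
  then have K: "AE \<omega> in P. \<bar>norm (gradF (x t \<omega>)) powr (2 * ph)\<bar> \<le> K powr (2 * ph)"
  proof eventually_elim
    case (elim \<omega>)
    then show ?case using ph_bounds by (auto intro!: powr_mono2)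
  qed
  have [measurable]: "x t \<in> borel_measurable P" using t by (intro P_measurable) auto
  show ?thesis by (rule bounded_rvI[OF _ K]) measurable
qed

text \<open>\<open>A\<close> and \<open>A'\<close> are positive upper bounds because they serve as
  normalising denominators. The constant is \<open>24 = 8 * 3\<close>, and
  \<open>T powr (1 - ph)\<close> over \<open>T\<close> leaves \<open>T powr (- ph)\<close>.\<close>

lemma mean_gradient_powr_le:
  assumes A: "0 < A" "P.expectation Q / \<eta> + (b0 powr (1 / p)) powr (1 - p) \<le> A"
    and A': "0 < A'" "P.expectation EE \<le> A'"
  shows "(\<Sum>t=1..T. P.expectation (\<lambda>\<omega>. norm (gradF (x t \<omega>)) powr (2 * ph))) / real T
    \<le> 24 * (real T powr (- ph) * m powr (ph / 3)) * (A powr (ph / (1 - p)) + A' powr ph)"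
proof -
  let ?B = "(b0 powr (1 / p)) powr (1 - p)"
  define X where "X \<omega> = Q \<omega> / \<eta> + ?B" for \<omega>
  define Y where "Y \<omega> = r (Suc T) \<omega> ^ 3" for \<omega>
  have X: "integrable P X" "P.expectation X \<le> A" "\<And>\<omega>. \<omega> \<in> space P \<Longrightarrow> 0 \<le> X \<omega>"
    unfolding X_def[abs_def] using bounded_rv_integrable[OF bounded_rv_Q] A
    by (auto simp: P.prob_space intro: order_trans[OF _ Q_ge_path])
  have Y: "integrable P Y" "P.expectation Y \<le> m" "\<And>\<omega>. \<omega> \<in> space P \<Longrightarrow> 0 \<le> Y \<omega>"
    unfolding Y_def[abs_def] using expectation_r_cube_le r_pos
    by (auto simp: m_def less_imp_le intro!: bounded_rv_integrable bounded_rv_power bounded_rv_r)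
  have E: "integrable P EE" "\<And>\<omega>. \<omega> \<in> space P \<Longrightarrow> 0 \<le> EE \<omega>"
    using bounded_rv_integrable[OF bounded_rv_EE] r_pos by (auto simp: EE_def less_imp_le intro!: sum_nonneg)
  have m: "0 < m" using m_ge_1 by simp
  have ph: "0 \<le> ph / 3" "0 \<le> ph" "ph / (1 - p) + ph / 3 \<le> 1" using ph_bounds by auto
  note XY = P.expectation_powr_mult_powr_le[OF X(1,3,2) A(1) Y(1,3,2) m ph_bounds(5) ph(1,3)]
  note EY = P.expectation_powr_mult_powr_le[OF E A'(2,1) Y(1,3,2) m ph(2,1) ph_bounds(3)]
  have "(\<Sum>t=1..T. P.expectation (\<lambda>\<omega>. norm (gradF (x t \<omega>)) powr (2 * ph)))
      = P.expectation (\<lambda>\<omega>. \<Sum>t=1..T. norm (gradF (x t \<omega>)) powr (2 * ph))"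
    by (rule Bochner_Integration.integral_sum[symmetric]) (intro bounded_rv_integrable bounded_rv_gradient_powr)
  also have "\<dots> \<le> P.expectation (\<lambda>\<omega>. 8 * real T powr (1 - ph) *
      (X \<omega> powr (ph / (1 - p)) * Y \<omega> powr (ph / 3) + EE \<omega> powr ph * Y \<omega> powr (ph / 3)))"
  proof (rule integral_mono)
    show "integrable P (\<lambda>\<omega>. \<Sum>t=1..T. norm (gradF (x t \<omega>)) powr (2 * ph))"
      by (intro bounded_rv_integrable bounded_rv_sum bounded_rv_gradient_powr)
  qed (use XY(1) EY(1) sum_gradient_powr_path in \<open>auto simp: X_def Y_def\<close>)
  also have "\<dots> = 8 * real T powr (1 - ph) * (P.expectation (\<lambda>\<omega>. X \<omega> powr (ph / (1 - p)) * Y \<omega> powr (ph / 3))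
      + P.expectation (\<lambda>\<omega>. EE \<omega> powr ph * Y \<omega> powr (ph / 3)))"
    using XY(1) EY(1) by simp
  also have "\<dots> \<le> 8 * real T powr (1 - ph) * (3 * (A powr (ph / (1 - p)) * m powr (ph / 3))
      + 3 * (A' powr ph * m powr (ph / 3)))"
    using XY(2) EY(2) by (intro mult_left_mono add_mono) auto
  also have "\<dots> = 24 * (real T powr (1 - ph) * m powr (ph / 3)) * (A powr (ph / (1 - p)) + A' powr ph)"
    by (simp add: algebra_simps)
  finally have "(\<Sum>t=1..T. P.expectation (\<lambda>\<omega>. norm (gradF (x t \<omega>)) powr (2 * ph))) / real T
      \<le> 24 * (real T powr (1 - ph) * m powr (ph / 3)) * (A powr (ph / (1 - p)) + A' powr ph) / real T"
    by (intro divide_right_mono) auto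
  also have "\<dots> = 24 * (real T powr (1 - ph) / real T * m powr (ph / 3)) * (A powr (ph / (1 - p)) + A' powr ph)"
    by simp
  also have "real T powr (1 - ph) / real T = real T powr (- ph)"
    using T by (simp add: powr_diff powr_minus divide_inverse)
  finally show ?thesis .
qed

text \<open>Every \<open>x t\<close> is measurable with respect to the whole sample sequence, hence
  independent of \<open>\<tau>\<close>. Splitting by the value of \<open>\<tau>\<close> reduces the
  random index to finitely many fixed ones, each of mass \<open>1 / T\<close>.\<close>

lemma nn_integral_output:
  assumes out: "uniform_output_index P D \<xi> T \<tau>"
  shows "(\<integral>\<^sup>+\<omega>. ennreal (norm (gradF (x (\<tau> \<omega>) \<omega>)) powr (2 * ph)) \<partial>P)
    = ennreal ((\<Sum>t=1..T. P.expectation (\<lambda>\<omega>. norm (gradF (x t \<omega>)) powr (2 * ph))) / real T)"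
proof -
  define \<phi> where "\<phi> u = norm (gradF u) powr (2 * ph)" for u
  have \<phi>: "\<phi> \<in> borel_measurable borel" unfolding \<phi>_def by measurable
  have \<tau>: "\<tau> \<in> measurable P (count_space UNIV)"
    and distr: "distr P (count_space UNIV) \<tau> = measure_pmf (pmf_of_set {1..T})"
    and ind: "P.indep_set {(\<lambda>\<omega>. \<lambda>i\<in>{1..}. \<xi> i \<omega>) -` A \<inter> space P | A. A \<in> sets (Pi\<^sub>M {1..} (\<lambda>_. D))}
       {\<tau> -` B \<inter> space P | B. B \<in> sets (count_space UNIV)}"
    using out by (auto simp: uniform_output_index_def)
  have mass: "measure (measure_pmf (pmf_of_set {1..T})) {t} = 1 / real T" if "t \<in> {1..T}" for t
    using that T by (simp add: measure_pmf_single pmf_of_set)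
  have t_part: "integrable P (\<lambda>\<omega>. \<phi> (x t \<omega>) * indicator {t} (\<tau> \<omega>))"
    "P.expectation (\<lambda>\<omega>. \<phi> (x t \<omega>) * indicator {t} (\<tau> \<omega>)) = P.expectation (\<lambda>\<omega>. \<phi> (x t \<omega>)) / real T"
    if t: "t \<in> {1..T}" for t
  proof -
    have xt: "x t \<in> borel_measurable (history {1..})" and xP: "x t \<in> borel_measurable P"
      using t by (auto intro!: x_history' P_measurable)
    note [measurable] = xP \<phi> \<tau>
    have eq: "distr P borel (x t) \<Otimes>\<^sub>M distr P (count_space UNIV) \<tau>
        = distr P (borel \<Otimes>\<^sub>M count_space UNIV) (\<lambda>\<omega>. (x t \<omega>, \<tau> \<omega>))"
    proof (rule P.distr_pair_of_product_rule[OF xP \<tau>])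
      fix A :: "'a set" and B :: "nat set" assume A: "A \<in> sets borel"
      have "x t -` A \<inter> space P \<in> sets (history {1..})"
        using measurable_sets[OF xt A] by simp
      then have "x t -` A \<inter> space P \<in> {(\<lambda>\<omega>. \<lambda>i\<in>{1..}. \<xi> i \<omega>) -` A \<inter> space P | A. A \<in> sets (Pi\<^sub>M {1..} (\<lambda>_. D))}"
        unfolding history_def by (subst (asm) sets_vimage_algebra2) (auto simp: space_PiM space_D)
      then show "P.prob ((x t -` A \<inter> space P) \<inter> (\<tau> -` B \<inter> space P))
          = P.prob (x t -` A \<inter> space P) * P.prob (\<tau> -` B \<inter> space P)"
        by (rule P.indep_setD[OF ind]) auto
    qed
    have bounded_rv: "bounded_rv (\<lambda>\<omega>. \<phi> (x t \<omega>))" unfolding \<phi>_def by (rule bounded_rv_gradient_powr[OF t])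
    show int: "integrable P (\<lambda>\<omega>. \<phi> (x t \<omega>) * indicator {t} (\<tau> \<omega>))"
    proof (rule Bochner_Integration.integrable_bound[OF bounded_rv_integrable[OF bounded_rv]])
      show "AE \<omega> in P. norm (\<phi> (x t \<omega>) * indicator {t} (\<tau> \<omega>)) \<le> norm (\<phi> (x t \<omega>))"
        by (auto simp: indicator_def)
      have "(\<lambda>\<omega>. indicator {t} (\<tau> \<omega>) :: real) \<in> borel_measurable P"
        by (rule measurable_compose[OF \<tau>]) simp
      then show "(\<lambda>\<omega>. \<phi> (x t \<omega>) * indicator {t} (\<tau> \<omega>)) \<in> borel_measurable P"
        using bounded_rv by (intro borel_measurable_times) (auto simp: bounded_rv_def)
    qed
    have h: "(\<lambda>z. \<phi> (fst z) * indicator {t} (snd z)) \<in> borel_measurable (borel \<Otimes>\<^sub>M count_space UNIV)"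
      by (intro borel_measurable_times measurable_compose[OF measurable_fst \<phi>] measurable_compose[OF measurable_snd]) simp
    have "P.expectation (\<lambda>\<omega>. \<phi> (x t \<omega>) * indicator {t} (\<tau> \<omega>))
        = P.expectation (\<lambda>\<omega>. \<integral>k. \<phi> (x t \<omega>) * indicator {t} k \<partial>measure_pmf (pmf_of_set {1..T}))"
      using P.expectation_distr_pair(2)[OF xP \<tau> eq h] int unfolding distr by simp
    also have "\<dots> = P.expectation (\<lambda>\<omega>. \<phi> (x t \<omega>) * (1 / real T))"
      using mass[OF t] by simp
    finally show "P.expectation (\<lambda>\<omega>. \<phi> (x t \<omega>) * indicator {t} (\<tau> \<omega>)) = P.expectation (\<lambda>\<omega>. \<phi> (x t \<omega>)) / real T"
      by simp
  qed
  have "AE k in distr P (count_space UNIV) \<tau>. k \<in> {1..T}"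
    unfolding distr using T by (simp add: AE_measure_pmf_iff set_pmf_of_set)
  then have "AE \<omega> in P. \<tau> \<omega> \<in> {1..T}"
    using \<tau> by (subst (asm) AE_distr_iff) auto
  then have "(\<integral>\<^sup>+\<omega>. ennreal (\<phi> (x (\<tau> \<omega>) \<omega>)) \<partial>P) = (\<integral>\<^sup>+\<omega>. ennreal (\<Sum>t=1..T. \<phi> (x t \<omega>) * indicator {t} (\<tau> \<omega>)) \<partial>P)"
  proof (intro nn_integral_cong_AE, eventually_elim)
    case (elim \<omega>)
    have "(\<Sum>t=1..T. \<phi> (x t \<omega>) * indicator {t} (\<tau> \<omega>)) = (\<Sum>t=1..T. if \<tau> \<omega> = t then \<phi> (x t \<omega>) else 0)"
      by (intro sum.cong) auto
    also have "\<dots> = \<phi> (x (\<tau> \<omega>) \<omega>)" using elim by simp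
    finally show ?case by simp
  qed
  also have "\<dots> = ennreal (P.expectation (\<lambda>\<omega>. \<Sum>t=1..T. \<phi> (x t \<omega>) * indicator {t} (\<tau> \<omega>)))"
  proof (rule nn_integral_eq_integral)
    show "integrable P (\<lambda>\<omega>. \<Sum>t=1..T. \<phi> (x t \<omega>) * indicator {t} (\<tau> \<omega>))"
      by (intro Bochner_Integration.integrable_sum t_part)
  qed (auto simp: \<phi>_def intro!: AE_I2 sum_nonneg)
  also have "P.expectation (\<lambda>\<omega>. \<Sum>t=1..T. \<phi> (x t \<omega>) * indicator {t} (\<tau> \<omega>))
      = (\<Sum>t=1..T. P.expectation (\<lambda>\<omega>. \<phi> (x t \<omega>)) / real T)"
    using t_part by (subst Bochner_Integration.integral_sum) auto
  finally show ?thesis by (simp add: \<phi>_def sum_divide_distrib)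
qed

end

section \<open>The convergence rate\<close>

lemma powr_add3_le:
  fixes x y z s :: real
  assumes "0 \<le> x" "0 \<le> y" "0 \<le> z" "0 \<le> s" "s \<le> 1"
  shows "(x + y + z) powr s \<le> 4 * (x powr s + y powr s + z powr s)"
proof -
  have "(x + y + z) powr s \<le> 2 * ((x + y) powr s + z powr s)"
    using assms by (intro powr_add_le) auto
  also have "\<dots> \<le> 2 * (2 * (x powr s + y powr s) + z powr s)"
    using assms powr_add_le[of x y s] by simp
  also have "\<dots> \<le> 4 * (x powr s + y powr s + z powr s)" by simp
  finally show ?thesis .
qed

text \<open>With \<open>k = 4 / a0\<^sup>2\<close> and \<open>e = ph\<close> the left side is the
  horizon factor in \<open>m\<close>. The summands 1 and \<open>\<sigma>\<^sup>2 * T\<close> give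
  the noiseless and the noisy part of the rate.\<close>

lemma horizon_factor_le:
  fixes k \<sigma> e :: real and T :: nat
  assumes k: "0 \<le> k" and \<sigma>: "0 \<le> \<sigma>" and e: "0 \<le> e" "e \<le> 1" and T: "1 \<le> T"
  shows "real T powr (- e) * (1 + k * \<sigma>\<^sup>2 * real T) powr (e / 3)
    \<le> 2 * (1 + k) * (1 / real T powr e + \<sigma> powr (2 * e / 3) / real T powr (2 * e / 3))"
proof -
  have "(1 + k * \<sigma>\<^sup>2 * real T) powr (e / 3) \<le> ((1 + k) * (1 + \<sigma>\<^sup>2 * real T)) powr (e / 3)"
    using k e by (intro powr_mono2) (auto simp: algebra_simps)
  also have "\<dots> = (1 + k) powr (e / 3) * (1 + \<sigma>\<^sup>2 * real T) powr (e / 3)"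
    using k by (simp add: powr_mult)
  also have "\<dots> \<le> (1 + k) powr 1 * (2 * (1 powr (e / 3) + (\<sigma>\<^sup>2 * real T) powr (e / 3)))"
    using k e by (intro mult_mono powr_mono powr_add_le) auto
  also have "(\<sigma>\<^sup>2 * real T) powr (e / 3) = \<sigma> powr (2 * e / 3) * real T powr (e / 3)"
  proof (cases "\<sigma> = 0")
    case False
    then have "\<sigma>\<^sup>2 = \<sigma> powr 2" using \<sigma> by (simp add: powr_numeral)
    then show ?thesis by (simp add: powr_mult powr_powr)
  qed simp
  finally have "(1 + k * \<sigma>\<^sup>2 * real T) powr (e / 3) \<le> 2 * (1 + k) * (1 + \<sigma> powr (2 * e / 3) * real T powr (e / 3))"
    using k by (simp add: algebra_simps)
  then have "real T powr (- e) * (1 + k * \<sigma>\<^sup>2 * real T) powr (e / 3)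
      \<le> real T powr (- e) * (2 * (1 + k) * (1 + \<sigma> powr (2 * e / 3) * real T powr (e / 3)))"
    by (intro mult_left_mono) auto
  also have "\<dots> = 2 * (1 + k) * (real T powr (- e) + \<sigma> powr (2 * e / 3) * (real T powr (- e) * real T powr (e / 3)))"
    by (simp add: algebra_simps)
  also have "real T powr (- e) * real T powr (e / 3) = real T powr (- (2 * e / 3))"
    by (simp flip: powr_add)
  finally show ?thesis by (simp add: powr_minus_divide)
qed

text \<open>A statement about real numbers only, so that \<open>C\<close> is obtained before
  problem, horizon and run; the probabilistic estimates enter as premises. It is applied with
  \<open>s0 = 32 * \<sigma>h\<^sup>2\<close> and \<open>K\<close> equal to
  \<open>K2\<close>.\<close>

lemma rate_constant_exists:
  fixes p ph a0 b0 \<eta> \<beta>0 s0 K :: real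
  assumes p: "0 < p" "p \<le> 1 / 2" and a0: "0 < a0" and b0: "0 < b0" and \<eta>: "0 < \<eta>" and \<beta>0: "1 < \<beta>0"
    and s0: "0 \<le> s0" and K: "0 \<le> K" and ph: "ph = 3 * (1 - p) / (4 - p)"
  obtains C :: real where "0 < C"
    and "\<And>\<beta> \<sigma> gap (T::nat) EQ EE \<Phi> m y0 W.
    \<beta>0 \<le> \<beta> \<Longrightarrow> 0 \<le> \<sigma> \<Longrightarrow> 0 \<le> gap \<Longrightarrow> 1 \<le> T \<Longrightarrow>
    m = 1 + 4 * \<sigma>\<^sup>2 / a0\<^sup>2 * real T \<Longrightarrow>
    y0 = (2 * (9 * \<eta>\<^sup>2) * \<beta> / \<eta>) powr (1 / p) \<Longrightarrow>
    W = 9 * \<eta>\<^sup>2 * \<beta> * y0 powr (1 - 2 * p) * (\<bar>ln y0\<bar> + \<bar>ln (b0 powr (1 / p))\<bar> + ln m) \<Longrightarrow>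
    EQ \<le> 2 * gap + 2 * (s0 + K * ln m) / \<beta> + 2 * W \<Longrightarrow>
    EE \<le> s0 + K * ln m + \<beta> * (EQ / 2 + W) \<Longrightarrow>
    (\<And>A A'. 0 < A \<Longrightarrow> EQ / \<eta> + (b0 powr (1 / p)) powr (1 - p) \<le> A \<Longrightarrow> 0 < A' \<Longrightarrow> EE \<le> A' \<Longrightarrow>
      \<Phi> \<le> 24 * (real T powr (- ph) * m powr (ph / 3)) * (A powr (ph / (1 - p)) + A' powr ph)) \<Longrightarrow>
    \<Phi> \<le> C * (gap powr (ph / (1 - p)) + \<beta> powr (ph / p) * (ln \<beta>) powr (ph / (1 - p))
             + \<beta> powr (ph / p) * (ln (1 + \<sigma>\<^sup>2 * real T)) powr (ph / (1 - p)))
            * (1 / real T powr ph + \<sigma> powr (2 * ph / 3) / real T powr (2 * ph / 3))"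
proof -
  define B where "B = b0 powr (1 / p)"
  define l0 where "l0 = ln \<beta>0"
  define k where "k = 4 / a0\<^sup>2"
  define k2 where "k2 = 9 * \<eta>\<^sup>2 * (18 * \<eta>) powr ((1 - 2 * p) / p)"
  define k3 where "k3 = \<bar>ln (18 * \<eta>)\<bar> / p + \<bar>ln B\<bar> + ln (1 + k)"
  define k4 where "k4 = k3 / l0 + 1 / p + 1"
  define k5 where "k5 = s0 / l0 + K * (ln (1 + k) / l0 + 1)"
  define k6 where "k6 = 2 + 2 * k5 + 2 * k2 * k4"
  define k7 where "k7 = k6 / \<eta> + B powr (1 - p) / l0"
  define k8 where "k8 = k5 + k6 / 2 + k2 * k4"
  define s where "s = ph / (1 - p)"
  define k9 where "k9 = k7 powr s + (k8 * (1 / l0) powr (p / (1 - p))) powr ph"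
  have l0: "0 < l0" using \<beta>0 by (simp add: l0_def)
  have B: "0 < B" using b0 by (simp add: B_def)
  have k: "0 < k" using a0 by (simp add: k_def)
  have lk: "0 < ln (1 + k)" using k by simp
  have k2: "0 < k2" using \<eta> by (simp add: k2_def)
  have k3: "0 < k3" unfolding k3_def using p lk by (intro add_nonneg_pos) auto
  have k4: "0 < k4" unfolding k4_def using p k3 l0 by (simp add: add_pos_pos)
  have k5: "0 \<le> k5" unfolding k5_def using s0 K lk l0 by simp
  have k6: "0 < k6" unfolding k6_def using k5 k2 k4 by (simp add: add_pos_nonneg)
  have k7: "0 < k7" unfolding k7_def using k6 \<eta> B l0 by (simp add: add_pos_pos)
  have k8: "0 < k8" unfolding k8_def using k5 k6 k2 k4 by (simp add: add_nonneg_pos add_pos_pos)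
  have "3 * u / w / u = 3 / w" if "u \<noteq> 0" for u w :: real using that by simp
  from this[of "1 - p"] have s_eq: "s = 3 / (4 - p)" using p by (simp add: s_def ph)
  have s: "0 < s" "s \<le> 1" using p by (auto simp: s_eq field_simps)
  have ph01: "0 < ph" "ph \<le> 1" using p by (auto simp: ph field_simps)
  have k9: "0 < k9" unfolding k9_def using k7 by (intro add_pos_nonneg) auto
  show ?thesis
  proof (rule that[of "24 * (2 * (1 + k)) * (k9 * 4)"])
    show "0 < 24 * (2 * (1 + k)) * (k9 * 4)" using k k9 by simp
    fix \<beta> \<sigma> gap :: real and T :: nat and EQ EE \<Phi> m y0 W :: real
    assume \<beta>: "\<beta>0 \<le> \<beta>" and \<sigma>: "0 \<le> \<sigma>" and gap: "0 \<le> gap" and T: "1 \<le> T"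
      and m: "m = 1 + 4 * \<sigma>\<^sup>2 / a0\<^sup>2 * real T"
      and y0: "y0 = (2 * (9 * \<eta>\<^sup>2) * \<beta> / \<eta>) powr (1 / p)"
      and W: "W = 9 * \<eta>\<^sup>2 * \<beta> * y0 powr (1 - 2 * p) * (\<bar>ln y0\<bar> + \<bar>ln (b0 powr (1 / p))\<bar> + ln m)"
      and EQ: "EQ \<le> 2 * gap + 2 * (s0 + K * ln m) / \<beta> + 2 * W"
      and EE: "EE \<le> s0 + K * ln m + \<beta> * (EQ / 2 + W)"
      and \<Phi>: "\<And>A A'. 0 < A \<Longrightarrow> EQ / \<eta> + (b0 powr (1 / p)) powr (1 - p) \<le> A \<Longrightarrow> 0 < A' \<Longrightarrow> EE \<le> A' \<Longrightarrow>
      \<Phi> \<le> 24 * (real T powr (- ph) * m powr (ph / 3)) * (A powr (ph / (1 - p)) + A' powr ph)"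
    define l where "l = ln \<beta>"
    define lam where "lam = ln (1 + \<sigma>\<^sup>2 * real T)"
    define b where "b = \<beta> powr (1 / p - 1)"
    \<comment> \<open>The common scale: up to constants \<open>EQ\<close> is at most
      \<open>R\<close> and \<open>EE\<close> at most \<open>\<beta> * R\<close>. The factor
      \<open>b\<close> is the power of \<open>\<beta>\<close> in \<open>W\<close>, and
      \<open>b powr (ph / (1 - p)) = \<beta> powr (ph / p)\<close> explains the exponent in the
      rate.\<close>
    define R where "R = gap + b * (l + lam)"
    have \<beta>1: "1 < \<beta>" using \<beta> \<beta>0 by simp
    have l: "l0 \<le> l" using \<beta> \<beta>0 by (simp add: l_def l0_def)
    have lam: "0 \<le> lam" by (simp add: lam_def)
    have b: "1 \<le> b" unfolding b_def using \<beta>1 p by (intro ge_one_powr_ge_zero) auto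
    have bl: "l + lam \<le> b * (l + lam)" using b l l0 lam mult_right_mono[of 1 b "l + lam"] by simp
    have m_eq: "m = 1 + k * \<sigma>\<^sup>2 * real T" by (simp add: m k_def)
    have ln_m: "ln m \<le> ln (1 + k) + lam"
    proof -
      have z: "0 \<le> \<sigma>\<^sup>2 * real T" by simp
      have "ln m \<le> ln ((1 + k) * (1 + \<sigma>\<^sup>2 * real T))"
        unfolding m_eq using k z by (intro ln_mono) (auto simp: algebra_simps add_pos_nonneg)
      also have "\<dots> = ln (1 + k) + lam"
        using k z unfolding lam_def by (intro ln_mult_pos) (auto simp: add_pos_nonneg)
      finally show ?thesis .
    qed
    \<comment> \<open>This is where \<open>\<beta>0 > 1\<close> acts: \<open>l \<ge> l0 > 0\<close>
      turns every additive constant into a multiple of \<open>l + lam\<close>.\<close>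
    have const: "x \<le> x / l0 * (l + lam)" if "0 \<le> x" for x
    proof -
      have "x / l0 * l0 \<le> x / l0 * (l + lam)" using that l l0 lam by (intro mult_left_mono) auto
      then show ?thesis using l0 by simp
    qed
    have noise: "s0 + K * ln m \<le> k5 * (l + lam)"
    proof -
      have "s0 + K * ln m \<le> s0 / l0 * (l + lam) + K * (ln (1 + k) / l0 * (l + lam) + (l + lam))"
        using const[OF s0] const[OF less_imp_le[OF lk]] ln_m K l l0
        by (intro add_mono mult_left_mono) auto
      then show ?thesis by (simp add: k5_def algebra_simps)
    qed
    have W_le: "W \<le> k2 * k4 * (b * (l + lam))"
    proof -
      have y0': "y0 = (18 * \<eta> * \<beta>) powr (1 / p)"
        using \<eta> by (simp add: y0 power2_eq_square mult.assoc)
      have "y0 powr (1 - 2 * p) = (18 * \<eta>) powr ((1 - 2 * p) / p) * \<beta> powr ((1 - 2 * p) / p)"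
        using \<eta> \<beta>1 by (simp add: y0' powr_powr powr_mult)
      moreover have "\<beta> * \<beta> powr ((1 - 2 * p) / p) = b"
      proof -
        have "\<beta> powr 1 * \<beta> powr ((1 - 2 * p) / p) = \<beta> powr (1 + (1 - 2 * p) / p)"
          by (rule powr_add[symmetric])
        also have "1 + (1 - 2 * p) / p = 1 / p - 1" using p by (simp add: field_simps)
        finally show ?thesis using \<beta>1 by (simp add: b_def)
      qed
      ultimately have coef: "9 * \<eta>\<^sup>2 * \<beta> * y0 powr (1 - 2 * p) = k2 * b"
        by (simp add: k2_def ac_simps)
      have "ln y0 = (ln (18 * \<eta>) + l) / p"
        using \<eta> \<beta>1 by (simp add: y0' l_def ln_powr ln_mult_pos)
      then have "\<bar>ln y0\<bar> \<le> (\<bar>ln (18 * \<eta>)\<bar> + l) / p"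
        using p l l0 by (simp add: abs_divide divide_right_mono)
      then have "\<bar>ln y0\<bar> + \<bar>ln B\<bar> + ln m \<le> k3 + (1 / p) * l + lam"
        using ln_m by (simp add: k3_def add_divide_distrib)
      also have "\<dots> \<le> k3 / l0 * (l + lam) + (1 / p) * (l + lam) + (l + lam)"
        using const[of k3] k3 p l l0 lam by (intro add_mono mult_left_mono) auto
      also have "\<dots> = k4 * (l + lam)" by (simp add: k4_def algebra_simps)
      finally have "k2 * b * (\<bar>ln y0\<bar> + \<bar>ln B\<bar> + ln m) \<le> k2 * b * (k4 * (l + lam))"
        using k2 b by (intro mult_left_mono) auto
      then show ?thesis unfolding W coef B_def[symmetric] by (simp add: ac_simps)
    qed
    have bR: "b * (l + lam) \<le> R" using gap by (simp add: R_def)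
    have WR: "W \<le> k2 * k4 * R"
      using k2 k4 bR by (intro order_trans[OF W_le] mult_left_mono) auto
    have lR: "l + lam \<le> R" using bl bR by simp
    have R: "l0 \<le> R" "0 < R" using lR l l0 lam by auto
    have EQ_le: "EQ \<le> k6 * R"
    proof -
      have ml: "0 \<le> s0 + K * ln m" 
        using s0 K m_eq k by (intro add_nonneg_nonneg mult_nonneg_nonneg ln_ge_zero) auto
      have "2 * (s0 + K * ln m) / \<beta> \<le> 2 * (s0 + K * ln m) / 1"
        using ml \<beta>1 by (intro divide_left_mono) auto
      also have "\<dots> \<le> 2 * (k5 * R)"
        using noise mult_left_mono[OF lR k5] by simp
      finally have "2 * (s0 + K * ln m) / \<beta> \<le> 2 * (k5 * R)" .
      moreover note WR
      moreover have "gap \<le> R"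
        unfolding R_def using b l l0 lam by simp
      ultimately have "EQ \<le> 2 * R + 2 * (k5 * R) + 2 * (k2 * k4 * R)" using EQ by linarith
      then show ?thesis by (simp add: k6_def algebra_simps)
    qed
    have A: "EQ / \<eta> + (b0 powr (1 / p)) powr (1 - p) \<le> k7 * R"
    proof -
      have "EQ / \<eta> \<le> k6 * R / \<eta>" using EQ_le \<eta> by (intro divide_right_mono) auto
      moreover have "B powr (1 - p) / l0 * l0 \<le> B powr (1 - p) / l0 * R"
        using R l0 by (intro mult_left_mono) auto
      ultimately show ?thesis using l0 unfolding B_def[symmetric] k7_def by (simp add: algebra_simps)
    qed
    have A': "EE \<le> k8 * (\<beta> * R)"
    proof -
      have "\<beta> * (EQ / 2 + W) \<le> \<beta> * (k6 * R / 2 + k2 * k4 * R)"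
        using EQ_le WR \<beta>1 by (intro mult_left_mono) auto
      moreover have "s0 + K * ln m \<le> k5 * (\<beta> * R)"
      proof -
        have "l + lam \<le> 1 * R" using lR by simp
        also have "\<dots> \<le> \<beta> * R" using \<beta>1 R by (intro mult_right_mono) auto
        finally show ?thesis using noise mult_left_mono[of "l + lam" "\<beta> * R" k5] k5 by linarith
      qed
      ultimately have "EE \<le> k5 * (\<beta> * R) + \<beta> * (k6 * R / 2 + k2 * k4 * R)"
        using EE by linarith
      then show ?thesis by (simp add: k8_def algebra_simps)
    qed
    have \<Phi>': "\<Phi> \<le> 24 * (real T powr (- ph) * m powr (ph / 3)) * ((k7 * R) powr s + (k8 * (\<beta> * R)) powr ph)"
      using \<Phi>[OF _ A _ A'] k7 k8 R \<beta>1 unfolding s_def by simp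
    \<comment> \<open>Since \<open>l0 * b \<le> R\<close>, \<open>\<beta>\<close> itself is at most
      a constant times \<open>R powr (p / (1 - p))\<close>. Hence the extra \<open>\<beta>\<close>
      in the bound for \<open>EE\<close> disappears: \<open>(\<beta> * R) powr ph\<close> is of
      order \<open>R powr (ph / (1 - p))\<close>, like the \<open>Q\<close>-part.\<close>
    have \<beta>_le: "\<beta> \<le> (1 / l0) powr (p / (1 - p)) * R powr (p / (1 - p))"
    proof -
      have "l0 * b \<le> R"
      proof -
        have "l0 * b \<le> b * (l + lam)" using l lam b by (simp add: mult.commute)
        then show ?thesis using bR by simp
      qed
      then have "b \<le> R / l0" using l0 by (simp add: field_simps)
      then have "b powr (p / (1 - p)) \<le> (R / l0) powr (p / (1 - p))"
        using b p by (intro powr_mono2) auto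
      moreover have "b powr (p / (1 - p)) = \<beta>"
      proof -
        have exponent: "(1 / p - 1) * (p / (1 - p)) = 1" using p by (simp add: field_simps)
        show ?thesis unfolding b_def powr_powr exponent using \<beta>1 by simp
      qed
      ultimately show ?thesis using R l0 by (simp add: powr_mult[symmetric])
    qed
    have "(k8 * (\<beta> * R)) powr ph \<le> (k8 * (1 / l0) powr (p / (1 - p)) * R powr (1 / (1 - p))) powr ph"
    proof (intro powr_mono2)
      have "R powr (p / (1 - p)) * R = R powr (p / (1 - p)) * R powr 1" using R by simp
      also have "\<dots> = R powr (p / (1 - p) + 1)" by (rule powr_add[symmetric])
      also have "p / (1 - p) + 1 = 1 / (1 - p)" using p by (simp add: field_simps)
      finally have "(1 / l0) powr (p / (1 - p)) * R powr (p / (1 - p)) * R = (1 / l0) powr (p / (1 - p)) * R powr (1 / (1 - p))"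
        by simp
      moreover have "\<beta> * R \<le> (1 / l0) powr (p / (1 - p)) * R powr (p / (1 - p)) * R"
        using \<beta>_le R by (intro mult_right_mono) auto
      ultimately have "\<beta> * R \<le> (1 / l0) powr (p / (1 - p)) * R powr (1 / (1 - p))" by (simp only:)
      then show "k8 * (\<beta> * R) \<le> k8 * (1 / l0) powr (p / (1 - p)) * R powr (1 / (1 - p))"
        using k8 by (simp add: mult.assoc)
    qed (use k8 \<beta>1 R ph01 in auto)
    also have "\<dots> = (k8 * (1 / l0) powr (p / (1 - p))) powr ph * R powr s"
      using k8 p by (simp add: powr_mult powr_powr s_def)
    finally have "(k7 * R) powr s + (k8 * (\<beta> * R)) powr ph \<le> k9 * R powr s"
      using k7 R by (simp add: k9_def powr_mult algebra_simps)
    also have "R powr s \<le> 4 * (gap powr s + \<beta> powr (ph / p) * l powr s + \<beta> powr (ph / p) * lam powr s)"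
    proof -
      have "(1 / p - 1) * s = ph / p" using p by (simp add: s_def field_simps)
      then have bs: "b powr s = \<beta> powr (ph / p)" by (simp add: b_def powr_powr)
      have "R powr s = (gap + b * l + b * lam) powr s" by (simp add: R_def algebra_simps)
      also have "\<dots> \<le> 4 * (gap powr s + (b * l) powr s + (b * lam) powr s)"
        using gap b l l0 lam s by (intro powr_add3_le) auto
      finally show ?thesis using b l l0 lam by (simp add: powr_mult bs)
    qed
    finally have main: "(k7 * R) powr s + (k8 * (\<beta> * R)) powr ph
        \<le> k9 * 4 * (gap powr s + \<beta> powr (ph / p) * l powr s + \<beta> powr (ph / p) * lam powr s)" (is "_ \<le> k9 * 4 * ?M")
      using k9 by (simp add: algebra_simps)
    have hf: "real T powr (- ph) * m powr (ph / 3)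
        \<le> 2 * (1 + k) * (1 / real T powr ph + \<sigma> powr (2 * ph / 3) / real T powr (2 * ph / 3))" (is "_ \<le> _ * ?N")
      unfolding m_eq using k \<sigma> ph01 T by (intro horizon_factor_le) auto
    have "\<Phi> \<le> 24 * (2 * (1 + k) * ?N) * (k9 * 4 * ?M)"
    proof (rule order_trans[OF \<Phi>'], rule mult_mono)
      show "24 * (real T powr (- ph) * m powr (ph / 3)) \<le> 24 * (2 * (1 + k) * ?N)"
        using hf by (intro mult_left_mono) auto
    qed (use main k in auto)
    also have "\<dots> = 24 * (2 * (1 + k)) * (k9 * 4) * ?M * ?N" by (simp only: mult_ac)
    finally show "\<Phi> \<le> 24 * (2 * (1 + k)) * (k9 * 4) * (gap powr (ph / (1 - p))
        + \<beta> powr (ph / p) * (ln \<beta>) powr (ph / (1 - p))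
        + \<beta> powr (ph / p) * (ln (1 + \<sigma>\<^sup>2 * real T)) powr (ph / (1 - p)))
      * (1 / real T powr ph + \<sigma> powr (2 * ph / 3) / real T powr (2 * ph / 3))"
      unfolding s_def l_def lam_def .
  qed
qed

text \<open>\<open>ph\<close> decreases in \<open>p\<close>, and the end points of the range of
  \<open>p\<close> give the two values. The upper bound amounts to
  \<open>(5 - sqrt 7) * p \<ge> 11 - 4 * sqrt 7\<close>, an equality at
  \<open>p = (3 - sqrt 7) / 2\<close>.\<close>

lemma exponent_range:
  fixes p ph :: real
  assumes "(3 - sqrt 7) / 2 \<le> p" "p \<le> 1 / 2" "ph = 3 * (1 - p) / (4 - p)"
  shows "ph \<in> {3 / 7 .. sqrt 7 - 2}"
proof -
  have s7: "sqrt 7 * sqrt 7 = (7::real)" by simp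
  have "sqrt 7 \<le> sqrt (25::real)" by (rule real_sqrt_le_mono) simp
  then have "sqrt 7 \<le> (5::real)" by simp
  then have "(5 - sqrt 7) * ((3 - sqrt 7) / 2) \<le> (5 - sqrt 7) * p"
    using assms(1) by (intro mult_left_mono) auto
  moreover have "(5 - sqrt 7) * ((3 - sqrt 7) / 2) = 11 - 4 * sqrt 7"
  proof -
    have "(5 - x) * ((3 - x) / 2) = (15 - 8 * x + x * x) / 2" for x :: real
      by (simp add: field_simps)
    then show ?thesis by (simp add: s7)
  qed
  ultimately have "3 * (1 - p) \<le> (sqrt 7 - 2) * (4 - p)"
    by (simp add: algebra_simps)
  then have "ph \<le> sqrt 7 - 2"
    unfolding assms(3) using assms(2) by (subst pos_divide_le_eq) auto
  moreover have "3 / 7 \<le> ph"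
    unfolding assms(3) using assms(2) by (subst pos_le_divide_eq) auto
  ultimately show ?thesis by simp
qed

theorem theoremF3:
  fixes p q ph a0 b0 \<eta> \<sigma>h \<beta>0 :: real
  assumes "(3 - sqrt 7) / 2 \<le> p" and "p \<le> 1 / 2" and "p + 2 * q = 1"
    and "0 < a0" and "0 < b0" and "0 < \<eta>" and "0 \<le> \<sigma>h"
    and "1 < \<beta>0"
    and "ph = 3 * (1 - p) / (4 - p)"
  shows "ph \<in> {3 / 7 .. sqrt 7 - 2} \<and>
    (\<exists>C>0. \<forall>(D :: 'b::second_countable_topology measure) (f :: 'a::euclidean_space \<Rightarrow> 'b \<Rightarrow> real)
        (\<sigma> :: real) (\<beta> :: real) (x1 :: 'a) (T :: nat)
        (P :: 'w measure) (\<xi> :: nat \<Rightarrow> 'w \<Rightarrow> 'b) (\<tau> :: 'w \<Rightarrow> nat)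
        (x :: nat \<Rightarrow> 'w \<Rightarrow> 'a) (a :: nat \<Rightarrow> 'w \<Rightarrow> real) (b :: nat \<Rightarrow> 'w \<Rightarrow> real)
        (d :: nat \<Rightarrow> 'w \<Rightarrow> 'a).
      stochastic_objective D f \<longrightarrow>
      bounded_below D f \<longrightarrow>
      0 \<le> \<sigma> \<longrightarrow> unbiased_bounded_variance D f \<sigma> \<longrightarrow>
      \<beta>0 \<le> \<beta> \<longrightarrow> mean_square_smooth D f \<beta> \<longrightarrow>
      bounded_gradient_differences D f \<sigma>h \<longrightarrow>
      1 \<le> T \<longrightarrow>
      prob_space P \<longrightarrow> iid_samples P D \<xi> \<longrightarrow> uniform_output_index P D \<xi> T \<tau> \<longrightarrow>
      (\<forall>\<omega>\<in>space P. meta_storm (sgrad D f) a0 b0 \<eta> p q x1 T (\<lambda>i. \<xi> i \<omega>)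
         (\<lambda>t. x t \<omega>) (\<lambda>t. a t \<omega>) (\<lambda>t. b t \<omega>) (\<lambda>t. d t \<omega>)) \<longrightarrow>
      (\<integral>\<^sup>+ \<omega>. ennreal (norm (gradient (objective D f) (x (\<tau> \<omega>) \<omega>)) powr (2 * ph)) \<partial>P)
        \<le> ennreal (C *
            ((objective D f x1 - (INF y. objective D f y)) powr (ph / (1 - p))
             + \<beta> powr (ph / p) * (ln \<beta>) powr (ph / (1 - p))
             + \<beta> powr (ph / p) * (ln (1 + \<sigma>\<^sup>2 * real T)) powr (ph / (1 - p)))
            * (1 / real T powr ph + \<sigma> powr (2 * ph / 3) / real T powr (2 * ph / 3))))"
proof -
  have "sqrt 7 < sqrt (9::real)" by (rule real_sqrt_less_mono) simp
  then have p0: "0 < p" using assms(1) by simp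
  \<comment> \<open>Copies of the constants \<open>c\<close> and \<open>K2\<close> of the run. They
    depend only on \<open>a0\<close> and \<open>\<sigma>h\<close>, and they are needed here because
    \<open>C\<close> is chosen before any run exists.\<close>
  define c where "c = 4 * \<sigma>h\<^sup>2 / a0\<^sup>2"
  define K where "K = 2 * (4 * a0\<^sup>2 * (1 + c)
    + (72 * \<sigma>h\<^sup>2 * c + 16 * \<sigma>h\<^sup>2 * (2 * c * (1 + c)) ^ 5 * (1 + c) ^ 4)) * (1 + c)"
  have "0 \<le> c" by (simp add: c_def)
  then have K: "0 \<le> K" unfolding K_def by (auto intro!: mult_nonneg_nonneg add_nonneg_nonneg)
  have s0: "0 \<le> 32 * \<sigma>h\<^sup>2" by simp
  show ?thesis
  proof (rule conjI[OF exponent_range[OF assms(1,2,9)]], rule rate_constant_exists[OF p0 assms(2,4,5,6,8) s0 K assms(9)], goal_cases)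
    case (1 C)
    show ?case
    proof (intro exI[of _ C] conjI allI impI 1(1))
    fix D :: "'b measure" and f :: "'a \<Rightarrow> 'b \<Rightarrow> real" and \<sigma> \<beta> :: real and x1 :: 'a and T :: nat
      and P :: "'w measure" and \<xi> :: "nat \<Rightarrow> 'w \<Rightarrow> 'b" and \<tau> :: "'w \<Rightarrow> nat"
      and x :: "nat \<Rightarrow> 'w \<Rightarrow> 'a" and a b :: "nat \<Rightarrow> 'w \<Rightarrow> real" and d :: "nat \<Rightarrow> 'w \<Rightarrow> 'a"
    assume h: "stochastic_objective D f" "bounded_below D f" "unbiased_bounded_variance D f \<sigma>"
      "mean_square_smooth D f \<beta>" "bounded_gradient_differences D f \<sigma>h" "iid_samples P D \<xi>"
      and \<sigma>: "0 \<le> \<sigma>" and \<beta>: "\<beta>0 \<le> \<beta>" and T: "1 \<le> T" and P: "prob_space P"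
      and out: "uniform_output_index P D \<xi> T \<tau>"
      and run: "\<forall>\<omega>\<in>space P. meta_storm (sgrad D f) a0 b0 \<eta> p q x1 T (\<lambda>i. \<xi> i \<omega>)
         (\<lambda>t. x t \<omega>) (\<lambda>t. a t \<omega>) (\<lambda>t. b t \<omega>) (\<lambda>t. d t \<omega>)"
    interpret P: prob_space P by (rule P)
    interpret run: meta_storm_run D f \<sigma> \<beta> \<sigma>h P \<xi> x1 T a0 b0 \<eta> p q x a b d
      using h \<beta> T run assms p0 by unfold_locales auto
    have ph: "run.ph = ph" unfolding run.ph_def assms(9) ..
    have K2: "run.K2 = K" unfolding run.K2_def run.K1_def run.c_def K_def c_def ..
    have "(\<integral>\<^sup>+ \<omega>. ennreal (norm (gradient (objective D f) (x (\<tau> \<omega>) \<omega>)) powr (2 * ph)) \<partial>P)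
      = ennreal ((\<Sum>t=1..T. P.expectation (\<lambda>\<omega>. norm (gradient (objective D f) (x t \<omega>)) powr (2 * ph))) / real T)"
      using run.nn_integral_output[OF out] unfolding ph .
    also have "\<dots> \<le> ennreal (C *
            (run.gap powr (ph / (1 - p))
             + \<beta> powr (ph / p) * (ln \<beta>) powr (ph / (1 - p))
             + \<beta> powr (ph / p) * (ln (1 + \<sigma>\<^sup>2 * real T)) powr (ph / (1 - p)))
            * (1 / real T powr ph + \<sigma> powr (2 * ph / 3) / real T powr (2 * ph / 3)))"
      by (intro ennreal_leI 1(2)[OF \<beta> \<sigma> run.gap_nonneg T run.m_def run.y0_def run.W_def
        run.expectation_Q_bound[unfolded K2] run.expectation_EE_bound[unfolded K2]
        run.mean_gradient_powr_le[unfolded ph]])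
    finally show "(\<integral>\<^sup>+ \<omega>. ennreal (norm (gradient (objective D f) (x (\<tau> \<omega>) \<omega>)) powr (2 * ph)) \<partial>P)
        \<le> ennreal (C *
            ((objective D f x1 - (INF y. objective D f y)) powr (ph / (1 - p))
             + \<beta> powr (ph / p) * (ln \<beta>) powr (ph / (1 - p))
             + \<beta> powr (ph / p) * (ln (1 + \<sigma>\<^sup>2 * real T)) powr (ph / (1 - p)))
            * (1 / real T powr ph + \<sigma> powr (2 * ph / 3) / real T powr (2 * ph / 3)))"
      unfolding run.gap_def .
    qed
  qed
qed

end
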